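(* For $n=1,2$ let $\Psi_n\subset\mathcal{H}_n$ be an $\mathcal{A}_n$-localised frame for the separable Hilbert space $\mathcal{H}_n$, and let $w_n$ be an $\mathcal{A}_n$-admissible weight. To any $K\in\mathcal{H}^{\infty,\infty}_{1/(w_1\otimes w_2)}(\Psi_1\otimes\Psi_2)$ corresponds a unique bounded linear operator $O:\mathcal{H}^1_{w_1}(\Psi_1)\to\mathcal{H}^\infty_{1/w_2}(\Psi_2)$ by means of $$\langle Of_1,f_2\rangle_{\mathcal{H}^\infty_{1/w_2}(\Psi_2),\,\mathcal{H}^1_{w_2}(\Psi_2)}=\langle K,f_1\otimes f_2\rangle_{\mathcal{H}^{\infty,\infty}_{1/(w_1\otimes w_2)}(\Psi_1\otimes\Psi_2),\,\mathcal{H}^{1,1}_{w_1\otimes w_2}(\Psi_1\otimes\Psi_2)}\qquad( * )$$ for all $f_1\in\mathcal{H}^1_{w_1}(\Psi_1)$ and all $f_2\in\mathcal{H}^1_{w_2}(\Psi_2)$. Moreover, $$\|K\|_{\mathcal{H}^{\infty,\infty}_{1/(w_1\otimes w_2)}(\Psi_1\otimes\Psi_2)}\asymp\|O\|_{\mathcal{H}^1_{w_1}(\Psi_1)\to\mathcal{H}^\infty_{1/w_2}(\Psi_2)},$$ with constants independent of $K$ and $O$. Conversely, to any bounded linear operator $O:\mathcal{H}^1_{w_1}(\Psi_1)\to\mathcal{H}^\infty_{1/w_2}(\Psi_2)$ corresponds a unique $K\in\mathcal{H}^{\infty,\infty}_{1/(w_1\otimes w_2)}(\Psi_1\otimes\Psi_2)$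 (called the kernel of $O$) that satisfies $( * )$ for every $f_1\in\mathcal{H}^1_{w_1}(\Psi_1)$ and $f_2\in\mathcal{H}^1_{w_2}(\Psi_2)$.
   Context: Conventions. Hilbert spaces are separable, with inner products linear in the first argument. $A\asymp B$ means $C^{-1}B\le A\le CB$ for some constant $C\ge1$. Frames. A countable family $\Psi=\{\psi_i\}_{i\in I}\subset\mathcal{H}$ is a frame if $A\|f\|^2\le\sum_i|\langle f,\psi_i\rangle|^2\le B\|f\|^2$ for all $f\in\mathcal{H}$ and some $A,B>0$. $C_\Psi f=\{\langle f,\psi_i\rangle\}_{i}$, $D_\Psi c=\sum_i c_i\psi_i$, $S_\Psi=D_\Psi C_\Psi$; the canonical dual frame is $\widetilde\Psi=\{\widetilde\psi_i\}=\{S_\Psi^{-1}\psi_i\}$. The Gram matrix is $G_\Psi=(\langle\psi_{i'},\psi_i\rangle)_{(i,i')\in I^2}$. Localisation. A spectral matrix algebra $\mathcal{A}$ is an involutive Banach algebra of infinite matrices indexed by $I\times I$ (involution: conjugate transpose) such that (a) every $A\in\mathcal{A}$ defines a bounded operator on $\ell^2(I)$; (b) if $A\in\mathcal{A}$ is invertible in $B(\ell^2(I))$ then $A^{-1}\in\mathcal{A}$; (c) $\mathcal{A}$ is solid: $A\in\mathcal{A}$ and $|b_{i,j}|\le|a_{i,j}|$ for all $i,j$ imply $B\in\mathcal{A}$ and $\|B\|_{\mathcal{A}}\le\|A\|_{\mathcal{A}}$. A frame $\Psi$ is $\mathcal{A}$-localised if $G_\Psi\in\mathcal{A}$. For a weight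 $w=\{w_i\}$, $w_i>0$, put $\|c\|_{\ell^p_w(I)}=\|c\cdot w\|_{\ell^p(I)}$; $w$ is $\mathcal{A}$-admissible if every $A\in\mathcal{A}$ defines a bounded operator on $\ell^p_w(I)$ for every $1\le p\le\infty$. Here $\mathcal{A}_1,\mathcal{A}_2$ are spectral matrix algebras over the index sets $I$ and $J$ of $\Psi_1=\{\psi_{1,i}\}_{i\in I}$ and $\Psi_2=\{\psi_{2,j}\}_{j\in J}$. Co-orbit spaces. $\mathcal{H}_{00}(\Psi)$ is the space of finite linear combinations of the $\psi_i$. For $1\le p<\infty$, $\mathcal{H}^p_w(\Psi)$ is the completion of $\mathcal{H}_{00}(\Psi)$ in the norm $\|f\|_{\mathcal{H}^p_w(\Psi)}=\|C_{\widetilde\Psi}f\|_{\ell^p_w}$. $\mathcal{H}^\infty_w(\Psi)$ is the space of equivalence classes of sequences $\{f_n\}\subset\mathcal{H}$ such that $(C_{\widetilde\Psi}f)_i:=\lim_n\langle f_n,\widetilde\psi_i\rangle$ exists for all $i$ and $\sup_n\|C_{\widetilde\Psi}f_n\|_{\ell^\infty_w}<\infty$, where $\{f_n\}\sim\{f_n'\}$ iff $\lim_n\langle f_n-f'_n,\widetilde\psi_i\rangle=0$ for all $i$, with norm $\|C_{\widetilde\Psi}f\|_{\ell^\infty_w}$. $C_{\widetilde\Psi}$ and $C_\Psi$ are extended to these spaces by continuity (respectively limits), so $(C_\Psi g)_i=\sum_j\langle\psi_j,\psi_i\rangle(C_{\widetilde\Psi}g)_j$. The pairing of $\mathcal{H}^p_w(\Psi)$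 and $\mathcal{H}^q_{1/w}(\Psi)$, $1/p+1/q=1$, is $\langle f,g\rangle=\sum_i(C_{\widetilde\Psi}f)_i\overline{(C_\Psi g)_i}$. Tensor products. $f_1\otimes f_2$ is the rank-one operator $f\mapsto\langle f,f_1\rangle f_2$ (antilinear in $f_1$); $\mathcal{H}_1\otimes\mathcal{H}_2$ is the Hilbert space completion of the span of simple tensors under $\langle f_1\otimes f_2,g_1\otimes g_2\rangle=\overline{\langle f_1,g_1\rangle}\langle f_2,g_2\rangle$. $\Psi_1\otimes\Psi_2=\{\psi_{1,i}\otimes\psi_{2,j}\}_{(i,j)\in I\times J}$ is a frame for it with canonical dual $\widetilde{\Psi_1\otimes\Psi_2}=\widetilde\Psi_1\otimes\widetilde\Psi_2$. $(w_1\otimes w_2)_{i,j}=w_{1,i}w_{2,j}$. $\ell^{p,p}_w(I\times J)$ is the weighted $\ell^p$ space on $I\times J$. $\mathcal{H}^{1,1}_w(\Psi_1\otimes\Psi_2)$ is the completion of the span $\mathcal{H}_{00}(\Psi_1\otimes\Psi_2)$ of $\Psi_1\otimes\Psi_2$ in the norm $\|C_{\widetilde{\Psi_1\otimes\Psi_2}}F\|_{\ell^{1,1}_w}$. $\mathcal{H}^{\infty,\infty}_w(\Psi_1\otimes\Psi_2)$ is the space of equivalence classes of sequences $\{F_n\}\subset\mathcal{H}_1\otimes\mathcal{H}_2$ such that $(C_{\widetilde{\Psi_1\otimes\Psi_2}}F)_{i,j}:=\lim_n\langle F_n,\widetilde\psi_{1,i}\otimes\widetilde\psi_{2,j}\rangle$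 exists for all $(i,j)$ and $\sup_n\|C_{\widetilde{\Psi_1\otimes\Psi_2}}F_n\|_{\ell^{\infty,\infty}_w}<\infty$ (two sequences being equivalent iff $\lim_n\langle F_n-F'_n,\widetilde\psi_{1,i}\otimes\widetilde\psi_{2,j}\rangle=0$ for all $(i,j)$), with norm $\|C_{\widetilde{\Psi_1\otimes\Psi_2}}F\|_{\ell^{\infty,\infty}_w}$. The pairing is $\langle F,G\rangle=\sum_{i,j}(C_{\widetilde{\Psi_1\otimes\Psi_2}}F)_{i,j}\overline{(C_{\Psi_1\otimes\Psi_2}G)_{i,j}}$, with $C_{\Psi_1\otimes\Psi_2}$ extended in the same way as $C_\Psi$. For $f_n$ in co-orbit spaces, $f_1\otimes f_2$ is the element with coefficients $(C_{\widetilde{\Psi_1\otimes\Psi_2}}(f_1\otimes f_2))_{i,j}=\overline{(C_{\widetilde\Psi_1}f_1)_i}\,(C_{\widetilde\Psi_2}f_2)_j$.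
   Formalization: The spectral matrix algebras are assumed to contain the identity matrix; without it condition (b) can be vacuous (no invertible elements) and the kernel need not be unique. If the algebra contains any invertible operator, (b) already gives the identity. *)

theory Defs
  imports "HOL-Analysis.Analysis"
begin

section \<open>Complex Hilbert spaces\<close>

class complex_vector = real_vector +
  fixes scaleC :: "complex \<Rightarrow> 'a \<Rightarrow> 'a"  (infixr \<open>*\<^sub>C\<close> 75)
  assumes scaleC_add_right: "c *\<^sub>C (x + y) = c *\<^sub>C x + c *\<^sub>C y"
    and scaleC_add_left: "(c + d) *\<^sub>C x = c *\<^sub>C x + d *\<^sub>C x"
    and scaleC_scaleC: "c *\<^sub>C (d *\<^sub>C x) = (c * d) *\<^sub>C x"
    and scaleR_scaleC: "r *\<^sub>R x = complex_of_real r *\<^sub>C x"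

text \<open>The inner product is linear in its first argument.\<close>

class complex_inner = complex_vector + real_normed_vector +
  fixes cinner :: "'a \<Rightarrow> 'a \<Rightarrow> complex"
  assumes cinner_commute: "cinner x y = cnj (cinner y x)"
    and cinner_add_left: "cinner (x + y) z = cinner x z + cinner y z"
    and cinner_scaleC_left: "cinner (c *\<^sub>C x) y = c * cinner x y"
    and cinner_norm: "cinner x x = complex_of_real ((norm x)\<^sup>2)"

class complex_hilbert = complex_inner + complete_space

lemma scaleC_one [simp]: "1 *\<^sub>C (x :: 'a::complex_vector) = x"
  using scaleR_scaleC[of 1 x] by simp

lemma scaleC_zero_left [simp]: "0 *\<^sub>C (x :: 'a::complex_vector) = 0"
  using scaleC_add_left[of 0 0 x] by simp

lemma scaleC_zero_right [simp]: "c *\<^sub>C (0 :: 'a::complex_vector) = 0"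
  using scaleC_add_right[of c 0 0] by simp

lemma scaleC_minus_one: "(- 1) *\<^sub>C (x :: 'a::complex_vector) = - x"
  using scaleC_add_left[of 1 "-1" x] by (simp add: eq_neg_iff_add_eq_0 add.commute)

lemma scaleC_minus_left: "(- c) *\<^sub>C (x :: 'a::complex_vector) = - (c *\<^sub>C x)"
  using scaleC_scaleC[of "-1" c x] by (simp add: scaleC_minus_one)

lemma scaleC_minus_right: "c *\<^sub>C (- x :: 'a::complex_vector) = - (c *\<^sub>C x)"
  using scaleC_scaleC[of c "-1" x] by (simp add: scaleC_minus_one scaleC_minus_left)

lemma scaleC_sum_right:
  "c *\<^sub>C (\<Sum>k\<in>A. f k) = (\<Sum>k\<in>A. c *\<^sub>C (f k :: 'a::complex_vector))"
  by (induction A rule: infinite_finite_induct) (auto simp: scaleC_add_right)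

lemma scaleC_sum_left:
  "(\<Sum>k\<in>A. c k) *\<^sub>C (x :: 'a::complex_vector) = (\<Sum>k\<in>A. c k *\<^sub>C x)"
  by (induction A rule: infinite_finite_induct) (auto simp: scaleC_add_left)

lemma sesquilinear_cauchy_schwarz:
  fixes ip :: "'a::complex_vector \<Rightarrow> 'a \<Rightarrow> complex"
  assumes comm: "\<And>x y. ip x y = cnj (ip y x)"
    and add: "\<And>x y z. ip (x + y) z = ip x z + ip y z"
    and scale: "\<And>c x y. ip (c *\<^sub>C x) y = c * ip x y"
    and pos: "\<And>x. 0 \<le> Re (ip x x)"
    and definite: "\<And>x. Re (ip x x) = 0 \<Longrightarrow> x = 0"
  shows "(cmod (ip x y))\<^sup>2 \<le> Re (ip x x) * Re (ip y y)"
proof (cases "y = 0")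
  case True
  have "ip 0 x = 0" using scale[of 0 0 x] by simp
  then show ?thesis using True comm[of x 0] pos by simp
next
  case False
  define q where "q = Re (ip y y)"
  have q: "ip y y = complex_of_real q"
    using comm[of y y] by (simp add: q_def complex_eq_iff)
  have qpos: "q > 0" using pos[of y] definite[of y] False unfolding q_def by fastforce
  define t where "t = - ip x y / q"
  have scale_r: "ip u (c *\<^sub>C v) = cnj c * ip u v" for u v c
    by (metis comm scale complex_cnj_mult)
  have add_r: "ip u (v + w) = ip u v + ip u w" for u v w
    by (metis comm add complex_cnj_add)
  have "ip (x + t *\<^sub>C y) (x + t *\<^sub>C y)
      = ip x x + t * ip y x + cnj t * ip x y + t * cnj t * q"
    by (simp add: add add_r scale scale_r q algebra_simps)
  also have "t * ip y x = - (ip x y * cnj (ip x y)) / q"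
    using comm[of y x] by (simp add: t_def)
  also have "cnj t * ip x y = - (ip x y * cnj (ip x y)) / q"
    by (simp add: t_def)
  also have "t * cnj t * q = (ip x y * cnj (ip x y)) / q"
    using qpos by (simp add: t_def)
  finally have "ip (x + t *\<^sub>C y) (x + t *\<^sub>C y) = ip x x - (ip x y * cnj (ip x y)) / q"
    by simp
  also have "ip x y * cnj (ip x y) = complex_of_real ((cmod (ip x y))\<^sup>2)"
    by (metis complex_norm_square)
  finally have "Re (ip (x + t *\<^sub>C y) (x + t *\<^sub>C y)) = Re (ip x x) - (cmod (ip x y))\<^sup>2 / q"
    by simp
  with pos[of "x + t *\<^sub>C y"] have "(cmod (ip x y))\<^sup>2 / q \<le> Re (ip x x)" by simp
  then show ?thesis using qpos by (simp add: field_simps q_def)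
qed

lemma sesquilinear_triangle:
  fixes ip :: "'a::complex_vector \<Rightarrow> 'a \<Rightarrow> complex"
  assumes comm: "\<And>x y. ip x y = cnj (ip y x)"
    and add: "\<And>x y z. ip (x + y) z = ip x z + ip y z"
    and scale: "\<And>c x y. ip (c *\<^sub>C x) y = c * ip x y"
    and pos: "\<And>x. 0 \<le> Re (ip x x)"
    and definite: "\<And>x. Re (ip x x) = 0 \<Longrightarrow> x = 0"
  shows "sqrt (Re (ip (x + y) (x + y))) \<le> sqrt (Re (ip x x)) + sqrt (Re (ip y y))"
proof (rule real_le_lsqrt)
  have add_r: "ip u (v + w) = ip u v + ip u w" for u v w
    by (metis comm add complex_cnj_add)
  have "cmod (ip x y) \<le> sqrt (Re (ip x x) * Re (ip y y))"
    by (rule real_le_rsqrt[OF sesquilinear_cauchy_schwarz[of ip, OF comm add scale pos definite]])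
  then have "Re (ip x y) \<le> sqrt (Re (ip x x)) * sqrt (Re (ip y y))"
    using complex_Re_le_cmod[of "ip x y"] by (simp add: real_sqrt_mult)
  moreover have "Re (ip y x) = Re (ip x y)" using comm[of x y] by simp
  ultimately show "Re (ip (x + y) (x + y)) \<le> (sqrt (Re (ip x x)) + sqrt (Re (ip y y)))\<^sup>2"
    using pos by (simp add: add add_r power2_sum)
qed (use pos in auto)

lemma cinner_add_right: "cinner (x :: 'a::complex_inner) (y + z) = cinner x y + cinner x z"
  by (metis cinner_commute cinner_add_left complex_cnj_add)

lemma cinner_scaleC_right: "cinner (x :: 'a::complex_inner) (c *\<^sub>C y) = cnj c * cinner x y"
  by (metis cinner_commute cinner_scaleC_left complex_cnj_mult)

lemma cinner_zero_left [simp]: "cinner 0 (x :: 'a::complex_inner) = 0"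
  using cinner_add_left[of 0 0 x] by simp

lemma cinner_zero_right [simp]: "cinner (x :: 'a::complex_inner) 0 = 0"
  using cinner_add_right[of x 0 0] by simp

lemma cinner_sum_left: "cinner (\<Sum>k\<in>A. f k) (y :: 'a::complex_inner) = (\<Sum>k\<in>A. cinner (f k) y)"
  by (induction A rule: infinite_finite_induct) (auto simp: cinner_add_left)

lemma cinner_sum_right: "cinner (x :: 'a::complex_inner) (\<Sum>k\<in>A. f k) = (\<Sum>k\<in>A. cinner x (f k))"
  by (induction A rule: infinite_finite_induct) (auto simp: cinner_add_right)

lemma cinner_minus_left: "cinner (- x) y = - cinner x (y :: 'a::complex_inner)"
  using cinner_add_left[of x "-x" y] by (simp add: add_eq_0_iff)

lemma cinner_minus_right: "cinner x (- y) = - cinner x (y :: 'a::complex_inner)"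
  using cinner_scaleC_right[of x "-1" y] by (simp add: scaleC_minus_one)

lemma cinner_diff_left: "cinner (x - y) z = cinner x z - cinner y (z :: 'a::complex_inner)"
  using cinner_add_left[of x "-y" z] by (simp add: cinner_minus_left)

lemma norm_cinner_le: "cmod (cinner x y) \<le> norm x * norm (y :: 'a::complex_inner)"
proof -
  have "(cmod (cinner x y))\<^sup>2 \<le> Re (cinner x x) * Re (cinner y y)"
    by (rule sesquilinear_cauchy_schwarz)
      (auto simp: cinner_add_left cinner_scaleC_left cinner_norm intro: cinner_commute)
  then have "(cmod (cinner x y))\<^sup>2 \<le> (norm x * norm y)\<^sup>2"
    by (simp add: cinner_norm power_mult_distrib)
  then show ?thesis by (rule power2_le_imp_le) simp
qed

lemma norm_scaleC: "norm (c *\<^sub>C (x :: 'a::complex_inner)) = cmod c * norm x"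
proof -
  have "complex_of_real ((norm (c *\<^sub>C x))\<^sup>2) = c * cnj c * complex_of_real ((norm x)\<^sup>2)"
    by (metis cinner_norm cinner_scaleC_left cinner_scaleC_right mult.assoc)
  also have "c * cnj c = complex_of_real ((cmod c)\<^sup>2)" by (metis complex_norm_square)
  finally have "complex_of_real ((norm (c *\<^sub>C x))\<^sup>2) = complex_of_real ((cmod c * norm x)\<^sup>2)"
    by (simp add: power_mult_distrib)
  then have "(norm (c *\<^sub>C x))\<^sup>2 = (cmod c * norm x)\<^sup>2" using of_real_eq_iff by blast
  then show ?thesis by (simp add: power2_eq_iff_nonneg)
qed

section \<open>Completion of a complex inner product space\<close>

text \<open>The completion of \<open>'a\<close> is the closure of the isometric image
  \<open>v \<mapsto> \<langle>v, \<cdot>\<rangle>\<close> of \<open>'a\<close> in the Banach space of bounded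
  real-linear maps \<open>'a \<Rightarrow>\<^sub>L complex\<close>.\<close>

lemma bounded_linear_cinner_right: "bounded_linear (\<lambda>u. cinner v (u :: 'a::complex_inner))"
  by (rule bounded_linear_intro[where K = "norm v"])
    (auto simp: cinner_add_right cinner_scaleC_right scaleR_scaleC norm_cinner_le mult.commute[of "norm _" "norm v"]
      scaleR_conv_of_real)

definition cinner_functional :: "'a::complex_inner \<Rightarrow> 'a \<Rightarrow>\<^sub>L complex" where
  "cinner_functional v = Blinfun (\<lambda>u. cinner v u)"

lemma cinner_functional_apply [simp]: "blinfun_apply (cinner_functional v) u = cinner v u"
  by (simp add: cinner_functional_def bounded_linear_Blinfun_apply bounded_linear_cinner_right)

lemma cinner_functional_add: "cinner_functional (u + v) = cinner_functional u + cinner_functional v"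
  by (rule blinfun_eqI) (simp add: blinfun.add_left cinner_add_left)

lemma cinner_functional_diff: "cinner_functional (u - v) = cinner_functional u - cinner_functional v"
  by (rule blinfun_eqI) (simp add: blinfun.diff_left cinner_diff_left)

lemma norm_cinner_functional [simp]: "norm (cinner_functional v) = norm v"
proof (rule antisym)
  show "norm (cinner_functional v) \<le> norm v"
    by (rule norm_blinfun_bound) (auto simp: norm_cinner_le)
  have "norm (cinner v v) \<le> norm (cinner_functional v) * norm v"
    using norm_blinfun[of "cinner_functional v" v] by simp
  then have "norm v * norm v \<le> norm (cinner_functional v) * norm v"
    by (simp add: cinner_norm norm_power power2_eq_square norm_mult)
  then show "norm v \<le> norm (cinner_functional v)"
    by (cases "v = 0") auto
qed

definition blinfun_scaleC :: "complex \<Rightarrow> ('a::real_normed_vector \<Rightarrow>\<^sub>L complex) \<Rightarrow> 'a \<Rightarrow>\<^sub>L complex"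
  where "blinfun_scaleC c x = blinfun_mult_right c o\<^sub>L x"

lemma blinfun_scaleC_apply [simp]: "blinfun_apply (blinfun_scaleC c x) u = c * blinfun_apply x u"
  by (simp add: blinfun_scaleC_def)

lemma cinner_functional_scaleC:
  "cinner_functional (c *\<^sub>C v) = blinfun_scaleC c (cinner_functional v)"
  by (rule blinfun_eqI) (simp add: cinner_scaleC_left)

typedef (overloaded) 'a hilbert_completion =
  "closure (range (cinner_functional :: 'a::complex_inner \<Rightarrow> 'a \<Rightarrow>\<^sub>L complex))"
  morphisms functional_of_completion Abs_hilbert_completion
  by (meson closure_subset rangeI subsetD)

setup_lifting type_definition_hilbert_completion

lemma completion_closure_add:
  assumes "x \<in> closure (range (cinner_functional :: 'a::complex_inner \<Rightarrow> _))"
    and "y \<in> closure (range (cinner_functional :: 'a::complex_inner \<Rightarrow> _))"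
  shows "x + y \<in> closure (range (cinner_functional :: 'a::complex_inner \<Rightarrow> _))"
proof -
  obtain f g where f: "\<And>n. f n \<in> range (cinner_functional :: 'a \<Rightarrow> _)" "f \<longlonglongrightarrow> x"
    and g: "\<And>n. g n \<in> range (cinner_functional :: 'a \<Rightarrow> _)" "g \<longlonglongrightarrow> y"
    using assms unfolding closure_sequential by blast
  have "f n + g n \<in> range (cinner_functional :: 'a \<Rightarrow> _)" for n
    using f(1)[of n] g(1)[of n] by (auto simp flip: cinner_functional_add)
  moreover have "(\<lambda>n. f n + g n) \<longlonglongrightarrow> x + y"
    by (rule tendsto_add[OF f(2) g(2)])
  ultimately show ?thesis
    unfolding closure_sequential by (intro exI[of _ "\<lambda>n. f n + g n"]) auto
qed

lemma bounded_linear_blinfun_scaleC: "bounded_linear (blinfun_scaleC c)"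
  unfolding blinfun_scaleC_def by (rule bounded_linear_intros bounded_linear_ident)+

lemma completion_closure_scaleC:
  assumes "x \<in> closure (range (cinner_functional :: 'a::complex_inner \<Rightarrow> _))"
  shows "blinfun_scaleC c x \<in> closure (range (cinner_functional :: 'a::complex_inner \<Rightarrow> _))"
proof -
  obtain f where f: "\<And>n. f n \<in> range (cinner_functional :: 'a \<Rightarrow> _)" "f \<longlonglongrightarrow> x"
    using assms by (meson closure_sequential)
  have "blinfun_scaleC c (f n) \<in> range (cinner_functional :: 'a \<Rightarrow> _)" for n
    using f(1)[of n] by (auto simp flip: cinner_functional_scaleC)
  then show ?thesis
    unfolding closure_sequential using bounded_linear.tendsto[OF bounded_linear_blinfun_scaleC f(2)]
    by (intro exI[of _ "\<lambda>n. blinfun_scaleC c (f n)"]) auto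
qed

lemma blinfun_scaleC_real: "blinfun_scaleC (complex_of_real r) x = r *\<^sub>R x"
  by (rule blinfun_eqI) (simp add: blinfun.scaleR_left scaleR_conv_of_real)

lemma completion_closure_scaleR:
  assumes "x \<in> closure (range (cinner_functional :: 'a::complex_inner \<Rightarrow> _))"
  shows "r *\<^sub>R x \<in> closure (range (cinner_functional :: 'a::complex_inner \<Rightarrow> _))"
  using completion_closure_scaleC[OF assms, of "complex_of_real r"] by (simp add: blinfun_scaleC_real)

instantiation hilbert_completion :: (complex_inner) real_normed_vector
begin

lift_definition zero_hilbert_completion :: "'a hilbert_completion" is 0
proof -
  have "cinner_functional (0::'a) = 0" by (rule blinfun_eqI) simp
  then show "0 \<in> closure (range (cinner_functional :: 'a \<Rightarrow> _))"
    by (metis closure_subset rangeI subsetD)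
qed

lift_definition plus_hilbert_completion ::
  "'a hilbert_completion \<Rightarrow> 'a hilbert_completion \<Rightarrow> 'a hilbert_completion" is "(+)"
  by (rule completion_closure_add)

lift_definition uminus_hilbert_completion :: "'a hilbert_completion \<Rightarrow> 'a hilbert_completion"
  is uminus
  using completion_closure_scaleR[where r = "-1"] by auto

lift_definition minus_hilbert_completion ::
  "'a hilbert_completion \<Rightarrow> 'a hilbert_completion \<Rightarrow> 'a hilbert_completion" is "(-)"
  subgoal for x y
    using completion_closure_add[OF _ completion_closure_scaleR[where r = "-1"], of x y] by simp
  done

lift_definition scaleR_hilbert_completion ::
  "real \<Rightarrow> 'a hilbert_completion \<Rightarrow> 'a hilbert_completion" is "(*\<^sub>R)"
  by (rule completion_closure_scaleR)

lift_definition norm_hilbert_completion :: "'a hilbert_completion \<Rightarrow> real" is norm .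

definition sgn_hilbert_completion :: "'a hilbert_completion \<Rightarrow> 'a hilbert_completion"
  where "sgn_hilbert_completion x = scaleR (inverse (norm x)) x"

definition dist_hilbert_completion :: "'a hilbert_completion \<Rightarrow> 'a hilbert_completion \<Rightarrow> real"
  where "dist_hilbert_completion x y = norm (x - y)"

definition uniformity_hilbert_completion ::
    "('a hilbert_completion \<times> 'a hilbert_completion) filter"
  where "uniformity_hilbert_completion = (INF e\<in>{0 <..}. principal {(x, y). dist x y < e})"

definition open_hilbert_completion :: "'a hilbert_completion set \<Rightarrow> bool"
  where "open_hilbert_completion S = (\<forall>x\<in>S. \<forall>\<^sub>F (x', y) in uniformity. x' = x \<longrightarrow> y \<in> S)"

instance
proof
  fix x y z :: "'a hilbert_completion" and r t :: real
  show "x + y + z = x + (y + z)" by transfer (rule add.assoc)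
  show "x + y = y + x" by transfer (rule add.commute)
  show "0 + x = x" by transfer simp
  show "- x + x = 0" by transfer simp
  show "x - y = x + - y" by transfer simp
  show "r *\<^sub>R (x + y) = r *\<^sub>R x + r *\<^sub>R y" by transfer (rule scaleR_add_right)
  show "(r + t) *\<^sub>R x = r *\<^sub>R x + t *\<^sub>R x" by transfer (rule scaleR_add_left)
  show "r *\<^sub>R t *\<^sub>R x = (r * t) *\<^sub>R x" by transfer simp
  show "1 *\<^sub>R x = x" by transfer simp
  show "norm x = 0 \<longleftrightarrow> x = 0" by transfer simp
  show "norm (x + y) \<le> norm x + norm y" by transfer (rule norm_triangle_ineq)
  show "norm (r *\<^sub>R x) = \<bar>r\<bar> * norm x" by transfer simp
qed (simp_all only: dist_hilbert_completion_def sgn_hilbert_completion_def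
    uniformity_hilbert_completion_def open_hilbert_completion_def)

end

instance hilbert_completion :: (complex_inner) complete_space
proof
  fix X :: "nat \<Rightarrow> 'a hilbert_completion"
  let ?F = "functional_of_completion :: 'a hilbert_completion \<Rightarrow> _"
  assume "Cauchy X"
  then have "Cauchy (\<lambda>n. ?F (X n))"
    by (simp add: Cauchy_def dist_norm norm_hilbert_completion.rep_eq minus_hilbert_completion.rep_eq)
  then obtain l where l: "(\<lambda>n. ?F (X n)) \<longlonglongrightarrow> l"
    by (meson Cauchy_convergent convergent_def)
  have "l \<in> closure (range (cinner_functional :: 'a \<Rightarrow> _))"
    by (rule Lim_in_closed_set[OF _ _ _ l])
      (auto intro!: always_eventually functional_of_completion)
  then have "?F (Abs_hilbert_completion l) = l"
    by (rule Abs_hilbert_completion_inverse)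
  with l have "X \<longlonglongrightarrow> Abs_hilbert_completion l"
    by (simp add: LIMSEQ_def dist_norm norm_hilbert_completion.rep_eq
        minus_hilbert_completion.rep_eq)
  then show "convergent X" by (auto simp: convergent_def)
qed

instantiation hilbert_completion :: (complex_inner) complex_vector
begin

lift_definition scaleC_hilbert_completion ::
  "complex \<Rightarrow> 'a hilbert_completion \<Rightarrow> 'a hilbert_completion" is blinfun_scaleC
  by (rule completion_closure_scaleC)

instance
proof
  fix c d :: complex and r :: real and x y :: "'a hilbert_completion"
  show "c *\<^sub>C (x + y) = c *\<^sub>C x + c *\<^sub>C y"
    by transfer (rule blinfun_eqI, simp add: blinfun.add_left distrib_left)
  show "(c + d) *\<^sub>C x = c *\<^sub>C x + d *\<^sub>C x"
    by transfer (rule blinfun_eqI, simp add: blinfun.add_left distrib_right)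
  show "c *\<^sub>C (d *\<^sub>C x) = (c * d) *\<^sub>C x"
    by transfer (rule blinfun_eqI, simp)
  show "r *\<^sub>R x = complex_of_real r *\<^sub>C x"
    by transfer (simp add: blinfun_scaleC_real)
qed

end

lift_definition to_completion :: "'a::complex_inner \<Rightarrow> 'a hilbert_completion"
  is cinner_functional
  by (meson closure_subset rangeI subsetD)

lemma to_completion_add: "to_completion (x + y) = to_completion x + to_completion y"
  by transfer (rule cinner_functional_add)

lemma to_completion_diff: "to_completion (x - y) = to_completion x - to_completion y"
  by transfer (rule cinner_functional_diff)

lemma to_completion_scaleC: "to_completion (c *\<^sub>C x) = c *\<^sub>C to_completion x"
  by transfer (rule cinner_functional_scaleC)

lemma norm_to_completion [simp]: "norm (to_completion x) = norm x"
  by transfer simp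

lemma to_completion_dense: "\<exists>f. (\<lambda>n. to_completion (f n)) \<longlonglongrightarrow> x"
proof -
  let ?F = "functional_of_completion :: 'a hilbert_completion \<Rightarrow> _"
  have "?F x \<in> closure (range (cinner_functional :: 'a \<Rightarrow> _))"
    by (rule functional_of_completion)
  then obtain g where g: "\<And>n. g n \<in> range (cinner_functional :: 'a \<Rightarrow> _)" "g \<longlonglongrightarrow> ?F x"
    by (meson closure_sequential)
  define f where "f n = (SOME v. g n = cinner_functional v)" for n
  have "g n = cinner_functional (f n)" for n
    unfolding f_def using g(1)[of n] by (metis (mono_tags, lifting) imageE someI_ex)
  then have "(\<lambda>n. to_completion (f n)) \<longlonglongrightarrow> x"
    using g(2) by (simp add: LIMSEQ_def dist_norm norm_hilbert_completion.rep_eq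
        minus_hilbert_completion.rep_eq to_completion.rep_eq)
  then show ?thesis by blast
qed

text \<open>The inner product on the completion is the continuous extension of the given one; it is
  obtained from the norm by polarization.\<close>

lemma cinner_polarization:
  "cinner x (y :: 'a::complex_inner) =
    ((norm (x + y))\<^sup>2 - (norm (x - y))\<^sup>2
      + \<i> * ((norm (x + \<i> *\<^sub>C y))\<^sup>2 - (norm (x - \<i> *\<^sub>C y))\<^sup>2)) / 4"
proof -
  have add: "complex_of_real ((norm (u + v))\<^sup>2) = cinner u u + cinner v v + cinner u v + cinner v u"
    for u v :: 'a
    by (subst cinner_norm[symmetric]) (simp add: cinner_add_left cinner_add_right)
  have diff: "complex_of_real ((norm (u - v))\<^sup>2) = cinner u u + cinner v v - cinner u v - cinner v u"
    for u v :: 'a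
    using add[of u "- v"] by (simp add: cinner_minus_left cinner_minus_right)
  show ?thesis
    unfolding of_real_diff add diff cinner_scaleC_left cinner_scaleC_right
    by (simp add: complex_eq_iff)
qed

instantiation hilbert_completion :: (complex_inner) complex_hilbert
begin

definition cinner_hilbert_completion ::
    "'a hilbert_completion \<Rightarrow> 'a hilbert_completion \<Rightarrow> complex"
  where "cinner_hilbert_completion x y =
    ((norm (x + y))\<^sup>2 - (norm (x - y))\<^sup>2
      + \<i> * ((norm (x + \<i> *\<^sub>C y))\<^sup>2 - (norm (x - \<i> *\<^sub>C y))\<^sup>2)) / 4"

lemma scaleC_hilbert_completion_tendsto:
  assumes "f \<longlonglongrightarrow> (x :: 'a hilbert_completion)"
  shows "(\<lambda>n. c *\<^sub>C f n) \<longlonglongrightarrow> c *\<^sub>C x"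
proof -
  have "norm (c *\<^sub>C u) \<le> cmod c * norm u" for u :: "'a hilbert_completion"
  proof transfer
    fix c and u :: "'a \<Rightarrow>\<^sub>L complex"
    show "norm (blinfun_scaleC c u) \<le> cmod c * norm u"
      by (rule norm_blinfun_bound)
        (auto simp: norm_mult mult.assoc intro!: mult_left_mono norm_blinfun)
  qed
  then have "bounded_linear (\<lambda>u :: 'a hilbert_completion. c *\<^sub>C u)"
    by (intro bounded_linear_intro[where K = "cmod c"])
      (auto simp: scaleC_add_right scaleR_scaleC scaleC_scaleC mult.commute)
  then show ?thesis using assms by (rule bounded_linear.tendsto)
qed

lemma cinner_hilbert_completion_tendsto:
  assumes "f \<longlonglongrightarrow> (x :: 'a hilbert_completion)" and "g \<longlonglongrightarrow> y"
  shows "(\<lambda>n. cinner (f n) (g n)) \<longlonglongrightarrow> cinner x y"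
proof -
  have ig: "(\<lambda>n. \<i> *\<^sub>C g n) \<longlonglongrightarrow> \<i> *\<^sub>C y"
    by (rule scaleC_hilbert_completion_tendsto[OF assms(2)])
  have sq: "(\<lambda>n. (norm (u n))\<^sup>2) \<longlonglongrightarrow> (norm z)\<^sup>2"
    if "u \<longlonglongrightarrow> z" for u and z :: "'a hilbert_completion"
    using tendsto_power[OF tendsto_norm[OF that]] .
  show ?thesis
    unfolding cinner_hilbert_completion_def
    by (intro tendsto_divide tendsto_add[where 'a = complex] tendsto_diff[where 'a = real]
        tendsto_mult[where 'a = complex] tendsto_of_real tendsto_const sq
        tendsto_add[OF assms] tendsto_diff[OF assms]
        tendsto_add[OF assms(1) ig] tendsto_diff[OF assms(1) ig]) simp_all
qed

lemma cinner_to_completion: "cinner (to_completion x) (to_completion (y :: 'a)) = cinner x y"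
  unfolding cinner_hilbert_completion_def cinner_polarization[of x y]
  by (simp flip: to_completion_add to_completion_diff to_completion_scaleC)

instance
proof
  fix x y z :: "'a hilbert_completion" and c
  obtain f where f: "(\<lambda>n. to_completion (f n)) \<longlonglongrightarrow> x" using to_completion_dense by blast
  obtain g where g: "(\<lambda>n. to_completion (g n)) \<longlonglongrightarrow> y" using to_completion_dense by blast
  obtain h where h: "(\<lambda>n. to_completion (h n)) \<longlonglongrightarrow> z" using to_completion_dense by blast
  note lim = cinner_hilbert_completion_tendsto
  have "(\<lambda>n. cinner (to_completion (f n)) (to_completion (g n))) \<longlonglongrightarrow> cnj (cinner y x)"
    using tendsto_cnj[OF lim[OF g f]]
    by (simp add: cinner_to_completion cinner_commute[of "f _" "g _"])
  then show "cinner x y = cnj (cinner y x)"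
    using lim[OF f g] LIMSEQ_unique by blast
  show "cinner (x + y) z = cinner x z + cinner y z"
    using lim[OF tendsto_add[OF f g] h] tendsto_add[OF lim[OF f h] lim[OF g h]]
    by (simp add: cinner_to_completion cinner_add_left LIMSEQ_unique flip: to_completion_add)
  show "cinner (c *\<^sub>C x) y = c * cinner x y"
    using lim[OF scaleC_hilbert_completion_tendsto[OF f, of c] g]
      tendsto_mult_left[OF lim[OF f g], of c]
    by (simp add: cinner_to_completion cinner_scaleC_left LIMSEQ_unique flip: to_completion_scaleC)
  have "(\<lambda>n. cinner (to_completion (f n)) (to_completion (f n))) \<longlonglongrightarrow> complex_of_real ((norm x)\<^sup>2)"
    unfolding cinner_to_completion cinner_norm
    using tendsto_power[OF tendsto_norm[OF f], of 2] by (intro tendsto_of_real) simp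
  then show "cinner x x = complex_of_real ((norm x)\<^sup>2)"
    using lim[OF f f] LIMSEQ_unique by blast
qed

end

section \<open>Hilbert space tensor product\<close>

text \<open>The algebraic tensor product is the space of finite sums of the rank-one operators
  \<open>f \<otimes> g = (\<lambda>x. \<langle>x, f\<rangle> g)\<close>, which are antilinear in \<open>f\<close>.\<close>

definition finite_rank_op ::
    "nat \<Rightarrow> (nat \<Rightarrow> 'a::complex_inner) \<Rightarrow> (nat \<Rightarrow> 'b::complex_vector) \<Rightarrow> 'a \<Rightarrow> 'b" where
  "finite_rank_op n f g = (\<lambda>x. \<Sum>k<n. cinner x (f k) *\<^sub>C g k)"

typedef (overloaded) ('a, 'b) alg_tensor =
  "{T :: 'a::complex_inner \<Rightarrow> 'b::complex_inner. \<exists>n f g. T = finite_rank_op n f g}"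
  morphisms op_of_tensor Abs_alg_tensor
  by auto

setup_lifting type_definition_alg_tensor

lemma finite_rank_op_add:
  "(\<lambda>x. finite_rank_op n f g x + finite_rank_op m f' g' x) =
    finite_rank_op (n + m) (\<lambda>k. if k < n then f k else f' (k - n))
      (\<lambda>k. if k < n then g k else g' (k - n))"
proof
  fix x
  let ?F = "\<lambda>k. cinner x (if k < n then f k else f' (k - n)) *\<^sub>C
    (if k < n then g k else g' (k - n))"
  have "(\<Sum>k<n + m. ?F k) = (\<Sum>k<n. ?F k) + (\<Sum>k<m. ?F (n + k))"
    by (induction m) (simp_all add: add.assoc)
  then show "finite_rank_op n f g x + finite_rank_op m f' g' x =
    finite_rank_op (n + m) (\<lambda>k. if k < n then f k else f' (k - n))
      (\<lambda>k. if k < n then g k else g' (k - n)) x"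
    by (simp add: finite_rank_op_def)
qed

lemma finite_rank_op_scaleC:
  "(\<lambda>x. c *\<^sub>C finite_rank_op n f g x) = finite_rank_op n f (\<lambda>k. c *\<^sub>C g k)"
  by (auto simp: finite_rank_op_def scaleC_sum_right scaleC_scaleC mult.commute)

instantiation alg_tensor :: (complex_inner, complex_inner) complex_vector
begin

lift_definition zero_alg_tensor :: "('a, 'b) alg_tensor" is "\<lambda>x. 0"
  by (intro exI[of _ 0]) (simp add: finite_rank_op_def)

lift_definition plus_alg_tensor ::
  "('a, 'b) alg_tensor \<Rightarrow> ('a, 'b) alg_tensor \<Rightarrow> ('a, 'b) alg_tensor" is "\<lambda>T S x. T x + S x"
  using finite_rank_op_add by blast

lift_definition scaleC_alg_tensor :: "complex \<Rightarrow> ('a, 'b) alg_tensor \<Rightarrow> ('a, 'b) alg_tensor"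
  is "\<lambda>c T x. c *\<^sub>C T x"
  using finite_rank_op_scaleC by blast

definition scaleR_alg_tensor :: "real \<Rightarrow> ('a, 'b) alg_tensor \<Rightarrow> ('a, 'b) alg_tensor"
  where "scaleR_alg_tensor r T = complex_of_real r *\<^sub>C T"

definition uminus_alg_tensor :: "('a, 'b) alg_tensor \<Rightarrow> ('a, 'b) alg_tensor"
  where "uminus_alg_tensor T = (- 1) *\<^sub>C T"

definition minus_alg_tensor ::
    "('a, 'b) alg_tensor \<Rightarrow> ('a, 'b) alg_tensor \<Rightarrow> ('a, 'b) alg_tensor"
  where "minus_alg_tensor T S = T + (- S)"

instance
proof
  fix T S U :: "('a, 'b) alg_tensor" and c d :: complex and r t :: real
  show "T + S + U = T + (S + U)" by transfer (simp add: add.assoc)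
  show "T + S = S + T" by transfer (simp add: add.commute)
  show "0 + T = T" by transfer simp
  show "- T + T = 0" unfolding uminus_alg_tensor_def by transfer (simp add: scaleC_minus_one)
  show "T - S = T + - S" by (rule minus_alg_tensor_def)
  show c_add: "c *\<^sub>C (T + S) = c *\<^sub>C T + c *\<^sub>C S" for c
    by transfer (simp add: scaleC_add_right)
  show add_c: "(c + d) *\<^sub>C T = c *\<^sub>C T + d *\<^sub>C T" for c d
    by transfer (simp add: scaleC_add_left)
  show cc: "c *\<^sub>C (d *\<^sub>C T) = (c * d) *\<^sub>C T" for c d
    by transfer (simp add: scaleC_scaleC)
  show "r *\<^sub>R T = complex_of_real r *\<^sub>C T" by (rule scaleR_alg_tensor_def)
  show "r *\<^sub>R (T + S) = r *\<^sub>R T + r *\<^sub>R S" by (simp add: scaleR_alg_tensor_def c_add)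
  show "(r + t) *\<^sub>R T = r *\<^sub>R T + t *\<^sub>R T" by (simp add: scaleR_alg_tensor_def add_c)
  show "r *\<^sub>R t *\<^sub>R T = (r * t) *\<^sub>R T" by (simp add: scaleR_alg_tensor_def cc)
  show "1 *\<^sub>R T = T" unfolding scaleR_alg_tensor_def by transfer simp
qed

end

text \<open>The inner product is determined by
  \<open>\<langle>T, g \<otimes> h\<rangle> = \<langle>T g, h\<rangle>\<close>, which for \<open>T = f \<otimes> u\<close> reads
  \<open>\<langle>f \<otimes> u, g \<otimes> h\<rangle> = cnj \<langle>f, g\<rangle> \<langle>u, h\<rangle>\<close>; see
  \<open>cinner_tensor\<close> below.\<close>

definition finite_rank_inner ::
    "('a::complex_inner \<Rightarrow> 'b::complex_inner) \<Rightarrow> ('a \<Rightarrow> 'b) \<Rightarrow> complex" where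
  "finite_rank_inner T S =
    (THE z. \<exists>n g h. S = finite_rank_op n g h \<and> z = (\<Sum>k<n. cinner (T (g k)) (h k)))"

lemma finite_rank_inner_swap:
  "(\<Sum>k<n. cinner (finite_rank_op m f u (g k)) (h k)) =
    cnj (\<Sum>l<m. cinner (finite_rank_op n g h (f l)) (u l))"
proof -
  have "cnj (cinner (f l) (g k) * cinner (h k) (u l)) = cinner (g k) (f l) * cinner (u l) (h k)"
    for k l
    by (simp only: complex_cnj_mult cinner_commute[of "f l" "g k"] cinner_commute[of "h k" "u l"]
        complex_cnj_cnj)
  then show ?thesis
    unfolding finite_rank_op_def cinner_sum_left cinner_scaleC_left cnj_sum
    by (subst sum.swap) simp
qed

lemma finite_rank_inner_eq:
  assumes "T = finite_rank_op m f u" and "S = finite_rank_op n g h"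
  shows "finite_rank_inner T S = (\<Sum>k<n. cinner (T (g k)) (h k))"
  unfolding finite_rank_inner_def
proof (rule the_equality)
  show "\<exists>n' g' h'. S = finite_rank_op n' g' h' \<and>
      (\<Sum>k<n. cinner (T (g k)) (h k)) = (\<Sum>k<n'. cinner (T (g' k)) (h' k))"
    using assms(2) by blast
next
  fix z
  assume "\<exists>n' g' h'. S = finite_rank_op n' g' h' \<and> z = (\<Sum>k<n'. cinner (T (g' k)) (h' k))"
  then obtain n' g' h' where S: "S = finite_rank_op n' g' h'"
    and z: "z = (\<Sum>k<n'. cinner (T (g' k)) (h' k))" by blast
  show "z = (\<Sum>k<n. cinner (T (g k)) (h k))"
    using finite_rank_inner_swap[of m f u g' h' n'] finite_rank_inner_swap[of m f u g h n]
    unfolding z assms(1) S[symmetric] assms(2)[symmetric] by simp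
qed

lemma orthonormal_coordinates:
  fixes f :: "nat \<Rightarrow> 'a::complex_inner"
  shows "\<exists>(m::nat) e a. (\<forall>i<m. \<forall>j<m. cinner (e i) (e j) = (if i = j then 1 else 0)) \<and>
    (\<forall>k<n. f k = (\<Sum>j<m. a k j *\<^sub>C (e j :: 'a)))"
proof (induction n)
  case 0
  show ?case by (intro exI[of _ 0]) auto
next
  case (Suc n)
  then obtain m e a where on: "\<And>i j. i < (m::nat) \<Longrightarrow> j < m \<Longrightarrow>
      cinner (e i) (e j :: 'a) = (if i = j then 1 else 0)"
    and f: "\<And>k. k < n \<Longrightarrow> f k = (\<Sum>j<m. a k j *\<^sub>C e j)" by blast
  define b where "b j = cinner (f n) (e j)" for j
  define r where "r = f n - (\<Sum>j<m. b j *\<^sub>C e j)"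
  have fn: "f n = (\<Sum>j<m. b j *\<^sub>C e j) + r" by (simp add: r_def)
  have r_orth: "cinner r (e i) = 0" if "i < m" for i
  proof -
    have "(\<Sum>j<m. b j * cinner (e j) (e i)) = (\<Sum>j<m. if j = i then b j else 0)"
      using on that by (intro sum.cong) auto
    then show ?thesis
      using that by (simp add: r_def cinner_diff_left cinner_sum_left cinner_scaleC_left b_def)
  qed
  show ?case
  proof (cases "r = 0")
    case True
    then have "f k = (\<Sum>j<m. (if k < n then a k else b) j *\<^sub>C e j)" if "k < Suc n" for k
      using f fn that by (cases "k < n") (auto simp: less_Suc_eq)
    then show ?thesis
      using on by (intro exI[of _ m] exI[of _ e] exI[of _ "\<lambda>k. if k < n then a k else b"]) blast
  next
    case False
    define c where "c = complex_of_real (norm r)"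
    define u where "u = (1 / c) *\<^sub>C r"
    have c: "c \<noteq> 0" "cnj c = c" "cinner r r = c * c"
      using False by (auto simp: c_def cinner_norm power2_eq_square)
    have uu: "cinner u u = 1"
      using c by (simp add: u_def cinner_scaleC_left cinner_scaleC_right)
    have ue: "cinner u (e i) = 0" if "i < m" for i
      using r_orth[OF that] by (simp add: u_def cinner_scaleC_left)
    have eu: "cinner (e i) u = 0" if "i < m" for i
      using ue[OF that] cinner_commute[of "e i" u] by simp
    have r: "r = c *\<^sub>C u" using c by (simp add: u_def scaleC_scaleC)
    define e' where "e' = e(m := u)"
    define a' where "a' k = (if k < n then (a k)(m := 0) else b(m := c))" for k
    have "cinner (e' i) (e' j) = (if i = j then 1 else 0)" if "i < Suc m" "j < Suc m" for i j
      using that on[of i j] uu ue[of j] eu[of i] by (auto simp: e'_def less_Suc_eq)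
    moreover have "f k = (\<Sum>j<Suc m. a' k j *\<^sub>C e' j)" if "k < Suc n" for k
    proof -
      have "(\<Sum>j<Suc m. d j *\<^sub>C e' j) = (\<Sum>j<m. d j *\<^sub>C e j) + d m *\<^sub>C u" for d
        by (auto simp: e'_def intro!: sum.cong)
      then have *: "(\<Sum>j<Suc m. a' k j *\<^sub>C e' j) = (\<Sum>j<m. a' k j *\<^sub>C e j) + a' k m *\<^sub>C u" .
      show ?thesis
      proof (cases "k < n")
        case True
        then have "(\<Sum>j<m. a' k j *\<^sub>C e j) = (\<Sum>j<m. a k j *\<^sub>C e j)"
          by (intro sum.cong) (auto simp: a'_def)
        with True * show ?thesis by (simp add: f a'_def)
      next
        case False
        then have "k = n" using that by simp
        have "(\<Sum>j<m. a' k j *\<^sub>C e j) = (\<Sum>j<m. b j *\<^sub>C e j)"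
          using False by (intro sum.cong) (auto simp: a'_def)
        then have "(\<Sum>j<Suc m. a' k j *\<^sub>C e' j) = (\<Sum>j<m. b j *\<^sub>C e j) + c *\<^sub>C u"
          using * False by (simp add: a'_def)
        then show ?thesis using fn r \<open>k = n\<close> by simp
      qed
    qed
    ultimately show ?thesis
      by (intro exI[of _ "Suc m"] exI[of _ e'] exI[of _ a']) blast
  qed
qed

lemma finite_rank_op_orthonormal:
  fixes f :: "nat \<Rightarrow> 'a::complex_inner" and g :: "nat \<Rightarrow> 'b::complex_inner"
  shows "\<exists>(m::nat) e h. (\<forall>i<m. \<forall>j<m. cinner (e i) (e j) = (if i = j then 1 else 0)) \<and>
    finite_rank_op n f g = finite_rank_op m e h"
proof -
  obtain m :: nat and e :: "nat \<Rightarrow> 'a" and a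
    where on: "\<forall>i<m. \<forall>j<m. cinner (e i) (e j) = (if i = j then 1 else 0)"
    and f: "\<And>k. k < n \<Longrightarrow> f k = (\<Sum>j<m. a k j *\<^sub>C e j)"
    using orthonormal_coordinates[of n f] by blast
  have "finite_rank_op n f g x = finite_rank_op m e (\<lambda>j. \<Sum>k<n. cnj (a k j) *\<^sub>C g k) x" for x
  proof -
    have "finite_rank_op n f g x = (\<Sum>k<n. \<Sum>j<m. (cnj (a k j) * cinner x (e j)) *\<^sub>C g k)"
      unfolding finite_rank_op_def
      by (intro sum.cong refl)
        (simp add: f cinner_sum_right cinner_scaleC_right scaleC_sum_left)
    also have "\<dots> = (\<Sum>j<m. \<Sum>k<n. (cnj (a k j) * cinner x (e j)) *\<^sub>C g k)"
      by (rule sum.swap)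
    finally show ?thesis
      by (simp add: finite_rank_op_def scaleC_sum_right scaleC_scaleC mult.commute)
  qed
  then show ?thesis using on by blast
qed

lemma finite_rank_inner_self:
  assumes "T = finite_rank_op n f g"
  shows "Re (finite_rank_inner T T) \<ge> 0"
    and "Re (finite_rank_inner T T) = 0 \<Longrightarrow> T = (\<lambda>x. 0)"
proof -
  obtain m :: nat and e h
    where on: "\<And>i j. i < m \<Longrightarrow> j < m \<Longrightarrow> cinner (e i) (e j) = (if i = j then 1 else 0)"
    and T: "T = finite_rank_op m e h"
    using finite_rank_op_orthonormal[of n f g] assms by metis
  have Te: "T (e k) = h k" if "k < m" for k
  proof -
    have "T (e k) = (\<Sum>j<m. if j = k then h j else 0)"
      unfolding T finite_rank_op_def using on that by (intro sum.cong) auto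
    then show ?thesis using that by simp
  qed
  have "finite_rank_inner T T = (\<Sum>k<m. cinner (T (e k)) (h k))"
    by (rule finite_rank_inner_eq[OF T T])
  also have "\<dots> = (\<Sum>k<m. complex_of_real ((norm (h k))\<^sup>2))"
    by (intro sum.cong refl) (simp add: Te cinner_norm)
  finally have eq: "Re (finite_rank_inner T T) = (\<Sum>k<m. (norm (h k))\<^sup>2)" by simp
  then show "Re (finite_rank_inner T T) \<ge> 0" by (simp add: sum_nonneg)
  show "T = (\<lambda>x. 0)" if "Re (finite_rank_inner T T) = 0"
  proof -
    have "(\<Sum>k<m. (norm (h k))\<^sup>2) = 0" using that eq by simp
    then have "h k = 0" if "k < m" for k using that by (simp add: sum_nonneg_eq_0_iff)
    then show ?thesis unfolding T finite_rank_op_def by simp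
  qed
qed

lift_definition alg_tensor_inner :: "('a::complex_inner, 'b::complex_inner) alg_tensor \<Rightarrow>
  ('a, 'b) alg_tensor \<Rightarrow> complex" is finite_rank_inner .

lemma alg_tensor_inner_props:
  fixes T S U :: "('a::complex_inner, 'b::complex_inner) alg_tensor"
  shows alg_tensor_inner_commute: "alg_tensor_inner T S = cnj (alg_tensor_inner S T)"
    and alg_tensor_inner_add: "alg_tensor_inner (T + S) U = alg_tensor_inner T U + alg_tensor_inner S U"
    and alg_tensor_inner_scaleC: "alg_tensor_inner (c *\<^sub>C T) S = c * alg_tensor_inner T S"
    and alg_tensor_inner_nonneg: "0 \<le> Re (alg_tensor_inner T T)"
    and alg_tensor_inner_definite: "Re (alg_tensor_inner T T) = 0 \<Longrightarrow> T = 0"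
proof -
  show comm: "alg_tensor_inner T S = cnj (alg_tensor_inner S T)" for T S :: "('a, 'b) alg_tensor"
  proof transfer
    fix T S :: "'a \<Rightarrow> 'b"
    assume "\<exists>n f g. T = finite_rank_op n f g" "\<exists>n f g. S = finite_rank_op n f g"
    then obtain n f g m f' g' where *: "T = finite_rank_op n f g"
      "S = finite_rank_op m f' g'" by blast
    show "finite_rank_inner T S = cnj (finite_rank_inner S T)"
      unfolding finite_rank_inner_eq[OF *] finite_rank_inner_eq[OF *(2,1)]
      unfolding * by (rule finite_rank_inner_swap)
  qed
  show "alg_tensor_inner (T + S) U = alg_tensor_inner T U + alg_tensor_inner S U"
  proof transfer
    fix T S U :: "'a \<Rightarrow> 'b"
    assume "\<exists>n f g. T = finite_rank_op n f g" "\<exists>n f g. S = finite_rank_op n f g"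
      "\<exists>n f g. U = finite_rank_op n f g"
    then obtain n f g m f' g' l f'' g'' where *: "T = finite_rank_op n f g"
      "S = finite_rank_op m f' g'" "U = finite_rank_op l f'' g''" by blast
    show "finite_rank_inner (\<lambda>x. T x + S x) U = finite_rank_inner T U + finite_rank_inner S U"
      using finite_rank_inner_eq[OF *(1,3)] finite_rank_inner_eq[OF *(2,3)]
        finite_rank_inner_eq[OF finite_rank_op_add *(3), of n f g m f' g']
      by (simp add: *(1,2) cinner_add_left sum.distrib)
  qed
  show "alg_tensor_inner (c *\<^sub>C T) S = c * alg_tensor_inner T S"
  proof transfer
    fix c and T S :: "'a \<Rightarrow> 'b"
    assume "\<exists>n f g. T = finite_rank_op n f g" "\<exists>n f g. S = finite_rank_op n f g"
    then obtain n f g m f' g' where *: "T = finite_rank_op n f g"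
      "S = finite_rank_op m f' g'" by blast
    show "finite_rank_inner (\<lambda>x. c *\<^sub>C T x) S = c * finite_rank_inner T S"
      using finite_rank_inner_eq[OF *] finite_rank_inner_eq[OF finite_rank_op_scaleC *(2), of c n f g]
      by (simp add: *(1) cinner_scaleC_left sum_distrib_left)
  qed
  show "0 \<le> Re (alg_tensor_inner T T)"
    by transfer (auto intro: finite_rank_inner_self(1))
  show "Re (alg_tensor_inner T T) = 0 \<Longrightarrow> T = 0"
    by transfer (auto dest: finite_rank_inner_self(2)[OF refl])
qed

instantiation alg_tensor :: (complex_inner, complex_inner) complex_inner
begin

definition cinner_alg_tensor :: "('a, 'b) alg_tensor \<Rightarrow> ('a, 'b) alg_tensor \<Rightarrow> complex"
  where "cinner_alg_tensor = alg_tensor_inner"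

definition norm_alg_tensor :: "('a, 'b) alg_tensor \<Rightarrow> real"
  where "norm_alg_tensor T = sqrt (Re (alg_tensor_inner T T))"

definition sgn_alg_tensor :: "('a, 'b) alg_tensor \<Rightarrow> ('a, 'b) alg_tensor"
  where "sgn_alg_tensor T = scaleR (inverse (norm T)) T"

definition dist_alg_tensor :: "('a, 'b) alg_tensor \<Rightarrow> ('a, 'b) alg_tensor \<Rightarrow> real"
  where "dist_alg_tensor T S = norm (T - S)"

definition uniformity_alg_tensor :: "(('a, 'b) alg_tensor \<times> ('a, 'b) alg_tensor) filter"
  where "uniformity_alg_tensor = (INF e\<in>{0 <..}. principal {(x, y). dist x y < e})"

definition open_alg_tensor :: "('a, 'b) alg_tensor set \<Rightarrow> bool"
  where "open_alg_tensor S = (\<forall>x\<in>S. \<forall>\<^sub>F (x', y) in uniformity. x' = x \<longrightarrow> y \<in> S)"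

instance
proof
  fix T S U :: "('a, 'b) alg_tensor" and c :: complex and r :: real
  show "cinner T S = cnj (cinner S T)"
    unfolding cinner_alg_tensor_def by (rule alg_tensor_inner_commute)
  show "cinner (T + S) U = cinner T U + cinner S U"
    unfolding cinner_alg_tensor_def by (rule alg_tensor_inner_add)
  show "cinner (c *\<^sub>C T) S = c * cinner T S"
    unfolding cinner_alg_tensor_def by (rule alg_tensor_inner_scaleC)
  have "Im (alg_tensor_inner T T) = 0"
    using alg_tensor_inner_commute[of T T] by (simp add: complex_eq_iff)
  then show "cinner T T = complex_of_real ((norm T)\<^sup>2)"
    by (simp add: cinner_alg_tensor_def norm_alg_tensor_def complex_eq_iff alg_tensor_inner_nonneg)
  have "alg_tensor_inner (0 :: ('a, 'b) alg_tensor) 0 = 0"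
    using alg_tensor_inner_scaleC[of 0 0 0] by simp
  then show "norm T = 0 \<longleftrightarrow> T = 0"
    using alg_tensor_inner_definite[of T] by (auto simp: norm_alg_tensor_def)
  show "norm (T + S) \<le> norm T + norm S"
    unfolding norm_alg_tensor_def
    by (rule sesquilinear_triangle[of alg_tensor_inner, OF alg_tensor_inner_commute
          alg_tensor_inner_add alg_tensor_inner_scaleC alg_tensor_inner_nonneg
          alg_tensor_inner_definite])
  have "alg_tensor_inner (r *\<^sub>R T) (r *\<^sub>R T) = r * cnj (r * alg_tensor_inner T T)"
    unfolding scaleR_scaleC
    by (metis alg_tensor_inner_commute alg_tensor_inner_scaleC)
  then show "norm (r *\<^sub>R T) = \<bar>r\<bar> * norm T"
    by (simp add: norm_alg_tensor_def real_sqrt_mult power2_eq_square[symmetric]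
        mult.assoc[symmetric])
qed (simp_all only: dist_alg_tensor_def sgn_alg_tensor_def
    uniformity_alg_tensor_def open_alg_tensor_def)

end

type_synonym ('a, 'b) hilbert_tensor = "('a, 'b) alg_tensor hilbert_completion"

lift_definition rank_one :: "'a::complex_inner \<Rightarrow> 'b::complex_inner \<Rightarrow> ('a, 'b) alg_tensor"
  is "\<lambda>f g x. cinner x f *\<^sub>C g"
  subgoal for f g
    by (intro exI[of _ 1] exI[of _ "\<lambda>_. f"] exI[of _ "\<lambda>_. g"]) (simp add: finite_rank_op_def)
  done

definition tensor ::
    "'a::complex_inner \<Rightarrow> 'b::complex_inner \<Rightarrow> ('a, 'b) hilbert_tensor"  (infixr \<open>\<otimes>\<^sub>H\<close> 70)
  where "f \<otimes>\<^sub>H g = to_completion (rank_one f g)"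

lemma cinner_tensor: "cinner (f \<otimes>\<^sub>H u) (g \<otimes>\<^sub>H h) = cnj (cinner f g) * cinner u h"
proof -
  have rk: "(\<lambda>x. cinner x f *\<^sub>C u) = finite_rank_op 1 (\<lambda>_. f) (\<lambda>_. u)"
    for f :: 'a and u :: 'b
    by (simp add: finite_rank_op_def)
  have "alg_tensor_inner (rank_one f u) (rank_one g h) = cinner (cinner g f *\<^sub>C u) h"
    using finite_rank_inner_eq[OF rk rk, of f u g h]
    by (simp add: alg_tensor_inner.rep_eq rank_one.rep_eq)
  then show ?thesis
    unfolding tensor_def cinner_to_completion cinner_alg_tensor_def
    by (simp add: cinner_scaleC_left) (metis cinner_commute)
qed

section \<open>Weighted sequence spaces and spectral matrix algebras\<close>

definition lp_norm :: "ennreal \<Rightarrow> ('i \<Rightarrow> real) \<Rightarrow> ('i \<Rightarrow> complex) \<Rightarrow> ennreal" where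
  "lp_norm p w c =
    (if p = \<infinity> then (SUP i. ennreal (cmod (c i) * w i))
     else let s = (\<Sum>\<^sub>\<infinity>i. ennreal ((cmod (c i) * w i) powr enn2real p))
       in if s = \<infinity> then \<infinity> else ennreal (enn2real s powr (1 / enn2real p)))"

definition lp_space :: "ennreal \<Rightarrow> ('i \<Rightarrow> real) \<Rightarrow> ('i \<Rightarrow> complex) set" where
  "lp_space p w = {c. lp_norm p w c < \<infinity>}"

type_synonym 'i matrix = "'i \<Rightarrow> 'i \<Rightarrow> complex"

definition mat_vec :: "'i matrix \<Rightarrow> ('i \<Rightarrow> complex) \<Rightarrow> 'i \<Rightarrow> complex" where
  "mat_vec A c i = (\<Sum>\<^sub>\<infinity>j. A i j * c j)"

definition mat_mult :: "'i matrix \<Rightarrow> 'i matrix \<Rightarrow> 'i matrix" where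
  "mat_mult A B i k = (\<Sum>\<^sub>\<infinity>j. A i j * B j k)"

definition mat_one :: "'i matrix" where
  "mat_one i j = (if i = j then 1 else 0)"

definition mat_adjoint :: "'i matrix \<Rightarrow> 'i matrix" where
  "mat_adjoint A i j = cnj (A j i)"

definition lp_bounded :: "ennreal \<Rightarrow> ('i \<Rightarrow> real) \<Rightarrow> 'i matrix \<Rightarrow> bool" where
  "lp_bounded p w A \<longleftrightarrow> (\<exists>B::real. \<forall>c\<in>lp_space p w.
    (\<forall>i. (\<lambda>j. A i j * c j) summable_on UNIV) \<and>
    lp_norm p w (mat_vec A c) \<le> ennreal B * lp_norm p w c)"

text \<open>Banach algebras are unital here: inverse-closedness in \<open>B(\<ell>\<^sup>2)\<close>
  would be vacuous for an algebra without the identity matrix.\<close>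

locale spectral_matrix_algebra =
  fixes \<A> :: "'i matrix set" and N :: "'i matrix \<Rightarrow> real"
  assumes one_mem: "mat_one \<in> \<A>"
    and add_mem: "A \<in> \<A> \<Longrightarrow> B \<in> \<A> \<Longrightarrow> (\<lambda>i j. A i j + B i j) \<in> \<A>"
    and scale_mem: "A \<in> \<A> \<Longrightarrow> (\<lambda>i j. c * A i j) \<in> \<A>"
    and mult_mem: "A \<in> \<A> \<Longrightarrow> B \<in> \<A> \<Longrightarrow> mat_mult A B \<in> \<A>"
    and adjoint_mem: "A \<in> \<A> \<Longrightarrow> mat_adjoint A \<in> \<A>"
    and norm_eq_0: "A \<in> \<A> \<Longrightarrow> N A = 0 \<longleftrightarrow> A = (\<lambda>i j. 0)"
    and norm_add: "A \<in> \<A> \<Longrightarrow> B \<in> \<A> \<Longrightarrow> N (\<lambda>i j. A i j + B i j) \<le> N A + N B"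
    and norm_scale: "A \<in> \<A> \<Longrightarrow> N (\<lambda>i j. c * A i j) = cmod c * N A"
    and norm_mult: "A \<in> \<A> \<Longrightarrow> B \<in> \<A> \<Longrightarrow> N (mat_mult A B) \<le> N A * N B"
    and norm_adjoint: "A \<in> \<A> \<Longrightarrow> N (mat_adjoint A) = N A"
    and complete: "(\<And>n::nat. X n \<in> \<A>) \<Longrightarrow>
      (\<forall>e>0. \<exists>M. \<forall>m\<ge>M. \<forall>n\<ge>M. N (\<lambda>i j. X m i j - X n i j) < e) \<Longrightarrow>
      \<exists>L\<in>\<A>. (\<lambda>n. N (\<lambda>i j. X n i j - L i j)) \<longlonglongrightarrow> 0"
    and bounded_l2: "A \<in> \<A> \<Longrightarrow> lp_bounded 2 (\<lambda>_. 1) A"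
    and inverse_closed: "A \<in> \<A> \<Longrightarrow> lp_bounded 2 (\<lambda>_. 1) B \<Longrightarrow>
      (\<forall>c\<in>lp_space 2 (\<lambda>_. 1). mat_vec B (mat_vec A c) = c \<and> mat_vec A (mat_vec B c) = c) \<Longrightarrow>
      B \<in> \<A>"
    and solid: "A \<in> \<A> \<Longrightarrow> (\<forall>i j. cmod (B i j) \<le> cmod (A i j)) \<Longrightarrow> B \<in> \<A> \<and> N B \<le> N A"

definition admissible_weight :: "'i matrix set \<Rightarrow> ('i \<Rightarrow> real) \<Rightarrow> bool" where
  "admissible_weight \<A> w \<longleftrightarrow> (\<forall>i. 0 < w i) \<and> (\<forall>A\<in>\<A>. \<forall>p\<ge>1. lp_bounded p w A)"

section \<open>Frames\<close>

definition is_frame :: "('i \<Rightarrow> 'a::complex_inner) \<Rightarrow> bool" where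
  "is_frame \<Psi> \<longleftrightarrow> (\<exists>A>0. \<exists>B>0. \<forall>f.
    (\<lambda>i. (cmod (cinner f (\<Psi> i)))\<^sup>2) summable_on UNIV \<and>
    A * (norm f)\<^sup>2 \<le> (\<Sum>\<^sub>\<infinity>i. (cmod (cinner f (\<Psi> i)))\<^sup>2) \<and>
    (\<Sum>\<^sub>\<infinity>i. (cmod (cinner f (\<Psi> i)))\<^sup>2) \<le> B * (norm f)\<^sup>2)"

definition analysis :: "('i \<Rightarrow> 'a::complex_inner) \<Rightarrow> 'a \<Rightarrow> 'i \<Rightarrow> complex" where
  "analysis \<Psi> f i = cinner f (\<Psi> i)"

definition synthesis :: "('i \<Rightarrow> 'a::complex_inner) \<Rightarrow> ('i \<Rightarrow> complex) \<Rightarrow> 'a" where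
  "synthesis \<Psi> c = (\<Sum>\<^sub>\<infinity>i. c i *\<^sub>C \<Psi> i)"

definition frame_op :: "('i \<Rightarrow> 'a::complex_inner) \<Rightarrow> 'a \<Rightarrow> 'a" where
  "frame_op \<Psi> f = synthesis \<Psi> (analysis \<Psi> f)"

definition dual_frame :: "('i \<Rightarrow> 'a::complex_inner) \<Rightarrow> 'i \<Rightarrow> 'a" where
  "dual_frame \<Psi> i = inv (frame_op \<Psi>) (\<Psi> i)"

definition gram :: "('i \<Rightarrow> 'a::complex_inner) \<Rightarrow> 'i matrix" where
  "gram \<Psi> i i' = cinner (\<Psi> i') (\<Psi> i)"

definition localised_frame :: "'i matrix set \<Rightarrow> ('i \<Rightarrow> 'a::complex_inner) \<Rightarrow> bool" where
  "localised_frame \<A> \<Psi> \<longleftrightarrow> is_frame \<Psi> \<and> gram \<Psi> \<in> \<A>"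

definition finite_combinations :: "('i \<Rightarrow> 'a::complex_inner) \<Rightarrow> 'a set" where
  "finite_combinations \<Psi> = {\<Sum>i\<in>F. c i *\<^sub>C \<Psi> i | F c. finite F}"

section \<open>Co-orbit spaces\<close>

text \<open>Elements of co-orbit spaces are equivalence classes of sequences. The family \<open>\<Phi>\<close>
  plays the role of the canonical dual of \<open>\<Psi>\<close>; it is a separate argument because the dual of
  a tensor product frame is written as the tensor product of the duals.
  For \<open>p < \<infinity>\<close> the space is the completion of the finite combinations of \<open>\<Psi>\<close>, as
  Cauchy sequences modulo null sequences; for \<open>p = \<infinity>\<close> the members of the sequences
  range over the whole Hilbert space and both convergence and equivalence are coefficientwise.\<close>

definition coorbit_seqs :: "ennreal \<Rightarrow> ('i \<Rightarrow> 'a::complex_inner) \<Rightarrow> ('i \<Rightarrow> 'a) \<Rightarrow> ('i \<Rightarrow> real) \<Rightarrow>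
    (nat \<Rightarrow> 'a) set" where
  "coorbit_seqs p \<Psi> \<Phi> w =
    (if p = \<infinity> then
       {f. (\<forall>i. convergent (\<lambda>n. analysis \<Phi> (f n) i)) \<and>
           (SUP n. lp_norm \<infinity> w (analysis \<Phi> (f n))) < \<infinity>}
     else
       {f. (\<forall>n. f n \<in> finite_combinations \<Psi>) \<and>
           (\<forall>e>0. \<exists>M. \<forall>m\<ge>M. \<forall>n\<ge>M. lp_norm p w (analysis \<Phi> (f m - f n)) < e)})"

definition coorbit_rel :: "ennreal \<Rightarrow> ('i \<Rightarrow> 'a::complex_inner) \<Rightarrow> ('i \<Rightarrow> 'a) \<Rightarrow> ('i \<Rightarrow> real) \<Rightarrow>
    ((nat \<Rightarrow> 'a) \<times> (nat \<Rightarrow> 'a)) set" where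
  "coorbit_rel p \<Psi> \<Phi> w =
    {(f, g). f \<in> coorbit_seqs p \<Psi> \<Phi> w \<and> g \<in> coorbit_seqs p \<Psi> \<Phi> w \<and>
      (if p = \<infinity> then \<forall>i. (\<lambda>n. analysis \<Phi> (f n - g n) i) \<longlonglongrightarrow> 0
       else (\<lambda>n. lp_norm p w (analysis \<Phi> (f n - g n))) \<longlonglongrightarrow> 0)}"

definition coorbit_wrt :: "ennreal \<Rightarrow> ('i \<Rightarrow> 'a::complex_inner) \<Rightarrow> ('i \<Rightarrow> 'a) \<Rightarrow> ('i \<Rightarrow> real) \<Rightarrow>
    (nat \<Rightarrow> 'a) set set" where
  "coorbit_wrt p \<Psi> \<Phi> w = coorbit_seqs p \<Psi> \<Phi> w // coorbit_rel p \<Psi> \<Phi> w"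

text \<open>The extension of an analysis operator to a class of sequences is the coefficientwise limit
  along a representative; on a space with \<open>p < \<infinity>\<close> this is the extension by
  continuity.\<close>

definition ext_analysis :: "('i \<Rightarrow> 'a::complex_inner) \<Rightarrow> (nat \<Rightarrow> 'a) set \<Rightarrow> 'i \<Rightarrow> complex" where
  "ext_analysis \<Phi> X i = lim (\<lambda>n. analysis \<Phi> ((SOME f. f \<in> X) n) i)"

definition coorbit_norm_wrt ::
    "ennreal \<Rightarrow> ('i \<Rightarrow> 'a::complex_inner) \<Rightarrow> ('i \<Rightarrow> real) \<Rightarrow> (nat \<Rightarrow> 'a) set \<Rightarrow> ennreal" where
  "coorbit_norm_wrt p \<Phi> w X = lp_norm p w (ext_analysis \<Phi> X)"

definition coorbit_pairing_wrt :: "('i \<Rightarrow> 'a::complex_inner) \<Rightarrow> ('i \<Rightarrow> 'a) \<Rightarrow>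
    (nat \<Rightarrow> 'a) set \<Rightarrow> (nat \<Rightarrow> 'a) set \<Rightarrow> complex" where
  "coorbit_pairing_wrt \<Psi> \<Phi> X Y = (\<Sum>\<^sub>\<infinity>i. ext_analysis \<Phi> X i * cnj (ext_analysis \<Psi> Y i))"

definition coorbit :: "ennreal \<Rightarrow> ('i \<Rightarrow> 'a::complex_inner) \<Rightarrow> ('i \<Rightarrow> real) \<Rightarrow> (nat \<Rightarrow> 'a) set set"
  where "coorbit p \<Psi> w = coorbit_wrt p \<Psi> (dual_frame \<Psi>) w"

definition coorbit_norm ::
    "ennreal \<Rightarrow> ('i \<Rightarrow> 'a::complex_inner) \<Rightarrow> ('i \<Rightarrow> real) \<Rightarrow> (nat \<Rightarrow> 'a) set \<Rightarrow> ennreal"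
  where "coorbit_norm p \<Psi> w = coorbit_norm_wrt p (dual_frame \<Psi>) w"

definition coorbit_pairing ::
    "('i \<Rightarrow> 'a::complex_inner) \<Rightarrow> (nat \<Rightarrow> 'a) set \<Rightarrow> (nat \<Rightarrow> 'a) set \<Rightarrow> complex"
  where "coorbit_pairing \<Psi> = coorbit_pairing_wrt \<Psi> (dual_frame \<Psi>)"

definition coorbit_add :: "ennreal \<Rightarrow> ('i \<Rightarrow> 'a::complex_inner) \<Rightarrow> ('i \<Rightarrow> real) \<Rightarrow>
    (nat \<Rightarrow> 'a) set \<Rightarrow> (nat \<Rightarrow> 'a) set \<Rightarrow> (nat \<Rightarrow> 'a) set" where
  "coorbit_add p \<Psi> w X Y =
    coorbit_rel p \<Psi> (dual_frame \<Psi>) w `` {(\<lambda>n. f n + g n) | f g. f \<in> X \<and> g \<in> Y}"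

definition coorbit_scale :: "ennreal \<Rightarrow> ('i \<Rightarrow> 'a::complex_inner) \<Rightarrow> ('i \<Rightarrow> real) \<Rightarrow>
    complex \<Rightarrow> (nat \<Rightarrow> 'a) set \<Rightarrow> (nat \<Rightarrow> 'a) set" where
  "coorbit_scale p \<Psi> w c X =
    coorbit_rel p \<Psi> (dual_frame \<Psi>) w `` {(\<lambda>n. c *\<^sub>C f n) | f. f \<in> X}"

text \<open>Operators are \<open>undefined\<close> outside their domain, so that equality of operators is
  equality of functions.\<close>

definition bounded_coorbit_ops ::
    "ennreal \<Rightarrow> ('i \<Rightarrow> 'a::complex_inner) \<Rightarrow> ('i \<Rightarrow> real) \<Rightarrow>
     ennreal \<Rightarrow> ('j \<Rightarrow> 'b::complex_inner) \<Rightarrow> ('j \<Rightarrow> real) \<Rightarrow>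
     ((nat \<Rightarrow> 'a) set \<Rightarrow> (nat \<Rightarrow> 'b) set) set" where
  "bounded_coorbit_ops p \<Psi>\<^sub>1 w\<^sub>1 q \<Psi>\<^sub>2 w\<^sub>2 =
    {T \<in> coorbit p \<Psi>\<^sub>1 w\<^sub>1 \<rightarrow>\<^sub>E coorbit q \<Psi>\<^sub>2 w\<^sub>2.
      (\<forall>X\<in>coorbit p \<Psi>\<^sub>1 w\<^sub>1. \<forall>Y\<in>coorbit p \<Psi>\<^sub>1 w\<^sub>1.
        T (coorbit_add p \<Psi>\<^sub>1 w\<^sub>1 X Y) = coorbit_add q \<Psi>\<^sub>2 w\<^sub>2 (T X) (T Y)) \<and>
      (\<forall>c. \<forall>X\<in>coorbit p \<Psi>\<^sub>1 w\<^sub>1.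
        T (coorbit_scale p \<Psi>\<^sub>1 w\<^sub>1 c X) = coorbit_scale q \<Psi>\<^sub>2 w\<^sub>2 c (T X)) \<and>
      (\<exists>B::real. \<forall>X\<in>coorbit p \<Psi>\<^sub>1 w\<^sub>1.
        coorbit_norm q \<Psi>\<^sub>2 w\<^sub>2 (T X) \<le> ennreal B * coorbit_norm p \<Psi>\<^sub>1 w\<^sub>1 X)}"

definition coorbit_op_norm ::
    "ennreal \<Rightarrow> ('i \<Rightarrow> 'a::complex_inner) \<Rightarrow> ('i \<Rightarrow> real) \<Rightarrow>
     ennreal \<Rightarrow> ('j \<Rightarrow> 'b::complex_inner) \<Rightarrow> ('j \<Rightarrow> real) \<Rightarrow>
     ((nat \<Rightarrow> 'a) set \<Rightarrow> (nat \<Rightarrow> 'b) set) \<Rightarrow> ennreal" where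
  "coorbit_op_norm p \<Psi>\<^sub>1 w\<^sub>1 q \<Psi>\<^sub>2 w\<^sub>2 T =
    (SUP X\<in>{X \<in> coorbit p \<Psi>\<^sub>1 w\<^sub>1. coorbit_norm p \<Psi>\<^sub>1 w\<^sub>1 X \<le> 1}. coorbit_norm q \<Psi>\<^sub>2 w\<^sub>2 (T X))"

section \<open>Co-orbit spaces of tensor product frames\<close>

definition tensor_family :: "('i \<Rightarrow> 'a::complex_inner) \<Rightarrow> ('j \<Rightarrow> 'b::complex_inner) \<Rightarrow>
    'i \<times> 'j \<Rightarrow> ('a, 'b) hilbert_tensor" where
  "tensor_family \<Psi>\<^sub>1 \<Psi>\<^sub>2 = (\<lambda>(i, j). \<Psi>\<^sub>1 i \<otimes>\<^sub>H \<Psi>\<^sub>2 j)"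

definition tensor_weight :: "('i \<Rightarrow> real) \<Rightarrow> ('j \<Rightarrow> real) \<Rightarrow> 'i \<times> 'j \<Rightarrow> real" where
  "tensor_weight w\<^sub>1 w\<^sub>2 = (\<lambda>(i, j). w\<^sub>1 i * w\<^sub>2 j)"

definition tensor_coorbit :: "ennreal \<Rightarrow> ('i \<Rightarrow> 'a::complex_inner) \<Rightarrow>
    ('j \<Rightarrow> 'b::complex_inner) \<Rightarrow> ('i \<times> 'j \<Rightarrow> real) \<Rightarrow> (nat \<Rightarrow> ('a, 'b) hilbert_tensor) set set" where
  "tensor_coorbit p \<Psi>\<^sub>1 \<Psi>\<^sub>2 w =
    coorbit_wrt p (tensor_family \<Psi>\<^sub>1 \<Psi>\<^sub>2) (tensor_family (dual_frame \<Psi>\<^sub>1) (dual_frame \<Psi>\<^sub>2)) w"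

definition tensor_coorbit_norm :: "ennreal \<Rightarrow> ('i \<Rightarrow> 'a::complex_inner) \<Rightarrow>
    ('j \<Rightarrow> 'b::complex_inner) \<Rightarrow> ('i \<times> 'j \<Rightarrow> real) \<Rightarrow>
    (nat \<Rightarrow> ('a, 'b) hilbert_tensor) set \<Rightarrow> ennreal" where
  "tensor_coorbit_norm p \<Psi>\<^sub>1 \<Psi>\<^sub>2 w =
    coorbit_norm_wrt p (tensor_family (dual_frame \<Psi>\<^sub>1) (dual_frame \<Psi>\<^sub>2)) w"

definition tensor_coorbit_pairing :: "('i \<Rightarrow> 'a::complex_inner) \<Rightarrow>
    ('j \<Rightarrow> 'b::complex_inner) \<Rightarrow> (nat \<Rightarrow> ('a, 'b) hilbert_tensor) set \<Rightarrow>
    (nat \<Rightarrow> ('a, 'b) hilbert_tensor) set \<Rightarrow> complex" where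
  "tensor_coorbit_pairing \<Psi>\<^sub>1 \<Psi>\<^sub>2 =
    coorbit_pairing_wrt (tensor_family \<Psi>\<^sub>1 \<Psi>\<^sub>2) (tensor_family (dual_frame \<Psi>\<^sub>1) (dual_frame \<Psi>\<^sub>2))"

text \<open>The element \<open>f\<^sub>1 \<otimes> f\<^sub>2\<close> of the co-orbit space with \<open>p = 1\<close>,
  specified by its coefficients.\<close>

definition coorbit_tensor :: "('i \<Rightarrow> 'a::complex_inner) \<Rightarrow> ('j \<Rightarrow> 'b::complex_inner) \<Rightarrow>
    ('i \<Rightarrow> real) \<Rightarrow> ('j \<Rightarrow> real) \<Rightarrow> (nat \<Rightarrow> 'a) set \<Rightarrow> (nat \<Rightarrow> 'b) set \<Rightarrow>
    (nat \<Rightarrow> ('a, 'b) hilbert_tensor) set" where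
  "coorbit_tensor \<Psi>\<^sub>1 \<Psi>\<^sub>2 w\<^sub>1 w\<^sub>2 f\<^sub>1 f\<^sub>2 =
    (THE F. F \<in> tensor_coorbit 1 \<Psi>\<^sub>1 \<Psi>\<^sub>2 (tensor_weight w\<^sub>1 w\<^sub>2) \<and>
      (\<forall>i j. ext_analysis (tensor_family (dual_frame \<Psi>\<^sub>1) (dual_frame \<Psi>\<^sub>2)) F (i, j) =
        cnj (ext_analysis (dual_frame \<Psi>\<^sub>1) f\<^sub>1 i) * ext_analysis (dual_frame \<Psi>\<^sub>2) f\<^sub>2 j))"

definition kernel_of :: "('i \<Rightarrow> 'a::complex_inner) \<Rightarrow> ('j \<Rightarrow> 'b::complex_inner) \<Rightarrow>
    ('i \<Rightarrow> real) \<Rightarrow> ('j \<Rightarrow> real) \<Rightarrow> (nat \<Rightarrow> ('a, 'b) hilbert_tensor) set \<Rightarrow>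
    ((nat \<Rightarrow> 'a) set \<Rightarrow> (nat \<Rightarrow> 'b) set) \<Rightarrow> bool" where
  "kernel_of \<Psi>\<^sub>1 \<Psi>\<^sub>2 w\<^sub>1 w\<^sub>2 K T \<longleftrightarrow>
    (\<forall>f\<^sub>1\<in>coorbit 1 \<Psi>\<^sub>1 w\<^sub>1. \<forall>f\<^sub>2\<in>coorbit 1 \<Psi>\<^sub>2 w\<^sub>2.
      coorbit_pairing \<Psi>\<^sub>2 (T f\<^sub>1) f\<^sub>2 =
      tensor_coorbit_pairing \<Psi>\<^sub>1 \<Psi>\<^sub>2 K (coorbit_tensor \<Psi>\<^sub>1 \<Psi>\<^sub>2 w\<^sub>1 w\<^sub>2 f\<^sub>1 f\<^sub>2))"

end

theory Submission
  imports Defs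
begin

text \<open>An element of a co-orbit space is the same thing as its family of coefficients with respect to the
canonical dual frame. Write \<open>\<phi>\<^sub>i\<close> for the members of the dual frame,
\<open>P = (\<langle>\<psi>\<^sub>j, \<phi>\<^sub>i\<rangle>)\<close>, \<open>G\<close> for the Gram matrix of the frame and \<open>D\<close> for the
Gram matrix of its dual. Then \<open>P\<close> is idempotent, \<open>D G = G D = P\<close> and \<open>P D = D P = D\<close>; the
co-orbit space for \<open>p = 1\<close> is \<open>{c \<in> \<ell>\<^sup>1\<^sub>w. P c = c}\<close> and the one for
\<open>p = \<infinity>\<close> and the weight \<open>1/w\<close> is \<open>{d. P d = d}\<close> inside the sequences with
\<open>\<bar>d\<^sub>i\<bar> \<le> M w\<^sub>i\<close> (locale \<open>coefficient_system\<close>). The tensor product of two frames has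
the same structure, with the entrywise conjugate of \<open>P\<^sub>1\<close> tensored with \<open>P\<^sub>2\<close> in the place of
\<open>P\<close> (\<open>tensor_coefficient_system\<close>).

In these coordinates, let \<open>k\<close> be the coefficients of \<open>K\<close>. The kernel identity says exactly that
\<open>O f\<close> has the coefficients \<open>\<Sum>\<^sub>i k\<^sub>i\<^sub>j \<langle>f, \<psi>\<^sub>i\<rangle>\<close> (\<open>kernel_of_iff\<close>): one implication is
Fubini's theorem, the other one takes \<open>\<phi>\<^sub>j\<close> as the second test element. A bounded kernel
therefore defines an operator. Conversely, \<open>f = \<Sum>\<^sub>i \<langle>f, \<psi>\<^sub>i\<rangle> \<phi>\<^sub>i\<close> converges in the
co-orbit space for \<open>p = 1\<close>, so a bounded \<open>O\<close> is determined by
\<open>k\<^sub>i\<^sub>j = (O \<phi>\<^sub>i)\<^sub>j\<close>, and these numbers are the coefficients of a kernel. The norm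
estimates come from the boundedness of \<open>G\<close> and \<open>D\<close> on \<open>\<ell>\<^sup>1\<^sub>w\<close>; for \<open>D\<close> this bounds the norm of
\<open>\<phi>\<^sub>i\<close> by a multiple of \<open>w\<^sub>i\<close>.

All of this needs \<open>P\<close>, \<open>G\<close> and \<open>D\<close> to act boundedly on the weighted sequence spaces. A
hermitian matrix of the algebra satisfies Schur's test for the weight, because admissibility with
\<open>p = 1\<close> bounds its columns (\<open>admissible_imp_schur\<close>). So the essential point is that \<open>P\<close>
and \<open>D\<close> belong to the algebra as soon as \<open>G\<close> does (\<open>projection_mem\<close>,
\<open>dual_gram_mem\<close>). On \<open>\<ell>\<^sup>2\<close>, the spectrum of \<open>G\<close> lies in \<open>{0} \<union> [a, b]\<close> with the
frame bounds \<open>a\<close> and \<open>b\<close>, and \<open>1 - P\<close> is the spectral projection of the point \<open>0\<close>: the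
mean of the resolvents \<open>(1 - s G)\<^sup>-\<^sup>1\<close> over the circle \<open>\<bar>s\<bar> = 2/a\<close>. These resolvents lie in
the algebra by inverse-closedness and are uniformly bounded in its norm, so the means over the
\<open>2\<^sup>n\<close>-th roots of unity form a Cauchy sequence there. Solidity makes the matrix entries
continuous, which identifies the limit. Finally \<open>D\<close> is obtained by inverting \<open>1 + G - P\<close>.

Operators on the Hilbert space keep the computations with matrices short: if \<open>S\<close> is the frame
operator, then \<open>G\<close>, \<open>P\<close> and \<open>D\<close> are the matrices
\<open>(\<langle>U \<psi>\<^sub>j, \<psi>\<^sub>i\<rangle>)\<close> for \<open>U = 1, S\<^sup>-\<^sup>1, S\<^sup>-\<^sup>2\<close>, and multiplying such matrices amounts to
composing operators (\<open>mat_mult_op_matrix\<close>).\<close>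

section \<open>Weighted sequence spaces\<close>

text \<open>The form in which Fubini's theorem is applied throughout: absolute summability in one order, with the
sums of the rows dominated by a summable family, gives everything about the other order.\<close>

lemma dominated_Fubini:
  fixes f :: "'x \<Rightarrow> 'y \<Rightarrow> 'c::banach"
  assumes f: "\<And>x. (\<lambda>y. norm (f x y)) summable_on UNIV"
    and g: "g summable_on UNIV" "\<And>x. (\<Sum>\<^sub>\<infinity>y. norm (f x y)) \<le> g x"
  shows "(\<lambda>x. norm (f x y)) summable_on UNIV"
    and "(\<lambda>y. \<Sum>\<^sub>\<infinity>x. norm (f x y)) summable_on UNIV"
    and "(\<Sum>\<^sub>\<infinity>y. \<Sum>\<^sub>\<infinity>x. norm (f x y)) \<le> (\<Sum>\<^sub>\<infinity>x. g x)"
    and "(\<Sum>\<^sub>\<infinity>y. \<Sum>\<^sub>\<infinity>x. f x y) = (\<Sum>\<^sub>\<infinity>x. \<Sum>\<^sub>\<infinity>y. f x y)"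
    and "(\<lambda>(x, y). norm (f x y)) summable_on UNIV"
proof -
  have G: "(\<lambda>x. \<Sum>\<^sub>\<infinity>y. norm (f x y)) summable_on UNIV"
    by (rule summable_on_comparison_test[OF g(1)]) (auto intro: g(2) infsum_nonneg)
  have abs: "(\<lambda>z. norm (case z of (x, y) \<Rightarrow> f x y)) summable_on UNIV \<times> UNIV"
    by (rule Infinite_Sum.abs_summable_on_Sigma_iff[THEN iffD2]) (use f G in \<open>auto simp: infsum_nonneg\<close>)
  have nrm: "(\<lambda>(x, y). norm (f x y)) summable_on UNIV \<times> UNIV"
    using abs by (simp add: case_prod_unfold)
  then show "(\<lambda>(x, y). norm (f x y)) summable_on UNIV" by simp
  have nrm': "(\<lambda>(y, x). norm (f x y)) summable_on UNIV \<times> UNIV"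
    using nrm by (subst summable_on_swap) (simp add: case_prod_unfold)
  show "(\<lambda>x. norm (f x y)) summable_on UNIV"
    using summable_on_SigmaD1[OF nrm', of y] by simp
  show "(\<lambda>y. \<Sum>\<^sub>\<infinity>x. norm (f x y)) summable_on UNIV"
    using summable_on_Sigma_banach[OF nrm'] by simp
  have "(\<Sum>\<^sub>\<infinity>y. \<Sum>\<^sub>\<infinity>x. norm (f x y)) = (\<Sum>\<^sub>\<infinity>x. \<Sum>\<^sub>\<infinity>y. norm (f x y))"
    by (rule infsum_swap_banach[OF nrm, symmetric])
  also have "\<dots> \<le> (\<Sum>\<^sub>\<infinity>x. g x)" by (rule infsum_mono[OF G g(1) g(2)])
  finally show "(\<Sum>\<^sub>\<infinity>y. \<Sum>\<^sub>\<infinity>x. norm (f x y)) \<le> (\<Sum>\<^sub>\<infinity>x. g x)" .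
  show "(\<Sum>\<^sub>\<infinity>y. \<Sum>\<^sub>\<infinity>x. f x y) = (\<Sum>\<^sub>\<infinity>x. \<Sum>\<^sub>\<infinity>y. f x y)"
    by (rule infsum_swap_banach[symmetric]) (rule abs_summable_summable[OF abs])
qed

lemma infsum_dominated_convergence:
  fixes f :: "nat \<Rightarrow> 'i \<Rightarrow> 'c::{banach, second_countable_topology}"
  assumes g: "g summable_on UNIV" and le: "\<And>n i. norm (f n i) \<le> g i"
    and lim: "\<And>i. (\<lambda>n. f n i) \<longlonglongrightarrow> h i"
  shows "(\<lambda>n. \<Sum>\<^sub>\<infinity>i. f n i) \<longlonglongrightarrow> (\<Sum>\<^sub>\<infinity>i. h i)"
proof -
  have h: "norm (h i) \<le> g i" for i
    by (rule tendsto_upperbound[OF tendsto_norm[OF lim]]) (simp_all add: le)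
  have abs: "Infinite_Set_Sum.abs_summable_on u UNIV" if "\<And>i. norm (u i) \<le> g i" for u :: "'i \<Rightarrow> 'c"
    using Infinite_Sum.abs_summable_on_comparison_test'[OF g that] by (simp add: abs_summable_equivalent)
  have eq: "(\<Sum>\<^sub>\<infinity>i. u i) = lebesgue_integral (count_space UNIV) u" if "\<And>i. norm (u i) \<le> g i" for u :: "'i \<Rightarrow> 'c"
    using infsetsum_infsum[OF abs[OF that]] by (simp add: infsetsum_def)
  have "integrable (count_space UNIV) g"
  proof -
    have "0 \<le> g i" for i using order_trans[OF norm_ge_zero le] .
    then have "(\<lambda>i. norm (g i)) summable_on UNIV" using g by simp
    then have "Infinite_Set_Sum.abs_summable_on g UNIV" by (rule iffD1[OF abs_summable_equivalent])
    then show ?thesis by (simp only: Infinite_Set_Sum.abs_summable_on_def)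
  qed
  then have "(\<lambda>n. lebesgue_integral (count_space UNIV) (f n)) \<longlonglongrightarrow> lebesgue_integral (count_space UNIV) h"
    by (rule integral_dominated_convergence[rotated 2]) (auto intro: le lim)
  then show ?thesis by (simp add: eq le h)
qed

definition l1_summable :: "('i \<Rightarrow> real) \<Rightarrow> ('i \<Rightarrow> complex) \<Rightarrow> bool" where
  "l1_summable w c \<longleftrightarrow> (\<lambda>i. cmod (c i) * w i) summable_on UNIV"

definition l1_norm :: "('i \<Rightarrow> real) \<Rightarrow> ('i \<Rightarrow> complex) \<Rightarrow> real" where
  "l1_norm w c = (\<Sum>\<^sub>\<infinity>i. cmod (c i) * w i)"

lemma infsum_ennreal_eq:
  fixes f :: "'i \<Rightarrow> real"
  assumes nonneg: "\<And>i. 0 \<le> f i"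
  shows "(\<Sum>\<^sub>\<infinity>i. ennreal (f i)) = (if f summable_on UNIV then ennreal (\<Sum>\<^sub>\<infinity>i. f i) else \<infinity>)"
proof -
  have sup: "(\<Sum>\<^sub>\<infinity>i. ennreal (f i)) = (SUP F\<in>{F. finite F}. ennreal (sum f F))"
    using nonneg by (subst nonneg_infsum_complete) (auto simp: sum_ennreal)
  show ?thesis
  proof (cases "f summable_on UNIV")
    case True
    then show ?thesis using infsum_nonneg_is_SUPREMUM_ennreal[OF True] nonneg sup by simp
  next
    case False
    have "(\<Sum>\<^sub>\<infinity>i. ennreal (f i)) = \<infinity>"
    proof (rule ccontr)
      \<comment> \<open>A finite value bounds all finite partial sums, so that \<open>f\<close> would be summable.\<close>
      assume "(\<Sum>\<^sub>\<infinity>i. ennreal (f i)) \<noteq> \<infinity>"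
      then obtain r where r: "(\<Sum>\<^sub>\<infinity>i. ennreal (f i)) = ennreal r" "0 \<le> r"
        by (metis ennreal_cases infinity_ennreal_def)
      have "sum f F \<le> r" if "finite F" for F
      proof -
        have "ennreal (sum f F) \<le> ennreal r"
          unfolding r(1)[symmetric] sup using that by (intro SUP_upper) simp
        then show ?thesis using r(2) by (simp add: ennreal_le_iff)
      qed
      then have "bdd_above (sum f ` {F. F \<subseteq> UNIV \<and> finite F})" by (auto intro!: bdd_aboveI)
      then show False using False nonneg nonneg_bdd_above_summable_on[of UNIV f] by auto
    qed
    with False show ?thesis by simp
  qed
qed

text \<open>The following three lemmas replace the extended real norms by statements about real sums and bounds,
which is how the sequence spaces are treated from here on.\<close>

lemma lp_norm_1:
  assumes "\<And>i. 0 < w i"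
  shows "lp_norm 1 w c = (if l1_summable w c then ennreal (l1_norm w c) else \<infinity>)"
proof -
  have nonneg: "0 \<le> cmod (c i) * w i" for i using assms[of i] by simp
  have "(\<Sum>\<^sub>\<infinity>i. ennreal ((cmod (c i) * w i) powr enn2real 1)) = (\<Sum>\<^sub>\<infinity>i. ennreal (cmod (c i) * w i))"
    using nonneg by (intro infsum_cong) simp
  also have "\<dots> = (if l1_summable w c then ennreal (l1_norm w c) else \<infinity>)"
    unfolding l1_summable_def l1_norm_def by (rule infsum_ennreal_eq[OF nonneg])
  finally show ?thesis
    unfolding lp_norm_def Let_def using infsum_nonneg[of UNIV "\<lambda>i. cmod (c i) * w i"] nonneg
    by (auto simp: l1_norm_def)
qed

lemma lp_norm_2:
  "lp_norm 2 (\<lambda>_. 1) c = (if (\<lambda>i. (cmod (c i))\<^sup>2) summable_on UNIV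
    then ennreal (sqrt (\<Sum>\<^sub>\<infinity>i. (cmod (c i))\<^sup>2)) else \<infinity>)"
proof -
  have "(\<Sum>\<^sub>\<infinity>i. ennreal ((cmod (c i) * 1) powr enn2real 2)) = (\<Sum>\<^sub>\<infinity>i. ennreal ((cmod (c i))\<^sup>2))"
    by (intro infsum_cong) (simp add: powr_numeral)
  also have "\<dots> = (if (\<lambda>i. (cmod (c i))\<^sup>2) summable_on UNIV
      then ennreal (\<Sum>\<^sub>\<infinity>i. (cmod (c i))\<^sup>2) else \<infinity>)"
    by (rule infsum_ennreal_eq) simp
  finally show ?thesis
    unfolding lp_norm_def Let_def using infsum_nonneg[of UNIV "\<lambda>i. (cmod (c i))\<^sup>2"]
    by (auto simp: powr_half_sqrt)
qed

lemma lp_norm_inf_le_iff: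
  assumes "\<And>i. 0 < w i" and "0 \<le> M"
  shows "lp_norm \<infinity> (\<lambda>i. 1 / w i) c \<le> ennreal M \<longleftrightarrow> (\<forall>i. cmod (c i) \<le> M * w i)"
proof -
  have "cmod (c i) / w i \<le> M \<longleftrightarrow> cmod (c i) \<le> M * w i" for i
    using assms(1)[of i] by (simp add: divide_le_eq)
  then show ?thesis
    unfolding lp_norm_def using assms by (simp add: SUP_le_iff ennreal_le_iff)
qed

lemma l1_norm_nonneg: "(\<And>i. 0 < w i) \<Longrightarrow> 0 \<le> l1_norm w c"
  unfolding l1_norm_def by (rule infsum_nonneg) (simp add: less_imp_le)

lemma l1_summable_finite_support:
  assumes "finite {i. c i \<noteq> 0}"
  shows "l1_summable w c"
  unfolding l1_summable_def
  by (rule finite_nonzero_values_imp_summable_on) (rule finite_subset[OF _ assms], auto)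

lemma l1_le:
  assumes w: "\<And>i. 0 < w i" and d: "l1_summable w d" and le: "\<And>i. cmod (c i) \<le> cmod (d i)"
  shows "l1_summable w c" and "l1_norm w c \<le> l1_norm w d"
proof -
  have le': "cmod (c i) * w i \<le> cmod (d i) * w i" for i
    using le w less_imp_le by (simp add: mult_right_mono)
  show s: "l1_summable w c"
    unfolding l1_summable_def
    by (rule summable_on_comparison_test[OF d[unfolded l1_summable_def]])
      (use le' w in \<open>auto simp: less_imp_le\<close>)
  show "l1_norm w c \<le> l1_norm w d"
    unfolding l1_norm_def
    by (rule infsum_mono[OF s[unfolded l1_summable_def] d[unfolded l1_summable_def] le'])
qed

lemma l1_add:
  assumes w: "\<And>i. 0 < w i" and c: "l1_summable w c" and d: "l1_summable w d"
  shows "l1_summable w (\<lambda>i. c i + d i)" and "l1_norm w (\<lambda>i. c i + d i) \<le> l1_norm w c + l1_norm w d"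
proof -
  have sum: "(\<lambda>i. cmod (c i) * w i + cmod (d i) * w i) summable_on UNIV"
    using c d unfolding l1_summable_def by (rule summable_on_add)
  have le: "cmod (c i + d i) * w i \<le> cmod (c i) * w i + cmod (d i) * w i" for i
    using w[of i] norm_triangle_ineq[of "c i" "d i"]
    by (metis distrib_right less_eq_real_def mult_right_mono)
  show s: "l1_summable w (\<lambda>i. c i + d i)"
    unfolding l1_summable_def
    by (rule summable_on_comparison_test[OF sum le]) (use w in \<open>auto simp: less_imp_le\<close>)
  have "l1_norm w (\<lambda>i. c i + d i) \<le> (\<Sum>\<^sub>\<infinity>i. cmod (c i) * w i + cmod (d i) * w i)"
    unfolding l1_norm_def by (rule infsum_mono[OF s[unfolded l1_summable_def] sum le])
  also have "\<dots> = l1_norm w c + l1_norm w d"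
    unfolding l1_norm_def using c d unfolding l1_summable_def by (rule infsum_add)
  finally show "l1_norm w (\<lambda>i. c i + d i) \<le> l1_norm w c + l1_norm w d" .
qed

lemma l1_scale:
  assumes c: "l1_summable w c"
  shows "l1_summable w (\<lambda>i. a * c i)" and "l1_norm w (\<lambda>i. a * c i) = cmod a * l1_norm w c"
proof -
  have eq: "cmod (a * c i) * w i = cmod a * (cmod (c i) * w i)" for i
    by (simp add: norm_mult)
  show "l1_summable w (\<lambda>i. a * c i)"
    using c unfolding l1_summable_def eq by (rule summable_on_cmult_right)
  show "l1_norm w (\<lambda>i. a * c i) = cmod a * l1_norm w c"
    unfolding l1_norm_def eq by (rule infsum_cmult_right')
qed

lemma l1_diff:
  assumes w: "\<And>i. 0 < w i" and c: "l1_summable w c" and d: "l1_summable w d"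
  shows "l1_summable w (\<lambda>i. c i - d i)"
  using l1_add(1)[OF w c l1_scale(1)[OF d, of "-1"]] by simp

text \<open>Convergence in the norm therefore implies convergence of all coefficients.\<close>

lemma coeff_le_l1_norm:
  assumes w: "\<And>i. 0 < w i" and c: "l1_summable w c"
  shows "cmod (c i) * w i \<le> l1_norm w c"
proof -
  have "sum (\<lambda>i. cmod (c i) * w i) {i} \<le> l1_norm w c"
    unfolding l1_norm_def
    by (rule finite_sum_le_infsum[OF c[unfolded l1_summable_def]]) (use w in \<open>auto simp: less_imp_le\<close>)
  then show ?thesis by simp
qed

lemma l1_by_finite_sums:
  assumes w: "\<And>i. 0 < w i" and le: "\<And>F. finite F \<Longrightarrow> (\<Sum>i\<in>F. cmod (c i) * w i) \<le> b"
  shows "l1_summable w c" and "l1_norm w c \<le> b"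
proof -
  show s: "l1_summable w c"
    unfolding l1_summable_def
    by (rule nonneg_bdd_above_summable_on) (use w le in \<open>auto simp: less_imp_le intro!: bdd_aboveI\<close>)
  show "l1_norm w c \<le> b"
    unfolding l1_norm_def by (rule infsum_le_finite_sums[OF s[unfolded l1_summable_def] le])
qed

text \<open>Summability of the differences is part of the definition because \<open>l1_norm\<close> takes the default
value \<open>0\<close> on families that are not summable.\<close>

definition l1_conv :: "('i \<Rightarrow> real) \<Rightarrow> (nat \<Rightarrow> 'i \<Rightarrow> complex) \<Rightarrow> ('i \<Rightarrow> complex) \<Rightarrow> bool" where
  "l1_conv w C c \<longleftrightarrow> (\<forall>n. l1_summable w (\<lambda>i. C n i - c i)) \<and>
    (\<lambda>n. l1_norm w (\<lambda>i. C n i - c i)) \<longlonglongrightarrow> 0"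

lemma l1_conv_coeff:
  assumes w: "\<And>i. 0 < w i" and C: "l1_conv w C c"
  shows "(\<lambda>n. C n i) \<longlonglongrightarrow> c i"
proof -
  have lim: "(\<lambda>n. l1_norm w (\<lambda>i. C n i - c i) / w i) \<longlonglongrightarrow> 0"
    using C unfolding l1_conv_def by (intro tendsto_divide_zero) auto
  have "(\<lambda>n. C n i - c i) \<longlonglongrightarrow> 0"
  proof (rule Lim_null_comparison[OF _ lim])
    show "\<forall>\<^sub>F n in sequentially. norm (C n i - c i) \<le> l1_norm w (\<lambda>i. C n i - c i) / w i"
      using coeff_le_l1_norm[where w = w and i = i and c = "\<lambda>i. C _ i - c i", OF w] C w[of i]
      unfolding l1_conv_def by (intro always_eventually allI) (simp add: le_divide_eq)
  qed
  then show ?thesis by (simp add: LIM_zero_iff)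
qed

lemma l1_complete:
  assumes w: "\<And>i. 0 < w i" and C: "\<And>n. l1_summable w (C n)"
    and cauchy: "\<And>e. e > 0 \<Longrightarrow> \<exists>M. \<forall>m\<ge>M. \<forall>n\<ge>M. l1_norm w (\<lambda>i. C m i - C n i) < e"
  shows "\<exists>c. l1_summable w c \<and> l1_conv w C c"
proof -
  have coef: "cmod (C m i - C n i) * w i \<le> l1_norm w (\<lambda>i. C m i - C n i)" for m n i
    using coeff_le_l1_norm[OF w l1_diff[OF w C C], where i = i] by simp
  have "Cauchy (\<lambda>n. C n i)" for i
  proof (rule metric_CauchyI)
    fix e :: real assume "e > 0"
    then obtain M where M: "\<forall>m\<ge>M. \<forall>n\<ge>M. l1_norm w (\<lambda>i. C m i - C n i) < e * w i"
      using cauchy[of "e * w i"] w[of i] by auto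
    have "dist (C m i) (C n i) < e" if "m \<ge> M" "n \<ge> M" for m n
    proof -
      have "cmod (C m i - C n i) * w i < e * w i" using M that coef[of m i n] by force
      then show ?thesis using w[of i] by (simp add: dist_norm)
    qed
    then show "\<exists>M. \<forall>m\<ge>M. \<forall>n\<ge>M. dist (C m i) (C n i) < e" by blast
  qed
  then have "\<exists>l. (\<lambda>n. C n i) \<longlonglongrightarrow> l" for i
    by (meson Cauchy_convergent convergent_def)
  then obtain c where c: "\<And>i. (\<lambda>n. C n i) \<longlonglongrightarrow> c i" by metis
  \<comment> \<open>The Cauchy estimate passes to the coefficientwise limit on finite sets of indices, hence to the norm.\<close>
  have lim: "l1_summable w (\<lambda>i. C m i - c i) \<and> l1_norm w (\<lambda>i. C m i - c i) \<le> e"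
    if M: "\<forall>m\<ge>M. \<forall>n\<ge>M. l1_norm w (\<lambda>i. C m i - C n i) < e" and "m \<ge> M" for e m M
  proof -
    have fs: "(\<Sum>i\<in>F. cmod (C m i - c i) * w i) \<le> e" if "finite F" for F
    proof (rule tendsto_upperbound)
      show "(\<lambda>n. \<Sum>i\<in>F. cmod (C m i - C n i) * w i) \<longlonglongrightarrow> (\<Sum>i\<in>F. cmod (C m i - c i) * w i)"
        by (intro tendsto_intros c)
      show "\<forall>\<^sub>F n in sequentially. (\<Sum>i\<in>F. cmod (C m i - C n i) * w i) \<le> e"
      proof (rule eventually_sequentiallyI)
        fix n assume "n \<ge> M"
        have "(\<Sum>i\<in>F. cmod (C m i - C n i) * w i) \<le> l1_norm w (\<lambda>i. C m i - C n i)"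
          unfolding l1_norm_def using l1_diff[OF w C C] w \<open>finite F\<close>
          by (intro finite_sum_le_infsum) (auto simp: l1_summable_def less_imp_le)
        also have "\<dots> < e" using M \<open>n \<ge> M\<close> \<open>m \<ge> M\<close> by blast
        finally show "(\<Sum>i\<in>F. cmod (C m i - C n i) * w i) \<le> e" by simp
      qed
    qed simp
    show ?thesis using l1_by_finite_sums[of w, OF w fs] by simp
  qed
  obtain M where "\<forall>m\<ge>M. \<forall>n\<ge>M. l1_norm w (\<lambda>i. C m i - C n i) < 1" using cauchy[of 1] by auto
  then have cM: "l1_summable w (\<lambda>i. C M i - c i)" using lim by blast
  have sc: "l1_summable w c" using l1_diff[OF w C[of M] cM] by simp
  have "(\<lambda>n. l1_norm w (\<lambda>i. C n i - c i)) \<longlonglongrightarrow> 0"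
  proof (rule LIMSEQ_I)
    fix r :: real assume "r > 0"
    then obtain M where "\<forall>m\<ge>M. \<forall>n\<ge>M. l1_norm w (\<lambda>i. C m i - C n i) < r / 2"
      using cauchy[of "r / 2"] by auto
    then have le: "l1_norm w (\<lambda>i. C m i - c i) \<le> r / 2" if "m \<ge> M" for m using lim that by blast
    have "norm (l1_norm w (\<lambda>i. C m i - c i) - 0) < r" if "m \<ge> M" for m
      using le[OF that] \<open>r > 0\<close> l1_norm_nonneg[of w "\<lambda>i. C m i - c i", OF w] by simp
    then show "\<exists>no. \<forall>n\<ge>no. norm (l1_norm w (\<lambda>i. C n i - c i) - 0) < r" by blast
  qed
  then show ?thesis using sc l1_diff[OF w C sc] unfolding l1_conv_def by blast
qed

text \<open>The index types are countable; cutting off along \<open>to_nat\<close> turns sums over them into limits of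
sequences, as the definition of the co-orbit spaces by sequences requires.\<close>

definition truncate :: "nat \<Rightarrow> ('i::countable \<Rightarrow> complex) \<Rightarrow> 'i \<Rightarrow> complex" where
  "truncate n c i = (if to_nat i < n then c i else 0)"

lemma finite_to_nat_less: "finite {i::'i::countable. to_nat i < n}"
  by (rule finite_imageD[of to_nat]) (auto intro: finite_subset[of _ "{..<n}"] inj_onI)

lemma cmod_truncate_le: "cmod (truncate n c i) \<le> cmod (c i)"
  by (simp add: truncate_def)

lemma truncate_tendsto: "(\<lambda>n. truncate n c i) \<longlonglongrightarrow> c i"
  by (rule tendsto_eventually)
    (auto simp: truncate_def eventually_sequentially intro!: exI[of _ "Suc (to_nat i)"])

lemma filterlim_to_nat_less:
  "filterlim (\<lambda>n. {i::'i::countable. to_nat i < n}) (finite_subsets_at_top UNIV) sequentially"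
proof (rule filterlim_finite_subsets_at_top[THEN iffD2], intro allI impI)
  fix X :: "'i set" assume X: "finite X \<and> X \<subseteq> UNIV"
  then obtain N where "\<And>i. i \<in> X \<Longrightarrow> to_nat i < N"
    using finite_nat_set_iff_bounded[of "to_nat ` X"] by auto
  then show "\<forall>\<^sub>F n in sequentially. finite {i::'i. to_nat i < n} \<and>
      X \<subseteq> {i. to_nat i < n} \<and> {i. to_nat i < n} \<subseteq> UNIV"
    using finite_to_nat_less by (auto simp: eventually_sequentially intro!: exI[of _ N] dest: less_le_trans)
qed

lemma has_sum_imp_LIMSEQ:
  "(f has_sum s) (UNIV :: 'i::countable set) \<Longrightarrow> (\<lambda>n. \<Sum>i\<in>{i. to_nat i < n}. f i) \<longlonglongrightarrow> s"
  unfolding has_sum_def using filterlim_compose[OF _ filterlim_to_nat_less] by blast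

lemma l1_conv_truncate:
  fixes c :: "'i::countable \<Rightarrow> complex"
  assumes w: "\<And>i. 0 < w i" and c: "l1_summable w c"
  shows "l1_conv w (\<lambda>n. truncate n c) c"
proof -
  have "(\<lambda>n. \<Sum>\<^sub>\<infinity>i. cmod (truncate n c i - c i) * w i) \<longlonglongrightarrow> (\<Sum>\<^sub>\<infinity>i::'i. 0)"
  proof (rule infsum_dominated_convergence[OF c[unfolded l1_summable_def]])
    show "norm (cmod (truncate n c i - c i) * w i) \<le> cmod (c i) * w i" for n i
      using w[of i] by (simp add: truncate_def)
    have "(\<lambda>n. cmod (truncate n c i - c i) * w i) \<longlonglongrightarrow> cmod (c i - c i) * w i" for i
      by (intro tendsto_intros truncate_tendsto)
    then show "(\<lambda>n. cmod (truncate n c i - c i) * w i) \<longlonglongrightarrow> 0" for i by simp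
  qed
  moreover have "l1_summable w (\<lambda>i. truncate n c i - c i)" for n
    by (rule l1_le[OF w c]) (simp add: truncate_def)
  ultimately show ?thesis unfolding l1_conv_def l1_norm_def by simp
qed

text \<open>Truncations are dense in \<open>\<ell>\<^sup>1\<^sub>w\<close>, so a bounded functional is determined by its values on the unit
vectors, here the rows of the identity matrix. This recovers an operator from its kernel.\<close>

lemma l1_functional_has_sum:
  fixes L :: "('i::countable \<Rightarrow> complex) \<Rightarrow> complex"
  assumes w: "\<And>i. 0 < w i"
    and add: "\<And>c d. l1_summable w c \<Longrightarrow> l1_summable w d \<Longrightarrow> L (\<lambda>i. c i + d i) = L c + L d"
    and scale: "\<And>a c. l1_summable w c \<Longrightarrow> L (\<lambda>i. a * c i) = a * L c"
    and bound: "\<And>c. l1_summable w c \<Longrightarrow> cmod (L c) \<le> B * l1_norm w c"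
    and c: "l1_summable w c"
  shows "((\<lambda>i. c i * L (mat_one i)) has_sum L c) UNIV"
proof -
  have e: "l1_summable w (mat_one i)" for i
    by (rule l1_summable_finite_support) (simp add: mat_one_def)
  have norm_e: "l1_norm w (mat_one i) = w i" for i
    unfolding l1_norm_def
    by (subst infsum_cong_neutral[where T = "{i}" and g = w]) (auto simp: mat_one_def)
  have fin: "l1_summable w (\<lambda>i. if i \<in> F then c i else 0) \<and>
      L (\<lambda>i. if i \<in> F then c i else 0) = (\<Sum>i\<in>F. c i * L (mat_one i))" if "finite F" for F
    using that
  proof (induction F)
    case empty
    have "l1_summable w (\<lambda>_. 0)" by (rule l1_summable_finite_support) simp
    then show ?case using scale[of "\<lambda>_. 0" 0] by simp
  next
    case (insert j F)
    have eq: "(\<lambda>i. if i \<in> insert j F then c i else 0) =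
        (\<lambda>i. c j * mat_one j i + (if i \<in> F then c i else 0))"
      using insert.hyps by (auto simp: mat_one_def)
    show ?case
      unfolding eq using insert l1_add(1)[OF w l1_scale(1)[OF e[of j], of "c j"]]
        add[OF l1_scale(1)[OF e[of j], of "c j"]] scale[OF e] by simp
  qed
  have "(\<lambda>i. cmod (c i * L (mat_one i))) summable_on UNIV"
  proof (rule Infinite_Sum.abs_summable_on_comparison_test')
    show "(\<lambda>i. (cmod (c i) * w i) * B) summable_on UNIV"
      using c unfolding l1_summable_def by (rule summable_on_cmult_left)
    show "norm (c i * L (mat_one i)) \<le> (cmod (c i) * w i) * B" for i
      using mult_left_mono[OF bound[OF e[of i]], of "cmod (c i)"]
      by (simp add: norm_mult norm_e algebra_simps)
  qed
  then have summ: "(\<lambda>i. c i * L (mat_one i)) summable_on UNIV" by (rule abs_summable_summable)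
  have "(\<lambda>n. \<Sum>i\<in>{i. to_nat i < n}. c i * L (mat_one i)) \<longlonglongrightarrow> L c"
  proof -
    have eq: "(\<Sum>i\<in>{i. to_nat i < n}. c i * L (mat_one i)) = L (truncate n c)" for n
      using fin[OF finite_to_nat_less[of n]] unfolding truncate_def[abs_def] by simp
    note conv = l1_conv_truncate[OF w c]
    have "L (truncate n c) - L c = L (\<lambda>i. truncate n c i - c i)" for n
    proof -
      have s: "l1_summable w (\<lambda>i. truncate n c i - c i)" using conv unfolding l1_conv_def by blast
      show ?thesis using add[OF s c] by simp
    qed
    then have le: "norm (L (truncate n c) - L c) \<le> B * l1_norm w (\<lambda>i. truncate n c i - c i)" for n
      using bound conv unfolding l1_conv_def by simp
    have lim: "(\<lambda>n. B * l1_norm w (\<lambda>i. truncate n c i - c i)) \<longlonglongrightarrow> 0"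
      using conv unfolding l1_conv_def by (intro tendsto_mult_right_zero) blast
    have "(\<lambda>n. L (truncate n c) - L c) \<longlonglongrightarrow> 0"
      by (rule Lim_null_comparison[OF always_eventually[OF allI[OF le]] lim])
    then show ?thesis unfolding eq by (simp add: LIM_zero_iff)
  qed
  then have "(\<Sum>\<^sub>\<infinity>i. c i * L (mat_one i)) = L c"
    by (rule LIMSEQ_unique[OF has_sum_imp_LIMSEQ[OF has_sum_infsum[OF summ]]])
  then show ?thesis using has_sum_infsum[OF summ] by simp
qed

section \<open>Hermitian matrices satisfying Schur's test\<close>

text \<open>The row condition of Schur's test for the weights \<open>w\<close>; for a hermitian matrix it is also the column
condition. Together they give boundedness on \<open>\<ell>\<^sup>1\<^sub>w\<close> and on \<open>\<ell>\<^sup>\<infinity>\<close> with the weight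
\<open>1/w\<close>, the only two spaces that occur.\<close>

definition schur :: "('i \<Rightarrow> real) \<Rightarrow> real \<Rightarrow> 'i matrix \<Rightarrow> bool" where
  "schur w B A \<longleftrightarrow> (\<forall>i. 0 < w i) \<and> (\<forall>i j. A j i = cnj (A i j)) \<and>
    (\<forall>i. (\<lambda>j. cmod (A i j) * w j) summable_on UNIV \<and> (\<Sum>\<^sub>\<infinity>j. cmod (A i j) * w j) \<le> B * w i)"

lemma schur_mono:
  assumes "schur w B A" and "B \<le> B'"
  shows "schur w B' A"
proof -
  have "B * w i \<le> B' * w i" for i
    using assms unfolding schur_def by (intro mult_right_mono) (auto simp: less_imp_le)
  then show ?thesis using assms(1) unfolding schur_def by (meson order_trans)
qed

lemma mat_vec_mat_one: "mat_vec A (mat_one j) i = A i j"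
proof -
  have "(\<Sum>\<^sub>\<infinity>k. A i k * mat_one j k) = (\<Sum>\<^sub>\<infinity>k\<in>{j}. A i k * mat_one j k)"
    by (rule infsum_cong_neutral) (auto simp: mat_one_def)
  then show ?thesis by (simp add: mat_vec_def mat_one_def)
qed

lemma l1_summable_mat_one: "l1_summable w (mat_one j)"
  by (rule l1_summable_finite_support) (simp add: mat_one_def)

lemma l1_norm_mat_one: "l1_norm w (mat_one j) = w j"
proof -
  have "(\<Sum>\<^sub>\<infinity>k. cmod (mat_one j k) * w k) = (\<Sum>\<^sub>\<infinity>k\<in>{j}. cmod (mat_one j k) * w k)"
    by (rule infsum_cong_neutral) (auto simp: mat_one_def)
  then show ?thesis by (simp add: l1_norm_def mat_one_def)
qed

text \<open>The infinite sums in \<open>A (A' c)\<close> may be exchanged once the double sum is dominated.\<close>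

lemma mat_vec_assoc_aux:
  assumes "\<And>j. (\<lambda>k. norm (A i j * (A' j k * c k))) summable_on UNIV"
    and "g summable_on UNIV" and "\<And>j. (\<Sum>\<^sub>\<infinity>k. norm (A i j * (A' j k * c k))) \<le> g j"
  shows "mat_vec A (mat_vec A' c) i = mat_vec (mat_mult A A') c i"
proof -
  have "mat_vec A (mat_vec A' c) i = (\<Sum>\<^sub>\<infinity>j. \<Sum>\<^sub>\<infinity>k. A i j * (A' j k * c k))"
    unfolding mat_vec_def by (simp add: infsum_cmult_right')
  also have "\<dots> = (\<Sum>\<^sub>\<infinity>k. \<Sum>\<^sub>\<infinity>j. A i j * (A' j k * c k))"
    by (rule dominated_Fubini(4)[OF assms, symmetric])
  also have "\<dots> = mat_vec (mat_mult A A') c i"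
    unfolding mat_vec_def mat_mult_def mult.assoc[symmetric] by (simp add: infsum_cmult_left')
  finally show ?thesis .
qed

context
  fixes w :: "'i \<Rightarrow> real" and B :: real and A :: "'i matrix"
  assumes A: "schur w B A"
begin

lemma schur_weight_pos: "0 < w i"
  using A unfolding schur_def by blast

lemma schur_cnj: "A j i = cnj (A i j)"
  using A unfolding schur_def by blast

lemma schur_row:
  shows "(\<lambda>j. cmod (A i j) * w j) summable_on UNIV" and "(\<Sum>\<^sub>\<infinity>j. cmod (A i j) * w j) \<le> B * w i"
  using A unfolding schur_def by blast+

lemma schur_const_nonneg: "0 \<le> B"
proof -
  have "0 \<le> B * w i" for i
    using schur_row(2)[of i] infsum_nonneg[of UNIV "\<lambda>j. cmod (A i j) * w j"] schur_weight_pos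
    by (auto simp: less_imp_le)
  then show ?thesis using schur_weight_pos by (simp add: zero_le_mult_iff less_le_not_le)
qed

lemma schur_column:
  shows "l1_summable w (\<lambda>i. A i j)" and "l1_norm w (\<lambda>i. A i j) \<le> B * w j"
proof -
  have "cmod (A i j) = cmod (A j i)" for i by (simp add: schur_cnj[of i j])
  then show "l1_summable w (\<lambda>i. A i j)" and "l1_norm w (\<lambda>i. A i j) \<le> B * w j"
    using schur_row[of j] by (simp_all add: l1_summable_def l1_norm_def)
qed

lemma schur_bounded:
  assumes d: "\<And>j. cmod (d j) \<le> M * w j"
  shows "(\<lambda>j. norm (A i j * d j)) summable_on UNIV"
    and "(\<Sum>\<^sub>\<infinity>j. norm (A i j * d j)) \<le> B * M * w i"
    and "cmod (mat_vec A d i) \<le> B * M * w i"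
proof -
  have le: "norm (A i j * d j) \<le> (cmod (A i j) * w j) * M" for j
    using mult_left_mono[OF d[of j], of "cmod (A i j)"] by (simp add: norm_mult algebra_simps)
  have s: "(\<lambda>j. (cmod (A i j) * w j) * M) summable_on UNIV"
    by (rule summable_on_cmult_left[OF schur_row(1)])
  have M: "0 \<le> M"
    using order_trans[OF norm_ge_zero d[of i]] schur_weight_pos[of i]
    by (simp add: zero_le_mult_iff less_le_not_le)
  show sum: "(\<lambda>j. norm (A i j * d j)) summable_on UNIV"
    by (rule Infinite_Sum.abs_summable_on_comparison_test'[OF s le])
  have "(\<Sum>\<^sub>\<infinity>j. norm (A i j * d j)) \<le> (\<Sum>\<^sub>\<infinity>j. (cmod (A i j) * w j) * M)"
    by (rule infsum_mono[OF sum s le])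
  also have "\<dots> \<le> B * M * w i"
    unfolding infsum_cmult_left' using mult_right_mono[OF schur_row(2)[of i] M] by (simp add: mult_ac)
  finally show *: "(\<Sum>\<^sub>\<infinity>j. norm (A i j * d j)) \<le> B * M * w i" .
  show "cmod (mat_vec A d i) \<le> B * M * w i"
    unfolding mat_vec_def using norm_infsum_bound[OF sum] * by simp
qed

text \<open>Stated for the sums of absolute values, since these also serve as majorants when two matrices are
applied one after the other.\<close>

lemma schur_l1_norms:
  assumes c: "l1_summable w c"
  shows "(\<lambda>j. norm (A i j * c j)) summable_on UNIV"
    and "l1_summable w (\<lambda>i. complex_of_real (\<Sum>\<^sub>\<infinity>j. norm (A i j * c j)))"
    and "l1_norm w (\<lambda>i. complex_of_real (\<Sum>\<^sub>\<infinity>j. norm (A i j * c j))) \<le> B * l1_norm w c"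
proof -
  have eq: "norm (complex_of_real (w i) * (A i j * c j)) = cmod (A i j) * w i * cmod (c j)" for i j
    using schur_weight_pos[of i] by (simp add: norm_mult)
  have col: "(\<lambda>i. norm (complex_of_real (w i) * (A i j * c j))) summable_on UNIV" for j
    unfolding eq using schur_column(1)[of j] unfolding l1_summable_def by (rule summable_on_cmult_left)
  have le: "(\<Sum>\<^sub>\<infinity>i. norm (complex_of_real (w i) * (A i j * c j))) \<le> B * (cmod (c j) * w j)" for j
    unfolding eq infsum_cmult_left' using mult_right_mono[OF schur_column(2)[of j], of "cmod (c j)"]
    by (simp add: l1_norm_def mult.assoc mult.commute[of "w j"])
  have s: "(\<lambda>j. B * (cmod (c j) * w j)) summable_on UNIV"
    using c unfolding l1_summable_def by (rule summable_on_cmult_right)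
  \<comment> \<open>The weighted double sum is finite in the order in which the columns are summed first.\<close>
  note F = dominated_Fubini[OF col s le]
  have "(\<lambda>j. w i * norm (A i j * c j)) summable_on UNIV"
    using F(1)[of i] schur_weight_pos[of i] by (simp add: norm_mult)
  then show "(\<lambda>j. norm (A i j * c j)) summable_on UNIV"
    using schur_weight_pos[of i] by (simp add: summable_on_cmult_right')
  have row: "cmod (complex_of_real (\<Sum>\<^sub>\<infinity>j. norm (A i j * c j))) * w i =
      (\<Sum>\<^sub>\<infinity>j. norm (complex_of_real (w i) * (A i j * c j)))" for i
  proof -
    have "(\<Sum>\<^sub>\<infinity>j. norm (complex_of_real (w i) * (A i j * c j))) = w i * (\<Sum>\<^sub>\<infinity>j. norm (A i j * c j))"
      using schur_weight_pos[of i] by (simp add: norm_mult[of "complex_of_real (w i)"] infsum_cmult_right')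
    moreover have "0 \<le> (\<Sum>\<^sub>\<infinity>j. norm (A i j * c j))" by (rule infsum_nonneg) simp
    ultimately show ?thesis by (simp add: mult.commute)
  qed
  show "l1_summable w (\<lambda>i. complex_of_real (\<Sum>\<^sub>\<infinity>j. norm (A i j * c j)))"
    unfolding l1_summable_def row by (rule F(2))
  have "l1_norm w (\<lambda>i. complex_of_real (\<Sum>\<^sub>\<infinity>j. norm (A i j * c j))) \<le> (\<Sum>\<^sub>\<infinity>j. B * (cmod (c j) * w j))"
    unfolding l1_norm_def row by (rule F(3))
  then show "l1_norm w (\<lambda>i. complex_of_real (\<Sum>\<^sub>\<infinity>j. norm (A i j * c j))) \<le> B * l1_norm w c"
    by (simp add: infsum_cmult_right' l1_norm_def)
qed

lemma schur_l1:
  assumes c: "l1_summable w c"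
  shows "l1_summable w (mat_vec A c)" and "l1_norm w (mat_vec A c) \<le> B * l1_norm w c"
proof -
  have le: "cmod (mat_vec A c i) \<le> cmod (complex_of_real (\<Sum>\<^sub>\<infinity>j. norm (A i j * c j)))" for i
    unfolding mat_vec_def using norm_infsum_bound[OF schur_l1_norms(1)[OF c], of i]
    by simp
  show "l1_summable w (mat_vec A c)"
    by (rule l1_le(1)[OF schur_weight_pos schur_l1_norms(2)[OF c] le])
  show "l1_norm w (mat_vec A c) \<le> B * l1_norm w c"
    using l1_le(2)[OF schur_weight_pos schur_l1_norms(2)[OF c] le] schur_l1_norms(3)[OF c]
    by (rule order_trans)
qed

lemma mat_vec_add_l1:
  assumes "l1_summable w c" and "l1_summable w d"
  shows "mat_vec A (\<lambda>i. c i + d i) = (\<lambda>i. mat_vec A c i + mat_vec A d i)"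
proof
  fix i
  show "mat_vec A (\<lambda>i. c i + d i) i = mat_vec A c i + mat_vec A d i"
    unfolding mat_vec_def distrib_left
    by (rule infsum_add) (use assms in \<open>auto intro: abs_summable_summable[OF schur_l1_norms(1)]\<close>)
qed

lemma mat_vec_scale: "mat_vec A (\<lambda>i. a * c i) = (\<lambda>i. a * mat_vec A c i)"
  unfolding mat_vec_def mult.left_commute[of _ a] by (simp add: infsum_cmult_right')

lemma mat_vec_diff_l1:
  assumes "l1_summable w c" and "l1_summable w d"
  shows "mat_vec A (\<lambda>i. c i - d i) = (\<lambda>i. mat_vec A c i - mat_vec A d i)"
  using mat_vec_add_l1[OF assms(1) l1_scale(1)[OF assms(2), of "-1"]] mat_vec_scale[of "-1" d] by simp

lemma l1_conv_mat_vec: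
  assumes C: "l1_conv w C c" and "l1_summable w c"
  shows "l1_conv w (\<lambda>n. mat_vec A (C n)) (mat_vec A c)"
proof -
  have sC: "l1_summable w (C n)" for n
  proof -
    have "l1_summable w (\<lambda>i. C n i - c i)" using C unfolding l1_conv_def by blast
    from l1_add(1)[OF schur_weight_pos this assms(2)] show ?thesis by simp
  qed
  have eq: "(\<lambda>i. mat_vec A (C n) i - mat_vec A c i) = mat_vec A (\<lambda>i. C n i - c i)" for n
    by (rule mat_vec_diff_l1[OF sC assms(2), symmetric])
  have le: "norm (l1_norm w (mat_vec A (\<lambda>i. C n i - c i))) \<le> B * l1_norm w (\<lambda>i. C n i - c i)" for n
    using schur_l1(2)[of "\<lambda>i. C n i - c i"] C l1_norm_nonneg[where w = w, OF schur_weight_pos]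
    unfolding l1_conv_def by simp
  have lim: "(\<lambda>n. B * l1_norm w (\<lambda>i. C n i - c i)) \<longlonglongrightarrow> 0"
    using C unfolding l1_conv_def by (intro tendsto_mult_right_zero) blast
  have "(\<lambda>n. l1_norm w (mat_vec A (\<lambda>i. C n i - c i))) \<longlonglongrightarrow> 0"
    by (rule Lim_null_comparison[OF always_eventually[OF allI[OF le]] lim])
  then show ?thesis unfolding l1_conv_def eq using schur_l1(1) C unfolding l1_conv_def by blast
qed

end

lemma mat_vec_assoc_l1:
  assumes A: "schur w B A" and A': "schur w B' A'" and c: "l1_summable w c"
  shows "mat_vec A (mat_vec A' c) = mat_vec (mat_mult A A') c"
proof
  fix i
  let ?h = "\<lambda>j. complex_of_real (\<Sum>\<^sub>\<infinity>k. norm (A' j k * c k))"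
  have h: "(\<lambda>j. norm (A i j * ?h j)) summable_on UNIV"
    by (rule schur_l1_norms(1)[OF A schur_l1_norms(2)[OF A' c]])
  have pos: "0 \<le> (\<Sum>\<^sub>\<infinity>k. norm (A' j k * c k))" for j by (rule infsum_nonneg) simp
  show "mat_vec A (mat_vec A' c) i = mat_vec (mat_mult A A') c i"
  proof (rule mat_vec_assoc_aux[OF _ h])
    show "(\<lambda>k. norm (A i j * (A' j k * c k))) summable_on UNIV" for j
      unfolding norm_mult[of "A i j"] by (rule summable_on_cmult_right[OF schur_l1_norms(1)[OF A' c]])
    show "(\<Sum>\<^sub>\<infinity>k. norm (A i j * (A' j k * c k))) \<le> norm (A i j * ?h j)" for j
      unfolding norm_mult[of "A i j"] using pos[of j] by (simp add: infsum_cmult_right')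
  qed
qed

lemma mat_vec_assoc_bounded:
  assumes A: "schur w B A" and A': "schur w B' A'"
    and d: "\<And>j. cmod (d j) \<le> M * w j"
  shows "mat_vec A (mat_vec A' d) = mat_vec (mat_mult A A') d"
proof
  fix i
  have h: "(\<lambda>j. cmod (A i j) * w j * (B' * M)) summable_on UNIV"
    by (rule summable_on_cmult_left[OF schur_row(1)[OF A]])
  show "mat_vec A (mat_vec A' d) i = mat_vec (mat_mult A A') d i"
  proof (rule mat_vec_assoc_aux[OF _ h])
    show "(\<lambda>k. norm (A i j * (A' j k * d k))) summable_on UNIV" for j
      unfolding norm_mult[of "A i j"] by (rule summable_on_cmult_right[OF schur_bounded(1)[OF A' d]])
    show "(\<Sum>\<^sub>\<infinity>k. norm (A i j * (A' j k * d k))) \<le> cmod (A i j) * w j * (B' * M)" for j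
      unfolding norm_mult[of "A i j"] infsum_cmult_right'
      using mult_left_mono[OF schur_bounded(2)[OF A' d, of j], of "cmod (A i j)"] by (simp add: mult_ac)
  qed
qed

text \<open>Boundedness on \<open>\<ell>\<^sup>1\<^sub>w\<close>, tested on a unit vector, bounds the weighted sum of a column; for a hermitian
matrix this is the bound for the row.\<close>

lemma admissible_imp_schur:
  assumes w: "admissible_weight \<A> w" and A: "A \<in> \<A>" and herm: "\<And>i j. A j i = cnj (A i j)"
  shows "\<exists>B. schur w B A"
proof -
  have pos: "\<And>i. 0 < w i" using w unfolding admissible_weight_def by blast
  obtain B where B: "\<forall>c\<in>lp_space 1 w. (\<forall>i. (\<lambda>j. A i j * c j) summable_on UNIV) \<and>
      lp_norm 1 w (mat_vec A c) \<le> ennreal B * lp_norm 1 w c"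
    using w A unfolding admissible_weight_def lp_bounded_def by (meson order_refl)
  have "(\<lambda>j. cmod (A i j) * w j) summable_on UNIV \<and> (\<Sum>\<^sub>\<infinity>j. cmod (A i j) * w j) \<le> max B 0 * w i" for i
  proof -
    have n1: "lp_norm 1 w (mat_one i) = ennreal (w i)"
      using lp_norm_1[where w = w, OF pos, of "mat_one i"] l1_summable_mat_one[of w i] by (simp add: l1_norm_mat_one)
    then have "mat_one i \<in> lp_space 1 w" unfolding lp_space_def by simp
    \<comment> \<open>The constant \<open>B\<close> may be negative, in which case \<open>ennreal B = 0\<close>; hence \<open>max B 0\<close> below.\<close>
    then have "lp_norm 1 w (mat_vec A (mat_one i)) \<le> ennreal B * ennreal (w i)"
      using B n1 by metis
    also have "mat_vec A (mat_one i) = (\<lambda>j. A j i)" by (rule ext) (rule mat_vec_mat_one)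
    finally have le: "lp_norm 1 w (\<lambda>j. A j i) \<le> ennreal (max B 0 * w i)"
      using pos[of i] by (cases "B \<ge> 0") (auto simp: ennreal_mult ennreal_neg less_imp_le)
    have fin: "lp_norm 1 w (\<lambda>j. A j i) < \<infinity>"
      using le_less_trans[OF le] by simp
    then have s: "l1_summable w (\<lambda>j. A j i)"
      using lp_norm_1[where w = w, OF pos, of "\<lambda>j. A j i"] by (auto split: if_splits)
    have "l1_norm w (\<lambda>j. A j i) \<le> max B 0 * w i"
      using le lp_norm_1[where w = w, OF pos, of "\<lambda>j. A j i"] s pos[of i] by (simp add: ennreal_le_iff less_imp_le)
    moreover have "cmod (A j i) = cmod (A i j)" for j by (simp add: herm[of i j])
    ultimately show ?thesis using s by (simp add: l1_summable_def l1_norm_def)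
  qed
  then show ?thesis using pos herm unfolding schur_def by blast
qed

section \<open>Bounded operators on a Hilbert space\<close>

instance complex_hilbert \<subseteq> banach ..

lemma bounded_linear_cinner_left: "bounded_linear (\<lambda>x. cinner (x :: 'a::complex_inner) y)"
  by (rule bounded_linear_intro[where K = "norm y"])
    (auto simp: cinner_add_left cinner_scaleC_left scaleR_scaleC norm_cinner_le scaleR_conv_of_real)

lemma bounded_linear_scaleC: "bounded_linear (\<lambda>x. c *\<^sub>C (x :: 'a::complex_inner))"
  by (rule bounded_linear_intro[where K = "cmod c"])
    (auto simp: scaleC_add_right scaleR_scaleC scaleC_scaleC norm_scaleC mult.commute)

lemma scaleC_diff_right: "c *\<^sub>C (x - y) = c *\<^sub>C x - c *\<^sub>C (y :: 'a::complex_vector)"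
  using scaleC_add_right[of c x "- y"] by (simp add: scaleC_minus_right)

lemma cinner_diff_right: "cinner x (y - z) = cinner x y - cinner x (z :: 'a::complex_inner)"
  using cinner_add_right[of x y "- z"] by (simp add: cinner_minus_right)

text \<open>Bounded operators are plain functions with this predicate, so that they can be multiplied by complex
scalars and inverted with \<open>inv\<close>.\<close>

definition bclinear :: "('a::complex_inner \<Rightarrow> 'b::complex_inner) \<Rightarrow> bool" where
  "bclinear U \<longleftrightarrow> (\<forall>x y. U (x + y) = U x + U y) \<and> (\<forall>c x. U (c *\<^sub>C x) = c *\<^sub>C U x) \<and>
    (\<exists>K. \<forall>x. norm (U x) \<le> K * norm x)"

lemma bclinearI:
  assumes "\<And>x y. U (x + y) = U x + U y" and "\<And>c x. U (c *\<^sub>C x) = c *\<^sub>C U x"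
    and "\<And>x. norm (U x) \<le> K * norm x"
  shows "bclinear U"
  using assms unfolding bclinear_def by blast

lemma bclinear_add: "bclinear U \<Longrightarrow> U (x + y) = U x + U y"
  unfolding bclinear_def by blast

lemma bclinear_scaleC: "bclinear U \<Longrightarrow> U (c *\<^sub>C x) = c *\<^sub>C U x"
  unfolding bclinear_def by blast

lemma bclinear_minus: "bclinear U \<Longrightarrow> U (- x) = - U x"
  using bclinear_scaleC[of U "-1" x] by (simp add: scaleC_minus_one)

lemma bclinear_diff: "bclinear U \<Longrightarrow> U (x - y) = U x - U y"
  using bclinear_add[of U x "- y"] by (simp add: bclinear_minus)

lemma bclinear_bounded: "bclinear U \<Longrightarrow> \<exists>K\<ge>0. \<forall>x. norm (U x) \<le> K * norm x"
proof -
  assume "bclinear U"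
  then obtain K where K: "\<And>x. norm (U x) \<le> K * norm x" unfolding bclinear_def by blast
  have "norm (U x) \<le> max K 0 * norm x" for x
    using K[of x] mult_right_mono[of K "max K 0" "norm x"] by simp
  then show ?thesis by (intro exI[of _ "max K 0"]) simp
qed

lemma bclinear_imp_bounded_linear: "bclinear U \<Longrightarrow> bounded_linear U"
proof -
  assume U: "bclinear U"
  obtain K where "\<forall>x. norm (U x) \<le> K * norm x" using bclinear_bounded[OF U] by blast
  then show ?thesis
    by (intro bounded_linear_intro[where K = K])
      (auto simp: bclinear_add[OF U] bclinear_scaleC[OF U] scaleR_scaleC mult.commute)
qed

lemma bclinear_ident: "bclinear (\<lambda>x. x)"
  by (rule bclinearI[where K = 1]) auto

lemma bclinear_zero: "bclinear (\<lambda>x. 0)"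
  by (rule bclinearI[where K = 0]) auto

lemma bclinear_compose:
  assumes U: "bclinear U" and V: "bclinear V"
  shows "bclinear (\<lambda>x. U (V x))"
proof -
  obtain K where K: "K \<ge> 0" "\<And>x. norm (U x) \<le> K * norm x" using bclinear_bounded[OF U] by blast
  obtain L where L: "\<And>x. norm (V x) \<le> L * norm x" using bclinear_bounded[OF V] by blast
  have "norm (U (V x)) \<le> (K * L) * norm x" for x
    using order_trans[OF K(2)[of "V x"] mult_left_mono[OF L[of x] K(1)]] by (simp add: mult.assoc)
  then show ?thesis
    by (intro bclinearI)
      (auto simp: bclinear_add[OF U] bclinear_add[OF V]
        bclinear_scaleC[OF U] bclinear_scaleC[OF V])
qed

lemma bclinear_plus:
  assumes U: "bclinear U" and V: "bclinear V"
  shows "bclinear (\<lambda>x. U x + V x)"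
proof -
  obtain K where K: "\<And>x. norm (U x) \<le> K * norm x" using bclinear_bounded[OF U] by blast
  obtain L where L: "\<And>x. norm (V x) \<le> L * norm x" using bclinear_bounded[OF V] by blast
  have "norm (U x + V x) \<le> (K + L) * norm x" for x
    using norm_triangle_ineq[of "U x" "V x"] K[of x] L[of x] by (simp add: algebra_simps)
  then show ?thesis
    by (intro bclinearI)
      (auto simp: bclinear_add[OF U] bclinear_add[OF V]
        bclinear_scaleC[OF U] bclinear_scaleC[OF V] scaleC_add_right)
qed

lemma bclinear_scale:
  assumes U: "bclinear U"
  shows "bclinear (\<lambda>x. c *\<^sub>C U x)"
proof -
  obtain K where K: "\<And>x. norm (U x) \<le> K * norm x" using bclinear_bounded[OF U] by blast
  have "norm (c *\<^sub>C U x) \<le> (cmod c * K) * norm x" for x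
    using mult_left_mono[OF K[of x], of "cmod c"] by (simp add: norm_scaleC mult.assoc)
  then show ?thesis
    by (intro bclinearI[where K = "cmod c * K"])
      (auto simp: bclinear_add[OF U] bclinear_scaleC[OF U] scaleC_add_right
        scaleC_scaleC mult.commute)
qed

lemma norm_diff_square:
  "(norm (x - y))\<^sup>2 = (norm x)\<^sup>2 - 2 * Re (cinner y x) + (norm (y :: 'a::complex_inner))\<^sup>2"
proof -
  have "complex_of_real ((norm (x - y))\<^sup>2) = cinner x x - cinner x y - cinner y x + cinner y y"
    by (subst cinner_norm[symmetric])
      (simp add: cinner_diff_left cinner_diff_right)
  also have "cinner x y = cnj (cinner y x)" by (rule cinner_commute)
  finally have "Re (complex_of_real ((norm (x - y))\<^sup>2)) =
      Re (cinner x x) - Re (cinner y x) - Re (cinner y x) + Re (cinner y y)" by simp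
  then show ?thesis by (simp add: cinner_norm)
qed

text \<open>The Lax-Milgram argument: for a small step \<open>\<tau>\<close> the map
\<open>x \<mapsto> x - \<tau> \<kappa> (T x - y)\<close> is a contraction, and its fixed point solves \<open>T x = y\<close>. The unimodular
factor \<open>\<kappa>\<close> rotates the numerical range of \<open>T\<close> into a right half plane.\<close>

lemma coercive_inverse:
  fixes T :: "'a::complex_hilbert \<Rightarrow> 'a"
  assumes T: "bclinear T" and \<alpha>: "\<alpha> > 0" and \<kappa>: "cmod \<kappa> = 1"
    and coercive: "\<And>x. \<alpha> * (norm x)\<^sup>2 \<le> Re (\<kappa> * cinner (T x) x)"
  shows "bij T" and "bclinear (inv T)" and "norm (inv T x) \<le> norm x / \<alpha>"
proof -
  obtain K where K: "K \<ge> 0" "\<And>x. norm (T x) \<le> K * norm x" using bclinear_bounded[OF T] by blast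
  \<comment> \<open>Enlarging the bound makes \<open>b\<close> positive and \<open>\<alpha> \<le> b\<close>, so that \<open>q\<close> is real.\<close>
  define b where "b = K + \<alpha>"
  have b: "b > 0" "\<alpha> \<le> b" and Tb: "norm (T x) \<le> b * norm x" for x
    using K \<alpha> order_trans[OF K(2)[of x] mult_right_mono[of K b "norm x"]] by (auto simp: b_def)
  have lower: "\<alpha> * norm x \<le> norm (T x)" for x
  proof (cases "x = 0")
    case True then show ?thesis by simp
  next
    case False
    have "\<alpha> * (norm x)\<^sup>2 \<le> cmod (\<kappa> * cinner (T x) x)"
      using coercive complex_Re_le_cmod order_trans by blast
    also have "\<dots> \<le> norm (T x) * norm x" by (simp add: norm_mult \<kappa> norm_cinner_le)
    finally have "(\<alpha> * norm x) * norm x \<le> norm (T x) * norm x" by (simp add: power2_eq_square)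
    then show ?thesis using False by simp
  qed
  have inj: "inj T"
  proof (rule injI)
    fix x y assume "T x = T y"
    then have "norm (T (x - y)) = 0" by (simp add: bclinear_diff[OF T])
    then have "\<alpha> * norm (x - y) \<le> 0" using lower[of "x - y"] by simp
    then show "x = y" using \<alpha> by (simp add: mult_le_0_iff)
  qed
  \<comment> \<open>The square of the Lipschitz constant is at most \<open>1 - 2 \<tau> \<alpha> + \<tau>\<^sup>2 b\<^sup>2\<close>;
    \<open>\<tau> = \<alpha> / b\<^sup>2\<close> minimises this expression, with the value \<open>q\<^sup>2\<close>.\<close>
  define \<tau> where "\<tau> = \<alpha> / b\<^sup>2"
  define q where "q = sqrt (1 - \<alpha>\<^sup>2 / b\<^sup>2)"
  have ab: "\<alpha>\<^sup>2 / b\<^sup>2 \<le> 1" using b \<alpha> by (simp add: power_mono)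
  have q: "0 \<le> q" "q < 1" using ab \<alpha> b by (simp_all add: q_def)
  have contraction: "norm (x - (\<tau> * \<kappa>) *\<^sub>C T x) \<le> q * norm x" for x
  proof -
    have re: "Re (complex_of_real \<tau> * z) = \<tau> * Re z" for z by simp
    have "(norm (x - (\<tau> * \<kappa>) *\<^sub>C T x))\<^sup>2 =
        (norm x)\<^sup>2 - 2 * \<tau> * Re (\<kappa> * cinner (T x) x) + \<tau>\<^sup>2 * (norm (T x))\<^sup>2"
      unfolding norm_diff_square norm_scaleC cinner_scaleC_left
      using re[of "\<kappa> * cinner (T x) x"]
      by (simp add: norm_mult \<kappa> power_mult_distrib mult.assoc del: Re_complex_of_real times_complex.sel)
    also have "\<dots> \<le> (norm x)\<^sup>2 - 2 * \<tau> * (\<alpha> * (norm x)\<^sup>2) + \<tau>\<^sup>2 * (b * norm x)\<^sup>2"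
      using coercive[of x] power_mono[OF Tb[of x], of 2] \<alpha> b
      by (intro add_mono diff_mono mult_left_mono order_refl) (auto simp: \<tau>_def)
    also have "\<dots> = (q * norm x)\<^sup>2"
      using ab b by (simp add: q_def \<tau>_def power_mult_distrib field_simps power2_eq_square)
    finally show ?thesis by (rule power2_le_imp_le) (simp add: q)
  qed
  have "\<exists>x. T x = y" for y
  proof -
    have lip: "dist (x - (\<tau> * \<kappa>) *\<^sub>C (T x - y)) (x' - (\<tau> * \<kappa>) *\<^sub>C (T x' - y)) \<le> q * dist x x'" for x x'
    proof -
      have eq: "x - (\<tau> * \<kappa>) *\<^sub>C (T x - y) - (x' - (\<tau> * \<kappa>) *\<^sub>C (T x' - y)) = (x - x') - (\<tau> * \<kappa>) *\<^sub>C T (x - x')"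
        by (simp add: bclinear_diff[OF T] scaleC_diff_right)
      show ?thesis unfolding dist_norm eq by (rule contraction)
    qed
    then have "\<exists>!x. x - (\<tau> * \<kappa>) *\<^sub>C (T x - y) = x" by (intro banach_fix_type[OF q]) blast
    then obtain x where "x - (\<tau> * \<kappa>) *\<^sub>C (T x - y) = x" by blast
    then have "(\<tau> * \<kappa>) *\<^sub>C (T x - y) = 0" by simp
    then have "cmod (\<tau> * \<kappa>) * norm (T x - y) = 0" by (metis norm_scaleC norm_zero)
    then show ?thesis using \<alpha> b \<kappa> by (auto simp: \<tau>_def norm_mult)
  qed
  then have "surj T" by (metis surjI surj_def)
  with inj show bij: "bij T" by (simp add: bij_def)
  have Tinv: "T (inv T x) = x" for x using bij by (simp add: bij_is_surj surj_f_inv_f)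
  have inv_eq: "inv T y = x" if "T x = y" for x y using that inj by (simp add: inv_f_eq)
  show bound: "norm (inv T x) \<le> norm x / \<alpha>" for x
    using lower[of "inv T x"] \<alpha> by (simp add: Tinv le_divide_eq mult.commute)
  show "bclinear (inv T)"
  proof (rule bclinearI[where K = "1 / \<alpha>"])
    show "inv T (x + y) = inv T x + inv T y" for x y
      by (rule inv_eq) (simp add: bclinear_add[OF T] Tinv)
    show "inv T (c *\<^sub>C x) = c *\<^sub>C inv T x" for c x
      by (rule inv_eq) (simp add: bclinear_scaleC[OF T] Tinv)
    show "norm (inv T x) \<le> 1 / \<alpha> * norm x" for x using bound[of x] by simp
  qed
qed

text \<open>A Cauchy criterion for unconditional convergence. The series \<open>\<Sum>\<^sub>i c\<^sub>i \<psi>\<^sub>i\<close> with square summable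
\<open>c\<close> need not converge absolutely; the criterion applies to it with \<open>g i = \<bar>c\<^sub>i\<bar>\<^sup>2\<close>.\<close>

lemma summable_on_by_square_bound:
  fixes f :: "'i \<Rightarrow> 'a::banach" and g :: "'i \<Rightarrow> real"
  assumes g: "g summable_on UNIV" "\<And>i. 0 \<le> g i" and K: "K \<ge> 0"
    and bound: "\<And>F. finite F \<Longrightarrow> (norm (sum f F))\<^sup>2 \<le> K * sum g F"
  shows "f summable_on UNIV"
proof -
  have cauchy: "\<exists>P. eventually P (finite_subsets_at_top UNIV) \<and>
      (\<forall>F F'. P F \<and> P F' \<longrightarrow> dist (sum f F) (sum f F') < e)" if "e > 0" for e
  proof -
    define \<epsilon> where "\<epsilon> = (e / 3)\<^sup>2 / (K + 1)"
    have \<epsilon>: "\<epsilon> > 0" "K * \<epsilon> \<le> (e / 3)\<^sup>2"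
      using that K by (auto simp: \<epsilon>_def field_simps)
    obtain F0 where F0: "finite F0" "dist (sum g F0) (infsum g UNIV) \<le> \<epsilon>"
      using infsum_finite_approximation[OF g(1) \<epsilon>(1)] by blast
    have tail: "norm (sum f (F - F0)) \<le> e / 3" if "finite F" for F
    proof -
      have "sum g F0 + sum g (F - F0) = sum g (F0 \<union> F)"
        using that F0(1) by (subst sum.union_disjoint[symmetric]) (auto simp: Un_Diff_cancel)
      also have "\<dots> \<le> infsum g UNIV"
        using that F0(1) g by (intro finite_sum_le_infsum) auto
      finally have "sum g (F - F0) \<le> \<epsilon>" using F0(2) by (simp add: dist_real_def)
      then have "(norm (sum f (F - F0)))\<^sup>2 \<le> K * \<epsilon>"
        using bound[of "F - F0"] that K by (meson finite_Diff mult_left_mono order_trans)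
      also have "\<dots> \<le> (e / 3)\<^sup>2" by (rule \<epsilon>(2))
      finally show ?thesis using \<open>e > 0\<close> by (elim power2_le_imp_le) simp
    qed
    have "dist (sum f F) (sum f F') < e"
      if "finite F \<and> F0 \<subseteq> F" "finite F' \<and> F0 \<subseteq> F'" for F F'
    proof -
      have split: "sum f F = sum f F0 + sum f (F - F0)" if "finite F \<and> F0 \<subseteq> F" for F
        using that by (metis add.commute sum.subset_diff)
      have "dist (sum f F) (sum f F') = norm (sum f (F - F0) - sum f (F' - F0))"
        using split[OF that(1)] split[OF that(2)] by (simp add: dist_norm)
      also have "\<dots> \<le> e / 3 + e / 3"
        using norm_triangle_ineq4[of "sum f (F - F0)" "sum f (F' - F0)"] tail[of F] tail[of F'] that by simp
      finally show ?thesis using \<open>e > 0\<close> by simp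
    qed
    then show ?thesis
      by (intro exI[of _ "\<lambda>F. finite F \<and> F0 \<subseteq> F"])
        (use F0(1) in \<open>auto simp: eventually_finite_subsets_at_top\<close>)
  qed
  then have "cauchy_filter (filtermap (sum f) (finite_subsets_at_top UNIV))"
    by (simp add: cauchy_filter_metric_filtermap)
  moreover have "complete (UNIV::'a set)"
    by (meson Cauchy_convergent UNIV_I complete_def convergent_def)
  ultimately obtain L' where "(sum f \<longlongrightarrow> L') (finite_subsets_at_top UNIV)"
    using complete_uniform[where S=UNIV] by (force simp add: filterlim_def)
  then show ?thesis using summable_on_def has_sum_def by blast
qed

section \<open>Operators in frame coordinates\<close>

definition l2_summable :: "('i \<Rightarrow> complex) \<Rightarrow> bool" where
  "l2_summable c \<longleftrightarrow> (\<lambda>i. (cmod (c i))\<^sup>2) summable_on UNIV"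

text \<open>A crude triangle inequality, sufficient because only the existence of bounds on \<open>\<ell>\<^sup>2\<close> matters.\<close>

lemma l2_norm_add_le: "(cmod (x + y))\<^sup>2 \<le> 2 * (cmod x)\<^sup>2 + 2 * (cmod y)\<^sup>2"
proof -
  have "(cmod (x + y))\<^sup>2 \<le> (cmod x + cmod y)\<^sup>2" by (rule power_mono[OF norm_triangle_ineq]) simp
  also have "\<dots> \<le> 2 * (cmod x)\<^sup>2 + 2 * (cmod y)\<^sup>2"
    using sum_squares_bound[of "cmod x" "cmod y"] by (simp add: power2_sum)
  finally show ?thesis .
qed

lemma l2_summable_mat_one: "l2_summable (mat_one i)"
  unfolding l2_summable_def
  by (rule finite_nonzero_values_imp_summable_on) (rule finite_subset[of _ "{i}"], auto simp: mat_one_def)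

lemma l2_summable_scale: "l2_summable c \<Longrightarrow> l2_summable (\<lambda>i. a * c i)"
  unfolding l2_summable_def norm_mult power_mult_distrib by (rule summable_on_cmult_right)

lemma l2_summable_add:
  assumes "l2_summable c" and "l2_summable d"
  shows "l2_summable (\<lambda>i. c i + d i)"
proof -
  have "(\<lambda>i. 2 * (cmod (c i))\<^sup>2 + 2 * (cmod (d i))\<^sup>2) summable_on UNIV"
    using assms unfolding l2_summable_def by (intro summable_on_add summable_on_cmult_right)
  then show ?thesis
    unfolding l2_summable_def by (rule summable_on_comparison_test) (auto intro: l2_norm_add_le)
qed

locale hilbert_frame =
  fixes \<Psi> :: "'i \<Rightarrow> 'a::complex_hilbert" and a b :: real
  assumes lower_pos: "0 < a" and upper_pos: "0 < b"
    and l2_summable_analysis: "l2_summable (analysis \<Psi> f)"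
    and lower_bound: "a * (norm f)\<^sup>2 \<le> (\<Sum>\<^sub>\<infinity>i. (cmod (analysis \<Psi> f i))\<^sup>2)"
    and upper_bound: "(\<Sum>\<^sub>\<infinity>i. (cmod (analysis \<Psi> f i))\<^sup>2) \<le> b * (norm f)\<^sup>2"
begin

lemma analysis_add: "analysis \<Psi> (f + g) = (\<lambda>i. analysis \<Psi> f i + analysis \<Psi> g i)"
  by (auto simp: analysis_def cinner_add_left)

lemma analysis_scaleC: "analysis \<Psi> (c *\<^sub>C f) = (\<lambda>i. c * analysis \<Psi> f i)"
  by (auto simp: analysis_def cinner_scaleC_left)

text \<open>The synthesis operator is the adjoint of the analysis operator and has the same norm: pair the sum with
itself and apply the Cauchy-Schwarz inequality.\<close>

lemma finite_synthesis_bound: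
  assumes "finite F"
  shows "(norm (\<Sum>i\<in>F. c i *\<^sub>C \<Psi> i))\<^sup>2 \<le> b * (\<Sum>i\<in>F. (cmod (c i))\<^sup>2)"
proof -
  define v where "v = (\<Sum>i\<in>F. c i *\<^sub>C \<Psi> i)"
  have "L2_set (\<lambda>i. cmod (cinner v (\<Psi> i))) F \<le> sqrt (b * (norm v)\<^sup>2)"
  proof -
    have "(\<Sum>i\<in>F. (cmod (cinner v (\<Psi> i)))\<^sup>2) \<le> (\<Sum>\<^sub>\<infinity>i. (cmod (analysis \<Psi> v i))\<^sup>2)"
      using l2_summable_analysis[of v] assms unfolding analysis_def l2_summable_def
      by (intro finite_sum_le_infsum) auto
    then show ?thesis unfolding L2_set_def using upper_bound[of v] by (intro real_sqrt_le_mono) simp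
  qed
  then have le: "L2_set (\<lambda>i. cmod (cinner v (\<Psi> i))) F \<le> sqrt b * norm v"
    by (simp add: real_sqrt_mult)
  have cmod_v: "cmod (cinner (\<Psi> i) v) = cmod (cinner v (\<Psi> i))" for i
    by (metis cinner_commute complex_mod_cnj)
  have "(norm v)\<^sup>2 = cmod (cinner v v)" by (simp add: cinner_norm norm_power)
  also have "cinner v v = (\<Sum>i\<in>F. c i * cinner (\<Psi> i) v)"
    by (subst (1) v_def) (simp add: cinner_sum_left cinner_scaleC_left)
  also have "cmod \<dots> \<le> (\<Sum>i\<in>F. \<bar>cmod (c i)\<bar> * \<bar>cmod (cinner v (\<Psi> i))\<bar>)"
    using norm_sum[of "\<lambda>i. c i * cinner (\<Psi> i) v" F] by (simp add: norm_mult cmod_v)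
  also have "\<dots> \<le> L2_set (\<lambda>i. cmod (c i)) F * L2_set (\<lambda>i. cmod (cinner v (\<Psi> i))) F"
    by (rule L2_set_mult_ineq)
  also have "\<dots> \<le> L2_set (\<lambda>i. cmod (c i)) F * (sqrt b * norm v)"
    by (rule mult_left_mono[OF le]) (rule L2_set_nonneg)
  finally have "norm v * norm v \<le> (sqrt b * L2_set (\<lambda>i. cmod (c i)) F) * norm v"
    by (simp add: power2_eq_square mult_ac)
  then have "norm v \<le> sqrt b * L2_set (\<lambda>i. cmod (c i)) F"
    using upper_pos by (cases "v = 0") (auto simp: L2_set_nonneg)
  then have "(norm v)\<^sup>2 \<le> (sqrt b * L2_set (\<lambda>i. cmod (c i)) F)\<^sup>2" by (rule power_mono) simp
  then show ?thesis
    using upper_pos by (simp add: v_def power_mult_distrib L2_set_def sum_nonneg)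
qed

lemma synthesis_summable:
  assumes "l2_summable c"
  shows "(\<lambda>i. c i *\<^sub>C \<Psi> i) summable_on UNIV"
  by (rule summable_on_by_square_bound[OF assms[unfolded l2_summable_def] _ _ finite_synthesis_bound])
    (use upper_pos in auto)

lemma synthesis_has_sum:
  "l2_summable c \<Longrightarrow> ((\<lambda>i. c i *\<^sub>C \<Psi> i) has_sum synthesis \<Psi> c) UNIV"
  unfolding synthesis_def by (rule has_sum_infsum[OF synthesis_summable])

lemma synthesis_bound:
  assumes "l2_summable c"
  shows "(norm (synthesis \<Psi> c))\<^sup>2 \<le> b * (\<Sum>\<^sub>\<infinity>i. (cmod (c i))\<^sup>2)"
proof -
  have "((\<lambda>F. (norm (\<Sum>i\<in>F. c i *\<^sub>C \<Psi> i))\<^sup>2) \<longlongrightarrow> (norm (synthesis \<Psi> c))\<^sup>2) (finite_subsets_at_top UNIV)"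
    using synthesis_has_sum[OF assms] unfolding has_sum_def by (intro tendsto_power tendsto_norm)
  moreover have "\<forall>\<^sub>F F in finite_subsets_at_top UNIV.
      (norm (\<Sum>i\<in>F. c i *\<^sub>C \<Psi> i))\<^sup>2 \<le> b * (\<Sum>\<^sub>\<infinity>i. (cmod (c i))\<^sup>2)"
  proof (rule eventually_finite_subsets_at_top_weakI)
    fix F :: "'i set" assume "finite F"
    then have "(\<Sum>i\<in>F. (cmod (c i))\<^sup>2) \<le> (\<Sum>\<^sub>\<infinity>i. (cmod (c i))\<^sup>2)"
      using assms unfolding l2_summable_def by (intro finite_sum_le_infsum) auto
    then show "(norm (\<Sum>i\<in>F. c i *\<^sub>C \<Psi> i))\<^sup>2 \<le> b * (\<Sum>\<^sub>\<infinity>i. (cmod (c i))\<^sup>2)"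
      using finite_synthesis_bound[OF \<open>finite F\<close>, of c] upper_pos
      by (meson less_imp_le mult_left_mono order_trans)
  qed
  ultimately show ?thesis by (rule tendsto_upperbound) simp
qed

lemma synthesis_add:
  "l2_summable c \<Longrightarrow> l2_summable d \<Longrightarrow>
    synthesis \<Psi> (\<lambda>i. c i + d i) = synthesis \<Psi> c + synthesis \<Psi> d"
  unfolding synthesis_def scaleC_add_left by (rule infsum_add[OF synthesis_summable synthesis_summable])

lemma synthesis_scale: "l2_summable c \<Longrightarrow> synthesis \<Psi> (\<lambda>i. k * c i) = k *\<^sub>C synthesis \<Psi> c"
  using infsumI[OF has_sum_bounded_linear[OF bounded_linear_scaleC synthesis_has_sum, of c k]]
  by (simp add: synthesis_def[of \<Psi> "\<lambda>i. k * c i"] scaleC_scaleC)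

abbreviation "S \<equiv> frame_op \<Psi>"

lemma frame_op_has_sum: "((\<lambda>i. cinner f (\<Psi> i) *\<^sub>C \<Psi> i) has_sum S f) UNIV"
  using synthesis_has_sum[OF l2_summable_analysis] by (simp add: frame_op_def analysis_def)

lemma bclinear_frame_op: "bclinear S"
proof (rule bclinearI[where K = b])
  show "S (x + y) = S x + S y" for x y
    unfolding frame_op_def analysis_add by (rule synthesis_add) (rule l2_summable_analysis)+
  show "S (c *\<^sub>C x) = c *\<^sub>C S x" for c x
    unfolding frame_op_def analysis_scaleC by (rule synthesis_scale) (rule l2_summable_analysis)
  show "norm (S x) \<le> b * norm x" for x
  proof (rule power2_le_imp_le)
    have "(norm (S x))\<^sup>2 \<le> b * (b * (norm x)\<^sup>2)"
      unfolding frame_op_def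
      using order_trans[OF synthesis_bound[OF l2_summable_analysis] mult_left_mono[OF upper_bound]] upper_pos
      by (simp add: less_imp_le)
    then show "(norm (S x))\<^sup>2 \<le> (b * norm x)\<^sup>2" by (simp add: power2_eq_square mult_ac)
  qed (use upper_pos in simp)
qed

lemma cinner_frame_op: "cinner (S x) x = complex_of_real (\<Sum>\<^sub>\<infinity>i. (cmod (analysis \<Psi> x i))\<^sup>2)"
proof -
  have "((\<lambda>i. cinner (cinner x (\<Psi> i) *\<^sub>C \<Psi> i) x) has_sum cinner (S x) x) UNIV"
    by (rule has_sum_bounded_linear[OF bounded_linear_cinner_left frame_op_has_sum])
  moreover have "cinner (cinner x (\<Psi> i) *\<^sub>C \<Psi> i) x = complex_of_real ((cmod (analysis \<Psi> x i))\<^sup>2)" for i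
    unfolding cinner_scaleC_left analysis_def cinner_commute[of "\<Psi> i" x] by (metis complex_norm_square)
  ultimately have "((\<lambda>i. complex_of_real ((cmod (analysis \<Psi> x i))\<^sup>2)) has_sum cinner (S x) x) UNIV" by simp
  moreover have "((\<lambda>i. complex_of_real ((cmod (analysis \<Psi> x i))\<^sup>2)) has_sum
      complex_of_real (\<Sum>\<^sub>\<infinity>i. (cmod (analysis \<Psi> x i))\<^sup>2)) UNIV"
    using l2_summable_analysis[of x] unfolding l2_summable_def by (intro has_sum_of_real has_sum_infsum)
  ultimately show ?thesis by (rule has_sum_unique)
qed

lemma frame_op_coercive: "a * (norm x)\<^sup>2 \<le> Re (cinner (S x) x)"
  using lower_bound by (simp add: cinner_frame_op)

lemma cinner_frame_op_left: "cinner (S x) y = cinner x (S y)"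
proof -
  have "((\<lambda>i. cinner (cinner x (\<Psi> i) *\<^sub>C \<Psi> i) y) has_sum cinner (S x) y) UNIV"
    by (rule has_sum_bounded_linear[OF bounded_linear_cinner_left frame_op_has_sum])
  moreover have "((\<lambda>i. cinner x (cinner y (\<Psi> i) *\<^sub>C \<Psi> i)) has_sum cinner x (S y)) UNIV"
    by (rule has_sum_bounded_linear[OF bounded_linear_cinner_right frame_op_has_sum])
  moreover have "cinner (cinner x (\<Psi> i) *\<^sub>C \<Psi> i) y = cinner x (cinner y (\<Psi> i) *\<^sub>C \<Psi> i)" for i
    by (simp add: cinner_scaleC_left cinner_scaleC_right cinner_commute[of "\<Psi> i" y])
  ultimately show ?thesis using has_sum_unique by auto
qed

abbreviation "W \<equiv> inv S"

text \<open>The lower frame bound says that the frame operator is coercive.\<close>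

lemma
  shows bij_frame_op: "bij S" and bclinear_inv_frame_op: "bclinear W"
    and norm_inv_frame_op: "norm (W x) \<le> norm x / a"
  using coercive_inverse[OF bclinear_frame_op lower_pos, of 1] frame_op_coercive by auto

lemma frame_op_inv [simp]: "S (W x) = x"
  using bij_frame_op by (simp add: bij_is_surj surj_f_inv_f)

lemma inv_frame_op [simp]: "W (S x) = x"
  using bij_frame_op by (simp add: bij_is_inj)

lemma dual_frame_eq: "dual_frame \<Psi> i = W (\<Psi> i)"
  by (simp add: dual_frame_def)

lemma cinner_inv_frame_op: "cinner (W x) y = cinner x (W y)"
  using cinner_frame_op_left[of "W x" "W y"] by simp

text \<open>Apply \<open>W\<close> to the series of \<open>S f\<close>.\<close>

lemma reconstruction_dual: "((\<lambda>i. cinner f (\<Psi> i) *\<^sub>C dual_frame \<Psi> i) has_sum f) UNIV"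
  using has_sum_bounded_linear[OF bclinear_imp_bounded_linear[OF bclinear_inv_frame_op]
      frame_op_has_sum[of f]]
  by (simp add: dual_frame_eq bclinear_scaleC[OF bclinear_inv_frame_op])

text \<open>With the analysis operator \<open>C\<close> and its adjoint, the synthesis operator, this is the matrix of
\<open>\<alpha> + C U C\<^sup>*\<close> on \<open>\<ell>\<^sup>2\<close>. Since \<open>C\<^sup>* C = S\<close>, such matrices are closed under products,
and all computations in the algebra can be made with operators on the Hilbert space.\<close>

definition op_matrix :: "complex \<Rightarrow> ('a \<Rightarrow> 'a) \<Rightarrow> 'i matrix" where
  "op_matrix \<alpha> U i j = \<alpha> * mat_one j i + cinner (U (\<Psi> j)) (\<Psi> i)"

lemma op_matrix_row_has_sum:
  assumes U: "bclinear U" and c: "l2_summable c"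
  shows "((\<lambda>j. op_matrix \<alpha> U i j * c j) has_sum \<alpha> * c i + cinner (U (synthesis \<Psi> c)) (\<Psi> i)) UNIV"
proof -
  have "((\<lambda>j. cinner (U (c j *\<^sub>C \<Psi> j)) (\<Psi> i)) has_sum cinner (U (synthesis \<Psi> c)) (\<Psi> i)) UNIV"
    by (rule has_sum_bounded_linear[OF bounded_linear_compose[OF bounded_linear_cinner_left
          bclinear_imp_bounded_linear[OF U]] synthesis_has_sum[OF c]])
  then have 1: "((\<lambda>j. cinner (U (\<Psi> j)) (\<Psi> i) * c j) has_sum cinner (U (synthesis \<Psi> c)) (\<Psi> i)) UNIV"
    by (simp add: bclinear_scaleC[OF U] cinner_scaleC_left mult.commute)
  have 2: "((\<lambda>j. \<alpha> * mat_one j i * c j) has_sum \<alpha> * c i) UNIV"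
    by (rule has_sum_finite_neutralI[of "{i}"]) (auto simp: mat_one_def)
  show ?thesis using has_sum_add[OF 2 1] by (simp add: op_matrix_def distrib_right)
qed

lemma mat_vec_op_matrix:
  assumes "bclinear U" and "l2_summable c"
  shows "mat_vec (op_matrix \<alpha> U) c = (\<lambda>i. \<alpha> * c i + analysis \<Psi> (U (synthesis \<Psi> c)) i)"
  unfolding mat_vec_def analysis_def using infsumI[OF op_matrix_row_has_sum[OF assms]] by blast

lemma l2_summable_mat_vec_op_matrix:
  assumes "bclinear U" and "l2_summable c"
  shows "l2_summable (mat_vec (op_matrix \<alpha> U) c)"
  unfolding mat_vec_op_matrix[OF assms]
  by (intro l2_summable_add l2_summable_scale assms l2_summable_analysis)

text \<open>\<open>(\<alpha> + C U C\<^sup>*) (\<beta> + C V C\<^sup>*) = \<alpha> \<beta> + C (\<alpha> V + \<beta> U + U S V) C\<^sup>*\<close>.\<close>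

lemma mat_vec_op_matrix_compose:
  assumes U: "bclinear U" and V: "bclinear V" and c: "l2_summable c"
  shows "mat_vec (op_matrix \<alpha> U) (mat_vec (op_matrix \<beta> V) c) =
    mat_vec (op_matrix (\<alpha> * \<beta>) (\<lambda>x. \<alpha> *\<^sub>C V x + \<beta> *\<^sub>C U x + U (S (V x)))) c"
proof -
  let ?f = "synthesis \<Psi> c"
  have B: "bclinear (\<lambda>x. \<alpha> *\<^sub>C V x + \<beta> *\<^sub>C U x + U (S (V x)))"
    by (intro bclinear_plus bclinear_scale bclinear_compose[OF U]
        bclinear_compose[OF bclinear_frame_op] U V)
  have "synthesis \<Psi> (mat_vec (op_matrix \<beta> V) c) = \<beta> *\<^sub>C ?f + S (V ?f)"
    unfolding mat_vec_op_matrix[OF V c]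
    by (simp add: synthesis_add synthesis_scale l2_summable_scale c l2_summable_analysis frame_op_def)
  then show ?thesis
    unfolding mat_vec_op_matrix[OF U l2_summable_mat_vec_op_matrix[OF V c]] mat_vec_op_matrix[OF B c]
    by (simp add: mat_vec_op_matrix[OF V c] analysis_add analysis_scaleC bclinear_add[OF U] bclinear_scaleC[OF U]
        algebra_simps)
qed

lemma mat_mult_op_matrix:
  assumes U: "bclinear U" and V: "bclinear V"
  shows "mat_mult (op_matrix \<alpha> U) (op_matrix \<beta> V) =
    op_matrix (\<alpha> * \<beta>) (\<lambda>x. \<alpha> *\<^sub>C V x + \<beta> *\<^sub>C U x + U (S (V x)))" (is "_ = ?M")
proof (intro ext)
  fix i k
  have "mat_mult (op_matrix \<alpha> U) (op_matrix \<beta> V) i k =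
      mat_vec (op_matrix \<alpha> U) (mat_vec (op_matrix \<beta> V) (mat_one k)) i"
    by (simp add: mat_mult_def mat_vec_def[of "op_matrix \<alpha> U"] mat_vec_mat_one)
  also have "\<dots> = ?M i k"
    by (simp add: mat_vec_op_matrix_compose[OF U V l2_summable_mat_one] mat_vec_mat_one)
  finally show "mat_mult (op_matrix \<alpha> U) (op_matrix \<beta> V) i k = ?M i k" .
qed

lemma lp_space_2: "c \<in> lp_space 2 (\<lambda>_. 1) \<longleftrightarrow> l2_summable c"
  unfolding lp_space_def l2_summable_def lp_norm_2 by simp

lemma lp_bounded_op_matrix:
  assumes U: "bclinear U"
  shows "lp_bounded 2 (\<lambda>_. 1) (op_matrix \<alpha> U)"
proof -
  obtain K where K: "K \<ge> 0" "\<And>x. norm (U x) \<le> K * norm x" using bclinear_bounded[OF U] by blast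
  \<comment> \<open>\<open>\<parallel>\<alpha> c + C U C\<^sup>* c\<parallel>\<^sup>2\<close> is at most twice the sum of the squares of the norms of the two
    terms, and \<open>C\<close> and \<open>C\<^sup>*\<close> have norm at most \<open>\<surd>b\<close>.\<close>
  define M where "M = 2 * (cmod \<alpha>)\<^sup>2 + 2 * b * K\<^sup>2 * b"
  have M: "M \<ge> 0" using upper_pos by (simp add: M_def)
  have "(\<forall>i. (\<lambda>j. op_matrix \<alpha> U i j * c j) summable_on UNIV) \<and>
      lp_norm 2 (\<lambda>_. 1) (mat_vec (op_matrix \<alpha> U) c) \<le> ennreal (sqrt M) * lp_norm 2 (\<lambda>_. 1) c"
    if "c \<in> lp_space 2 (\<lambda>_. 1)" for c
  proof
    have c: "l2_summable c" using that by (simp add: lp_space_2)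
    show "\<forall>i. (\<lambda>j. op_matrix \<alpha> U i j * c j) summable_on UNIV"
      using op_matrix_row_has_sum[OF U c] has_sum_imp_summable by blast
    let ?f = "U (synthesis \<Psi> c)" and ?s = "\<Sum>\<^sub>\<infinity>i. (cmod (c i))\<^sup>2"
    have mv: "l2_summable (mat_vec (op_matrix \<alpha> U) c)" by (rule l2_summable_mat_vec_op_matrix[OF U c])
    have sc: "(\<lambda>i. 2 * (cmod (\<alpha> * c i))\<^sup>2) summable_on UNIV"
      using l2_summable_scale[OF c, of \<alpha>] unfolding l2_summable_def by (rule summable_on_cmult_right)
    have sf: "(\<lambda>i. 2 * (cmod (analysis \<Psi> ?f i))\<^sup>2) summable_on UNIV"
      using l2_summable_analysis[of ?f] unfolding l2_summable_def by (rule summable_on_cmult_right)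
    have "(\<Sum>\<^sub>\<infinity>i. (cmod (mat_vec (op_matrix \<alpha> U) c i))\<^sup>2) \<le>
        (\<Sum>\<^sub>\<infinity>i. 2 * (cmod (\<alpha> * c i))\<^sup>2 + 2 * (cmod (analysis \<Psi> ?f i))\<^sup>2)"
    proof (rule infsum_mono)
      show "(\<lambda>i. (cmod (mat_vec (op_matrix \<alpha> U) c i))\<^sup>2) summable_on UNIV"
        using mv unfolding l2_summable_def .
      show "(\<lambda>i. 2 * (cmod (\<alpha> * c i))\<^sup>2 + 2 * (cmod (analysis \<Psi> ?f i))\<^sup>2) summable_on UNIV"
        by (rule summable_on_add[OF sc sf])
      show "(cmod (mat_vec (op_matrix \<alpha> U) c i))\<^sup>2 \<le>
          2 * (cmod (\<alpha> * c i))\<^sup>2 + 2 * (cmod (analysis \<Psi> ?f i))\<^sup>2" for i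
        unfolding mat_vec_op_matrix[OF U c] by (rule l2_norm_add_le)
    qed
    also have "\<dots> = 2 * (cmod \<alpha>)\<^sup>2 * ?s + 2 * (\<Sum>\<^sub>\<infinity>i. (cmod (analysis \<Psi> ?f i))\<^sup>2)"
      unfolding infsum_add[OF sc sf] by (simp add: infsum_cmult_right' norm_mult power_mult_distrib)
    also have "\<dots> \<le> 2 * (cmod \<alpha>)\<^sup>2 * ?s + 2 * (b * (K\<^sup>2 * (b * ?s)))"
    proof -
      have "(norm ?f)\<^sup>2 \<le> (K * norm (synthesis \<Psi> c))\<^sup>2" by (rule power_mono[OF K(2)]) simp
      also have "\<dots> \<le> K\<^sup>2 * (b * ?s)"
        unfolding power_mult_distrib by (rule mult_left_mono[OF synthesis_bound[OF c]]) simp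
      finally have "b * (norm ?f)\<^sup>2 \<le> b * (K\<^sup>2 * (b * ?s))" using upper_pos by simp
      then show ?thesis using upper_bound[of ?f] by simp
    qed
    also have "\<dots> = M * ?s" by (simp add: M_def algebra_simps)
    finally have "sqrt (\<Sum>\<^sub>\<infinity>i. (cmod (mat_vec (op_matrix \<alpha> U) c i))\<^sup>2) \<le> sqrt M * sqrt ?s"
      by (simp add: real_sqrt_mult[symmetric])
    then show "lp_norm 2 (\<lambda>_. 1) (mat_vec (op_matrix \<alpha> U) c) \<le> ennreal (sqrt M) * lp_norm 2 (\<lambda>_. 1) c"
      using mv c M unfolding lp_norm_2 l2_summable_def
      by (simp add: ennreal_mult[symmetric] infsum_nonneg ennreal_le_iff)
  qed
  then show ?thesis unfolding lp_bounded_def by blast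
qed

lemma gram_eq_op_matrix: "gram \<Psi> = op_matrix 0 (\<lambda>x. x)"
  by (intro ext) (simp add: gram_def op_matrix_def)

lemma mat_one_eq_op_matrix: "mat_one = op_matrix 1 (\<lambda>x. 0)"
  by (intro ext) (simp add: op_matrix_def mat_one_def)

lemma op_matrix_scale: "(\<lambda>i j. c * op_matrix \<alpha> U i j) = op_matrix (c * \<alpha>) (\<lambda>x. c *\<^sub>C U x)"
  by (intro ext) (simp add: op_matrix_def cinner_scaleC_left algebra_simps)

end

section \<open>Spectral matrix algebras contain the projection and the dual Gram matrix\<close>

context spectral_matrix_algebra
begin

lemma zero_mem: "(\<lambda>i j. 0) \<in> \<A>"
  using scale_mem[OF one_mem, of 0] by simp

lemma norm_nonneg: "A \<in> \<A> \<Longrightarrow> 0 \<le> N A"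
proof -
  assume A: "A \<in> \<A>"
  have z: "N (\<lambda>i j. 0) = 0" using norm_eq_0[OF zero_mem] by simp
  have "N (\<lambda>i j. A i j + (- 1) * A i j) \<le> N A + N (\<lambda>i j. (- 1) * A i j)"
    by (rule norm_add[OF A scale_mem[OF A]])
  then show ?thesis using norm_scale[OF A, of "-1"] z by simp
qed

lemma diff_mem: "A \<in> \<A> \<Longrightarrow> B \<in> \<A> \<Longrightarrow> (\<lambda>i j. A i j - B i j) \<in> \<A>"
  using add_mem[OF _ scale_mem[of B "-1"], of A] by simp

lemma sum_mem:
  assumes "finite F" and "\<And>k. k \<in> F \<Longrightarrow> X k \<in> \<A>"
  shows "(\<lambda>i j. \<Sum>k\<in>F. X k i j) \<in> \<A> \<and> N (\<lambda>i j. \<Sum>k\<in>F. X k i j) \<le> (\<Sum>k\<in>F. N (X k))"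
  using assms
proof (induction F rule: finite_induct)
  case empty
  then show ?case using zero_mem norm_eq_0[OF zero_mem] by simp
next
  case (insert x F)
  then show ?case
    using add_mem[of "X x" "\<lambda>i j. \<Sum>k\<in>F. X k i j"] norm_add[of "X x" "\<lambda>i j. \<Sum>k\<in>F. X k i j"] by simp
qed

text \<open>Solidity makes the matrix entries continuous: if \<open>E\<close> is the matrix unit at the position
\<open>(i, j)\<close>, then \<open>A\<^sub>i\<^sub>j E\<close> is dominated entrywise by \<open>A\<close>. Some matrix of the algebra must have a
nonzero entry there for \<open>E\<close> to be a member; otherwise the claim is trivial.\<close>

lemma entry_bound: "\<exists>C\<ge>0. \<forall>A\<in>\<A>. cmod (A i j) \<le> C * N A"
proof (cases "\<exists>A\<in>\<A>. A i j \<noteq> 0")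
  case False
  then show ?thesis by (intro exI[of _ 0]) auto
next
  case True
  then obtain A0 where A0: "A0 \<in> \<A>" "A0 i j \<noteq> 0" by blast
  define E where "E z k l = (if k = i \<and> l = j then z else 0)" for z :: complex and k l
  have E_solid: "E (A i j) \<in> \<A> \<and> N (E (A i j)) \<le> N A" if "A \<in> \<A>" for A
    by (rule solid[OF that]) (simp add: E_def)
  have E_scale: "E (c * z) = (\<lambda>k l. c * E z k l)" for c z
    by (intro ext) (simp add: E_def)
  have E1: "E 1 \<in> \<A>"
    using scale_mem[of "E (A0 i j)" "1 / A0 i j"] E_solid[OF A0(1)] A0(2) E_scale[of "1 / A0 i j" "A0 i j"]
    by simp
  have "E 1 i j \<noteq> (\<lambda>i j. 0) i j" by (simp add: E_def)
  then have "E 1 \<noteq> (\<lambda>i j. 0)" by metis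
  then have pos: "N (E 1) > 0" using norm_eq_0[OF E1] norm_nonneg[OF E1] by simp
  have "cmod (A i j) \<le> (1 / N (E 1)) * N A" if A: "A \<in> \<A>" for A
  proof -
    have "cmod (A i j) * N (E 1) = N (E (A i j))"
      using norm_scale[OF E1, of "A i j"] E_scale[of "A i j" 1] by simp
    also have "\<dots> \<le> N A" using E_solid[OF A] by blast
    finally show ?thesis using pos by (simp add: le_divide_eq)
  qed
  then show ?thesis using pos by (intro exI[of _ "1 / N (E 1)"]) auto
qed

text \<open>Geometrically decreasing steps make the sequence Cauchy in the norm of the algebra; the limit is
identified by its entries.\<close>

lemma complete_geometric:
  assumes X: "\<And>n. X n \<in> \<A>" and step: "\<And>n. N (\<lambda>i j. X (Suc n) i j - X n i j) \<le> C / 2 ^ n"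
  shows "\<exists>L\<in>\<A>. \<forall>i j. (\<lambda>n. X n i j) \<longlonglongrightarrow> L i j"
proof -
  have C: "0 \<le> C" using order_trans[OF norm_nonneg step[of 0]] diff_mem X by simp
  have tri: "N (\<lambda>i j. A i j - B i j) \<le> N (\<lambda>i j. A i j - D i j) + N (\<lambda>i j. D i j - B i j)"
    if "A \<in> \<A>" "B \<in> \<A>" "D \<in> \<A>" for A B D
    using norm_add[OF diff_mem[OF that(1,3)] diff_mem[OF that(3,2)]] by simp
  have sym: "N (\<lambda>i j. A i j - B i j) = N (\<lambda>i j. B i j - A i j)" if "A \<in> \<A>" "B \<in> \<A>" for A B
    using norm_scale[OF diff_mem[OF that], of "-1"] by simp
  have fwd: "N (\<lambda>i j. X (n + k) i j - X n i j) \<le> 2 * C / 2 ^ n - 2 * C / 2 ^ (n + k)" for n k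
  proof (induction k)
    case 0
    have "(\<lambda>i j. X n i j - X n i j) = (\<lambda>i j. 0)" by simp
    then show ?case using norm_eq_0[OF zero_mem] by simp
  next
    case (Suc k)
    have "N (\<lambda>i j. X (n + Suc k) i j - X n i j) \<le> C / 2 ^ (n + k) + (2 * C / 2 ^ n - 2 * C / 2 ^ (n + k))"
      using tri[OF X[of "n + Suc k"] X[of n] X[of "n + k"]] step[of "n + k"] Suc by simp
    then show ?case by (simp add: field_simps)
  qed
  have near: "N (\<lambda>i j. X m i j - X n i j) \<le> 2 * C / 2 ^ M" if "m \<ge> M" "n \<ge> M" for m n M
  proof -
    have *: "N (\<lambda>i j. X m i j - X n i j) \<le> 2 * C / 2 ^ M" if "M \<le> n" "n \<le> m" for m n
    proof -
      have "N (\<lambda>i j. X m i j - X n i j) \<le> 2 * C / 2 ^ n - 2 * C / 2 ^ m"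
        using fwd[of n "m - n"] that by simp
      also have "\<dots> \<le> 2 * C / 2 ^ n" using C by simp
      also have "\<dots> \<le> 2 * C / 2 ^ M" using C that by (intro divide_left_mono) auto
      finally show ?thesis .
    qed
    show ?thesis using *[of n m] *[of m n] that sym[OF X[of m] X[of n]] by (cases "n \<le> m") auto
  qed
  have "\<exists>M. \<forall>m\<ge>M. \<forall>n\<ge>M. N (\<lambda>i j. X m i j - X n i j) < e" if "e > 0" for e
  proof -
    have "(\<lambda>M. (2 * C) * (1 / 2) ^ M) \<longlonglongrightarrow> (2 * C) * 0"
      by (intro tendsto_mult tendsto_const LIMSEQ_power_zero) simp
    then have "\<forall>\<^sub>F M in sequentially. (2 * C) * (1 / 2) ^ M < e"
      using that by (intro order_tendstoD(2)) auto
    then obtain M where "(2 * C) * (1 / 2) ^ M < e" by (auto simp: eventually_sequentially)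
    then have "2 * C / 2 ^ M < e" by (simp add: power_one_over)
    then show ?thesis using near by (meson le_less_trans)
  qed
  then obtain L where L: "L \<in> \<A>" "(\<lambda>n. N (\<lambda>i j. X n i j - L i j)) \<longlonglongrightarrow> 0"
    using complete[of X] X by blast
  have "(\<lambda>n. X n i j) \<longlonglongrightarrow> L i j" for i j
  proof -
    obtain K where K: "\<forall>A\<in>\<A>. cmod (A i j) \<le> K * N A" using entry_bound by blast
    have le: "norm (X n i j - L i j) \<le> K * N (\<lambda>i j. X n i j - L i j)" for n
      using K diff_mem[OF X[of n] L(1)] by fastforce
    have "(\<lambda>n. X n i j - L i j) \<longlonglongrightarrow> 0"
      by (rule Lim_null_comparison[OF always_eventually[OF allI[OF le]] tendsto_mult_right_zero[OF L(2)]])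
    then show ?thesis by (simp add: LIM_zero_iff)
  qed
  then show ?thesis using L(1) by blast
qed

end

lemma sum_root_of_unity_powers:
  fixes z :: complex
  assumes "z ^ m = 1" and "z \<noteq> 1"
  shows "(\<Sum>k<m. z ^ k) = 0"
  using assms by (simp add: geometric_sum)

lemma cis_power_neq_1:
  assumes "0 < l" and "l < m"
  shows "cis (2 * pi / real m) ^ l \<noteq> 1"
proof
  assume "cis (2 * pi / real m) ^ l = 1"
  then have "exp (2 * of_real pi * \<i> * of_nat l / of_nat m) = 1"
    unfolding Complex.DeMoivre unfolding cis_conv_exp by (simp add: mult_ac)
  then have "m dvd l" using assms complex_root_unity_eq_1[of m l] by simp
  then show False using assms by (auto dest: dvd_imp_le)
qed

locale localised_hilbert_frame = hilbert_frame \<Psi> a b + spectral_matrix_algebra \<A> N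
  for \<Psi> :: "'i \<Rightarrow> 'a::complex_hilbert" and a b and \<A> :: "'i matrix set" and N +
  assumes gram_mem: "gram \<Psi> \<in> \<A>"
begin

text \<open>Inverse-closedness in frame coordinates: the two identities say that \<open>1 + C V C\<^sup>*\<close> is the inverse of
\<open>1 + C U C\<^sup>*\<close>.\<close>

lemma op_matrix_inverse_mem:
  assumes U: "bclinear U" and V: "bclinear V" and mem: "op_matrix 1 U \<in> \<A>"
    and UV: "\<And>x. U x + V x + U (S (V x)) = 0" and VU: "\<And>x. U x + V x + V (S (U x)) = 0"
  shows "op_matrix 1 V \<in> \<A>"
proof (rule inverse_closed[OF mem lp_bounded_op_matrix[OF V]], rule ballI, rule conjI)
  fix c assume "c \<in> lp_space 2 (\<lambda>_::'i. 1)"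
  then have c: "l2_summable c" by (simp add: lp_space_2)
  have one: "mat_vec (op_matrix 1 (\<lambda>x. 0)) c = c"
    by (simp add: mat_vec_op_matrix[OF bclinear_zero c] analysis_def)
  show "mat_vec (op_matrix 1 V) (mat_vec (op_matrix 1 U) c) = c"
    using one VU by (simp add: mat_vec_op_matrix_compose[OF V U c])
  show "mat_vec (op_matrix 1 U) (mat_vec (op_matrix 1 V) c) = c"
    using one UV by (simp add: mat_vec_op_matrix_compose[OF U V c] add.commute)
qed

text \<open>Resolvents, in the variable \<open>s\<close> for which \<open>(1 - s G)\<^sup>-\<^sup>1 = 1 + C (res s) C\<^sup>*\<close>.\<close>

definition shifted :: "complex \<Rightarrow> 'a \<Rightarrow> 'a" where
  "shifted s x = x - s *\<^sub>C S x"

definition res :: "complex \<Rightarrow> 'a \<Rightarrow> 'a" where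
  "res s x = s *\<^sub>C inv (shifted s) x"

lemma bclinear_shifted: "bclinear (shifted s)"
proof -
  have "shifted s = (\<lambda>x. x + (- s) *\<^sub>C S x)" by (auto simp: shifted_def scaleC_minus_left)
  then show ?thesis
    using bclinear_plus[OF bclinear_ident bclinear_scale[OF bclinear_frame_op]]
    by simp
qed

context
  fixes s :: complex
  assumes s: "cmod s = 2 / a"
begin

text \<open>The circle \<open>\<bar>s\<bar> = 2/a\<close> stays away from the inverses of the spectrum of \<open>S\<close>, which are at most
\<open>1/a\<close>: after a rotation the term \<open>s S\<close>, of size at least \<open>2\<close>, outweighs the identity.\<close>

lemma
  shows bij_shifted: "bij (shifted s)" and bclinear_inv_shifted: "bclinear (inv (shifted s))"
    and norm_inv_shifted: "norm (inv (shifted s) x) \<le> norm x"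
proof -
  have s0: "cmod s > 0" "s \<noteq> 0" using s lower_pos by auto
  define \<kappa> where "\<kappa> = - cnj s / cmod s"
  have \<kappa>: "cmod \<kappa> = 1" using s0 by (simp add: \<kappa>_def norm_divide)
  have \<kappa>s: "\<kappa> * s = - complex_of_real (cmod s)"
    using s0 by (simp add: \<kappa>_def complex_norm_square[symmetric] mult.commute[of "cnj s"] power2_eq_square)
  have coercive: "1 * (norm x)\<^sup>2 \<le> Re (\<kappa> * cinner (shifted s x) x)" for x
  proof -
    have "\<kappa> * cinner (shifted s x) x = \<kappa> * complex_of_real ((norm x)\<^sup>2) - (\<kappa> * s) * cinner (S x) x"
      by (simp add: shifted_def cinner_diff_left cinner_scaleC_left cinner_norm algebra_simps)
    then have "Re (\<kappa> * cinner (shifted s x) x) = Re \<kappa> * (norm x)\<^sup>2 + cmod s * Re (cinner (S x) x)"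
      unfolding \<kappa>s by simp
    moreover have "cmod s * (a * (norm x)\<^sup>2) \<le> cmod s * Re (cinner (S x) x)"
      by (rule mult_left_mono[OF frame_op_coercive]) simp
    moreover have "cmod s * (a * (norm x)\<^sup>2) = 2 * (norm x)\<^sup>2" using s lower_pos by simp
    moreover have "- 1 * (norm x)\<^sup>2 \<le> Re \<kappa> * (norm x)\<^sup>2"
      using abs_Re_le_cmod[of \<kappa>] \<kappa> by (intro mult_right_mono) auto
    ultimately show ?thesis by simp
  qed
  show "bij (shifted s)" "bclinear (inv (shifted s))"
    using coercive_inverse(1,2)[OF bclinear_shifted _ \<kappa> coercive] by auto
  show "norm (inv (shifted s) x) \<le> norm x"
    using coercive_inverse(3)[OF bclinear_shifted _ \<kappa> coercive, of x] by simp
qed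

lemma bclinear_res: "bclinear (res s)"
  unfolding res_def[abs_def] by (rule bclinear_scale[OF bclinear_inv_shifted])

lemma norm_res: "norm (res s x) \<le> 2 / a * norm x"
  unfolding res_def norm_scaleC s
  using mult_left_mono[OF norm_inv_shifted, of "2 / a" x] lower_pos by simp

lemma shifted_res: "res s x - s *\<^sub>C S (res s x) = s *\<^sub>C x"
proof -
  have "shifted s (res s x) = s *\<^sub>C x"
    using bij_shifted by (simp add: res_def bclinear_scaleC[OF bclinear_shifted]
        bij_is_surj surj_f_inv_f)
  then show ?thesis by (simp add: shifted_def)
qed

lemma res_shifted: "res s x - s *\<^sub>C res s (S x) = s *\<^sub>C x"
proof -
  have "res s (shifted s x) = s *\<^sub>C x"
    using bij_shifted by (simp add: res_def bij_is_inj)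
  then show ?thesis
    by (simp add: shifted_def bclinear_diff[OF bclinear_res]
        bclinear_scaleC[OF bclinear_res])
qed

lemma res_mem: "op_matrix 1 (res s) \<in> \<A>"
proof (rule op_matrix_inverse_mem[OF bclinear_scale[OF bclinear_ident, of "- s"] bclinear_res])
  have "op_matrix 1 (\<lambda>x. (- s) *\<^sub>C x) = (\<lambda>i j. mat_one i j + (- s) * gram \<Psi> i j)"
    by (intro ext) (simp add: op_matrix_def gram_def mat_one_def cinner_scaleC_left)
  then show "op_matrix 1 (\<lambda>x. (- s) *\<^sub>C x) \<in> \<A>"
    using add_mem[OF one_mem scale_mem[OF gram_mem, of "- s"]] by simp
  show "(- s) *\<^sub>C x + res s x + (- s) *\<^sub>C S (res s x) = 0" for x
    using shifted_res[of x] by (simp add: scaleC_minus_left algebra_simps)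
  show "(- s) *\<^sub>C x + res s x + res s (S ((- s) *\<^sub>C x)) = 0" for x
    using res_shifted[of x]
    by (simp add: scaleC_minus_left bclinear_minus[OF bclinear_frame_op]
        bclinear_scaleC[OF bclinear_frame_op]
        bclinear_minus[OF bclinear_res] bclinear_scaleC[OF bclinear_res]
        algebra_simps)
qed

text \<open>Iterating this identity expands the resolvent in powers of \<open>W/s\<close>, where \<open>W = S\<^sup>-\<^sup>1\<close> has norm at
most \<open>1/a\<close>, that is, half of \<open>\<bar>s\<bar>\<close>.\<close>

lemma res_inverse_step: "res s x = - W x + (1 / s) *\<^sub>C res s (W x)"
proof -
  have s0: "s \<noteq> 0" using s lower_pos by auto
  have "res s (W x) - s *\<^sub>C res s x = s *\<^sub>C W x" using res_shifted[of "W x"] by simp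
  then have "(1 / s) *\<^sub>C (res s (W x) - s *\<^sub>C res s x) = (1 / s) *\<^sub>C (s *\<^sub>C W x)" by simp
  then show ?thesis using s0 by (simp add: scaleC_diff_right scaleC_scaleC algebra_simps)
qed

lemma res_expansion:
  "res s x = - (\<Sum>l<m. (1 / s) ^ l *\<^sub>C (W ^^ Suc l) x) + (1 / s) ^ m *\<^sub>C res s ((W ^^ m) x)"
proof (induction m)
  case 0
  show ?case by simp
next
  case (Suc m)
  have "(1 / s) ^ m *\<^sub>C res s ((W ^^ m) x) =
      - ((1 / s) ^ m *\<^sub>C (W ^^ Suc m) x) + (1 / s) ^ Suc m *\<^sub>C res s ((W ^^ Suc m) x)"
    by (subst res_inverse_step) (simp add: scaleC_diff_right scaleC_minus_right scaleC_scaleC mult.commute)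
  with Suc show ?case by simp
qed

end

text \<open>The resolvent identity for \<open>(1 - s G)\<^sup>-\<^sup>1\<close>. It makes the resolvents Lipschitz continuous in the norm
of the algebra wherever this norm is bounded.\<close>

lemma resolvent_identity:
  assumes s: "cmod s = 2 / a" and t: "cmod t = 2 / a"
  shows "(\<lambda>i j. op_matrix 1 (res s) i j - op_matrix 1 (res t) i j) =
    (\<lambda>i j. (s - t) * mat_mult (op_matrix 1 (res s)) (mat_mult (gram \<Psi>) (op_matrix 1 (res t))) i j)"
proof -
  note Rs = bclinear_res[OF s] and Rt = bclinear_res[OF t]
  let ?V = "\<lambda>x. x + S (res t x)"
  have V: "bclinear ?V"
    by (intro bclinear_plus bclinear_ident bclinear_compose[OF bclinear_frame_op] Rt)
  have eq: "mat_mult (op_matrix 1 (res s)) (mat_mult (gram \<Psi>) (op_matrix 1 (res t))) =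
      op_matrix 0 (\<lambda>x. ?V x + res s (S (?V x)))"
    unfolding gram_eq_op_matrix mat_mult_op_matrix[OF bclinear_ident Rt]
    using mat_mult_op_matrix[OF Rs V, of 1 0] by simp
  have "(s - t) *\<^sub>C (?V x + res s (S (?V x))) = res s x - res t x" for x
  proof -
    have tV: "t *\<^sub>C ?V x = res t x" using shifted_res[OF t, of x] by (simp add: scaleC_add_right algebra_simps)
    have "s *\<^sub>C (?V x + res s (S (?V x))) = res s (?V x)"
      using res_shifted[OF s, of "?V x"] by (simp add: scaleC_add_right algebra_simps)
    moreover have "t *\<^sub>C (?V x + res s (S (?V x))) = res t x + res s (S (res t x))"
      by (metis tV scaleC_add_right bclinear_scaleC[OF Rs] bclinear_scaleC[OF bclinear_frame_op])
    moreover have "(s - t) *\<^sub>C (?V x + res s (S (?V x))) =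
        s *\<^sub>C (?V x + res s (S (?V x))) - t *\<^sub>C (?V x + res s (S (?V x)))"
      using scaleC_add_left[of s "- t"] by (simp add: scaleC_minus_left)
    ultimately show ?thesis by (simp add: bclinear_add[OF Rs])
  qed
  then show ?thesis
    unfolding eq op_matrix_scale by (intro ext) (simp add: op_matrix_def cinner_diff_left)
qed

definition res_size :: "complex \<Rightarrow> real" where "res_size s = N (op_matrix 1 (res s))"

lemma norm_res_diff:
  assumes s: "cmod s = 2 / a" and t: "cmod t = 2 / a"
  shows "N (\<lambda>i j. op_matrix 1 (res s) i j - op_matrix 1 (res t) i j) \<le>
    cmod (s - t) * (res_size s * (N (gram \<Psi>) * res_size t))"
proof -
  note ms = res_mem[OF s] and mt = res_mem[OF t]
  have "N (mat_mult (op_matrix 1 (res s)) (mat_mult (gram \<Psi>) (op_matrix 1 (res t)))) \<le>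
      res_size s * N (mat_mult (gram \<Psi>) (op_matrix 1 (res t)))"
    unfolding res_size_def by (rule norm_mult[OF ms mult_mem[OF gram_mem mt]])
  also have "\<dots> \<le> res_size s * (N (gram \<Psi>) * res_size t)"
    unfolding res_size_def using norm_mult[OF gram_mem mt] norm_nonneg[OF ms] by (rule mult_left_mono)
  finally show ?thesis
    unfolding resolvent_identity[OF s t] norm_scale[OF mult_mem[OF ms mult_mem[OF gram_mem mt]]]
    by (rule mult_left_mono) simp
qed

text \<open>The norm of the algebra gives no direct bound for an inverse. Near a point \<open>t\<close> of the circle the
resolvent identity bounds the resolvents by \<open>2 res_size t\<close>; compactness of the circle does the rest.\<close>

lemma resolvent_bounded: "\<exists>K\<ge>0. \<forall>s. cmod s = 2 / a \<longrightarrow> res_size s \<le> K"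
proof (rule ccontr)
  assume unb: "\<not> ?thesis"
  have "\<exists>s. cmod s = 2 / a \<and> res_size s > real n" for n
    using unb by (meson not_le of_nat_0_le_iff)
  then obtain s where s: "\<And>n. cmod (s n) = 2 / a" "\<And>n. res_size (s n) > real n" by metis
  have "compact (sphere (0::complex) (2 / a))" by simp
  then obtain t \<phi> where t: "t \<in> sphere 0 (2 / a)" and \<phi>: "strict_mono \<phi>" and lim: "(s \<circ> \<phi>) \<longlonglongrightarrow> t"
    using s(1) unfolding compact_def by (metis mem_sphere_0)
  have t': "cmod t = 2 / a" using t by simp
  define g where "g = N (gram \<Psi>)"
  have g: "0 \<le> g" and rt: "0 \<le> res_size t"
    unfolding g_def res_size_def by (rule norm_nonneg[OF gram_mem], rule norm_nonneg[OF res_mem[OF t']])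
  \<comment> \<open>For \<open>\<bar>z - t\<bar> < \<delta>\<close> the resolvent identity gives
    \<open>res_size z \<le> res_size t + res_size z / 2\<close>.\<close>
  define \<delta> where "\<delta> = 1 / (2 * (g * res_size t + 1))"
  have gr: "0 \<le> g * res_size t" using g rt by simp
  have \<delta>: "\<delta> > 0" "\<delta> * (g * res_size t) \<le> 1 / 2" using gr by (auto simp: \<delta>_def field_simps)
  have close: "res_size z \<le> 2 * res_size t" if z: "cmod z = 2 / a" and d: "cmod (z - t) < \<delta>" for z
  proof -
    have rz: "0 \<le> res_size z" unfolding res_size_def by (rule norm_nonneg[OF res_mem[OF z]])
    have "N (op_matrix 1 (res z)) = N (\<lambda>i j. op_matrix 1 (res t) i j +
        (op_matrix 1 (res z) i j - op_matrix 1 (res t) i j))" by simp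
    also have "\<dots> \<le> res_size t + N (\<lambda>i j. op_matrix 1 (res z) i j - op_matrix 1 (res t) i j)"
      unfolding res_size_def by (rule norm_add[OF res_mem[OF t'] diff_mem[OF res_mem[OF z] res_mem[OF t']]])
    finally have "res_size z \<le> res_size t + cmod (z - t) * (res_size z * (g * res_size t))"
      using norm_res_diff[OF z t'] unfolding res_size_def g_def by simp
    also have "cmod (z - t) * (res_size z * (g * res_size t)) \<le> \<delta> * (res_size z * (g * res_size t))"
      using d rz gr by (intro mult_right_mono) auto
    also have "\<dots> = res_size z * (\<delta> * (g * res_size t))" by simp
    also have "\<dots> \<le> res_size z * (1 / 2)" by (rule mult_left_mono[OF \<delta>(2) rz])
    finally show ?thesis by simp
  qed
  have "\<forall>\<^sub>F n in sequentially. dist ((s \<circ> \<phi>) n) t < \<delta>"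
    using lim \<delta>(1) by (simp add: tendsto_iff)
  then obtain M where M: "\<And>n. n \<ge> M \<Longrightarrow> dist ((s \<circ> \<phi>) n) t < \<delta>" by (auto simp: eventually_sequentially)
  define n where "n = max M (nat \<lceil>2 * res_size t\<rceil>)"
  have "res_size (s (\<phi> n)) \<le> 2 * res_size t" using close[OF s(1)] M[of n] by (simp add: n_def dist_norm)
  moreover have "2 * res_size t \<le> real n" unfolding n_def by linarith
  moreover have "real n \<le> real (\<phi> n)" using seq_suble[OF \<phi>, of n] by simp
  ultimately show False using s(2)[of "\<phi> n"] by simp
qed

text \<open>Riemann sums for the mean over the circle, at the \<open>2\<^sup>n\<close>-th roots of unity. Powers of two let each
set of nodes contain the preceding one.\<close>

definition node :: "nat \<Rightarrow> nat \<Rightarrow> complex" where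
  "node n k = complex_of_real (2 / a) * cis (2 * pi / real (2 ^ n)) ^ k"

lemma cmod_node: "cmod (node n k) = 2 / a"
  using lower_pos by (simp add: node_def norm_mult norm_power norm_divide)

lemma node_double: "node (Suc n) (2 * k) = node n k"
  by (simp add: node_def power_mult Complex.DeMoivre)

definition avg :: "nat \<Rightarrow> 'a \<Rightarrow> 'a" where
  "avg n x = complex_of_real (1 / 2 ^ n) *\<^sub>C (\<Sum>k<2 ^ n. res (node n k) x)"

definition avg_matrix :: "nat \<Rightarrow> 'i matrix" where
  "avg_matrix n i j = complex_of_real (1 / 2 ^ n) * (\<Sum>k<2 ^ n. op_matrix 1 (res (node n k)) i j)"

lemma avg_matrix_mem: "avg_matrix n \<in> \<A>"
proof -
  have "(\<lambda>i j. \<Sum>k<2 ^ n. op_matrix 1 (res (node n k)) i j) \<in> \<A>"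
    using sum_mem[of "{..<2 ^ n}" "\<lambda>k. op_matrix 1 (res (node n k))"] res_mem[OF cmod_node] by blast
  from scale_mem[OF this, of "complex_of_real (1 / 2 ^ n)"] show ?thesis
    unfolding avg_matrix_def[abs_def] .
qed

lemma avg_matrix_eq: "avg_matrix n = op_matrix 1 (avg n)"
proof (intro ext)
  fix i j
  have "(\<Sum>k<2 ^ n. op_matrix 1 (res (node n k)) i j) =
      2 ^ n * mat_one j i + cinner (\<Sum>k<2 ^ n. res (node n k) (\<Psi> j)) (\<Psi> i)"
    by (simp add: op_matrix_def sum.distrib cinner_sum_left)
  then show "avg_matrix n i j = op_matrix 1 (avg n) i j"
    by (simp add: avg_matrix_def avg_def op_matrix_def cinner_scaleC_left distrib_left)
qed

lemma sum_even_odd: "(\<Sum>k<2 * m. f k) = (\<Sum>k<m. f (2 * k) + f (Suc (2 * k)))" for f :: "nat \<Rightarrow> 'c::comm_monoid_add"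
  by (induction m) (simp_all add: add.assoc)

text \<open>The even nodes of the finer sum are the nodes of the coarser one, so the difference of the two means is
half the mean of differences of resolvents at adjacent nodes, and these are of order \<open>2\<^sup>-\<^sup>n\<close>.\<close>

lemma avg_matrix_step: "\<exists>C. \<forall>n. N (\<lambda>i j. avg_matrix (Suc n) i j - avg_matrix n i j) \<le> C / 2 ^ n"
proof -
  obtain K where K: "K \<ge> 0" "\<And>s. cmod s = 2 / a \<Longrightarrow> res_size s \<le> K" using resolvent_bounded by blast
  define L where "L = K * (N (gram \<Psi>) * K)"
  have g: "0 \<le> N (gram \<Psi>)" by (rule norm_nonneg[OF gram_mem])
  have L: "L \<ge> 0" unfolding L_def using K(1) g by simp
  have lip: "N (\<lambda>i j. op_matrix 1 (res s) i j - op_matrix 1 (res t) i j) \<le> L * cmod (s - t)"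
    if s: "cmod s = 2 / a" and t: "cmod t = 2 / a" for s t
  proof -
    have "res_size s * (N (gram \<Psi>) * res_size t) \<le> L"
      unfolding L_def using K g norm_nonneg[OF res_mem[OF s]] norm_nonneg[OF res_mem[OF t]] s t
      by (intro mult_mono mult_left_mono mult_nonneg_nonneg) (auto simp: res_size_def)
    then show ?thesis using order_trans[OF norm_res_diff[OF s t] mult_left_mono] by (simp add: mult.commute)
  qed
  let ?M = "\<lambda>n k. op_matrix 1 (res (node n k))"
  have "N (\<lambda>i j. avg_matrix (Suc n) i j - avg_matrix n i j) \<le> (L * (2 / a) * pi) / 2 ^ n" for n
  proof -
    let ?D = "\<lambda>k i j. ?M (Suc n) (Suc (2 * k)) i j - ?M (Suc n) (2 * k) i j"
    have D: "?D k \<in> \<A>" for k by (intro diff_mem res_mem cmod_node)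
    have dist_node: "cmod (node (Suc n) (Suc (2 * k)) - node (Suc n) (2 * k)) \<le> (2 / a) * (2 * pi / 2 ^ Suc n)" for k
    proof -
      let ?z = "cis (2 * pi / real (2 ^ Suc n))"
      have "c * z ^ Suc j - c * z ^ j = c * z ^ j * (z - 1)" for c z :: complex and j
        by (simp add: algebra_simps)
      then have "node (Suc n) (Suc (2 * k)) - node (Suc n) (2 * k) =
          complex_of_real (2 / a) * ?z ^ (2 * k) * (?z - 1)"
        unfolding node_def .
      then have eq: "cmod (node (Suc n) (Suc (2 * k)) - node (Suc n) (2 * k)) = (2 / a) * cmod (?z - 1)"
        using lower_pos by (simp add: Real_Vector_Spaces.norm_mult norm_power norm_divide)
      have "cmod (?z - 1) = 2 * \<bar>sin (2 * pi / real (2 ^ Suc n) / 2)\<bar>"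
        unfolding cis_conv_exp by (rule dist_exp_i_1)
      also have "\<dots> \<le> 2 * \<bar>2 * pi / real (2 ^ Suc n) / 2\<bar>"
        by (rule mult_left_mono[OF abs_sin_x_le_abs_x]) simp
      also have "\<dots> = 2 * pi / 2 ^ Suc n" by simp
      finally show ?thesis unfolding eq using lower_pos by (intro mult_left_mono) auto
    qed
    have "(\<lambda>i j. avg_matrix (Suc n) i j - avg_matrix n i j) =
        (\<lambda>i j. complex_of_real (1 / 2 ^ Suc n) * (\<Sum>k<2 ^ n. ?D k i j))"
    proof (intro ext)
      fix i j
      have "(\<Sum>k<2 ^ Suc n. ?M (Suc n) k i j) = (\<Sum>k<2 ^ n. ?M n k i j + ?M (Suc n) (Suc (2 * k)) i j)"
        using sum_even_odd[of "\<lambda>k. ?M (Suc n) k i j" "2 ^ n"] by (simp add: node_double)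
      moreover have "(\<Sum>k<2 ^ n. ?D k i j) = (\<Sum>k<2 ^ n. ?M (Suc n) (Suc (2 * k)) i j - ?M n k i j)"
        by (simp add: node_double)
      ultimately show "avg_matrix (Suc n) i j - avg_matrix n i j =
          complex_of_real (1 / 2 ^ Suc n) * (\<Sum>k<2 ^ n. ?D k i j)"
        by (simp add: avg_matrix_def sum.distrib sum_subtractf field_simps)
    qed
    then have "N (\<lambda>i j. avg_matrix (Suc n) i j - avg_matrix n i j) =
        (1 / 2 ^ Suc n) * N (\<lambda>i j. \<Sum>k<2 ^ n. ?D k i j)"
      using norm_scale[of "\<lambda>i j. \<Sum>k<2 ^ n. ?D k i j" "complex_of_real (1 / 2 ^ Suc n)"] sum_mem[of "{..<2 ^ n}" ?D] D
      by (simp add: norm_divide norm_power Real_Vector_Spaces.norm_mult)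
    also have "N (\<lambda>i j. \<Sum>k<2 ^ n. ?D k i j) \<le> (\<Sum>k<2 ^ n. N (?D k))"
      using sum_mem[of "{..<2 ^ n}" ?D] D by blast
    also have "\<dots> \<le> (\<Sum>k<(2::nat) ^ n. L * ((2 / a) * (2 * pi / 2 ^ Suc n)))"
      by (intro sum_mono order_trans[OF lip[OF cmod_node cmod_node]] mult_left_mono dist_node L)
    also have "\<dots> = L * (2 / a) * pi" by (simp add: field_simps)
    finally have "N (\<lambda>i j. avg_matrix (Suc n) i j - avg_matrix n i j) \<le> (1 / 2 ^ Suc n) * (L * (2 / a) * pi)"
      by (simp add: mult_left_mono divide_right_mono)
    also have "\<dots> \<le> (L * (2 / a) * pi) / 2 ^ n"
      using L lower_pos by (simp add: field_simps)
    finally show ?thesis .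
  qed
  then show ?thesis by blast
qed

lemma norm_inv_power: "norm ((W ^^ m) x) \<le> (1 / a) ^ m * norm x"
proof (induction m)
  case (Suc m)
  have "norm ((W ^^ Suc m) x) \<le> norm ((W ^^ m) x) / a" using norm_inv_frame_op by simp
  also have "\<dots> \<le> (1 / a) ^ m * norm x / a" using Suc lower_pos by (intro divide_right_mono) auto
  finally show ?case by simp
qed simp

text \<open>Averaging the expansion of the resolvent over the \<open>m\<close>-th roots of unity, \<open>m = 2\<^sup>n\<close>, kills all powers
\<open>(W/s)\<^sup>l\<close> with \<open>0 < l < m\<close>. The term for \<open>l = 0\<close> gives \<open>- W\<close>, and the remainder carries the
factor \<open>(W/s)\<^sup>m\<close>, of norm at most \<open>2\<^sup>-\<^sup>m\<close>.\<close>

lemma avg_tendsto: "(\<lambda>n. avg n x) \<longlonglongrightarrow> - W x"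
proof -
  have step: "norm (avg n x + W x) \<le> (1 / 2) ^ n * (2 / a * norm x)" for n
  proof -
    define m :: nat where "m = 2 ^ n"
    have m: "0 < m" by (simp add: m_def)
    let ?\<rho> = "complex_of_real (a / 2)" and ?z = "cis (2 * pi / real m)"
    have inv_node: "1 / node n k = ?\<rho> * inverse ?z ^ k" for k
      using lower_pos by (simp add: node_def m_def field_simps)
    have zm: "?z ^ m = 1" using m by (simp add: Complex.DeMoivre)
    have zkm: "(inverse ?z ^ k) ^ m = 1" for k
    proof -
      have "(inverse ?z ^ k) ^ m = (inverse ?z ^ m) ^ k" by (simp only: power_mult[symmetric] mult.commute)
      also have "inverse ?z ^ m = 1" by (simp only: power_inverse zm inverse_1)
      finally show ?thesis by simp
    qed
    have sum0: "(\<Sum>k<m. (1 / node n k) ^ l) = 0" if l: "0 < l" "l < m" for l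
    proof -
      have "inverse ?z ^ l \<noteq> 1"
        using cis_power_neq_1[OF l] unfolding power_inverse inverse_eq_1_iff .
      with zkm have "(\<Sum>k<m. (inverse ?z ^ l) ^ k) = 0" by (rule sum_root_of_unity_powers)
      moreover have "(1 / node n k) ^ l = ?\<rho> ^ l * (inverse ?z ^ l) ^ k" for k
        by (simp only: inv_node power_mult_distrib power_mult[symmetric] mult.commute[of l])
      ultimately show ?thesis by (simp add: sum_distrib_left[symmetric])
    qed
    have pow_m: "(1 / node n k) ^ m = ?\<rho> ^ m" for k
      by (simp only: inv_node power_mult_distrib zkm mult_1_right)
    let ?y = "(W ^^ m) x"
    have "(\<Sum>k<m. res (node n k) x) =
        (\<Sum>k<m. - (\<Sum>l<m. (1 / node n k) ^ l *\<^sub>C (W ^^ Suc l) x) + (1 / node n k) ^ m *\<^sub>C res (node n k) ?y)"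
      by (intro sum.cong refl res_expansion cmod_node)
    also have "\<dots> = - (\<Sum>k<m. \<Sum>l<m. (1 / node n k) ^ l *\<^sub>C (W ^^ Suc l) x) +
        (\<Sum>k<m. ?\<rho> ^ m *\<^sub>C res (node n k) ?y)"
      unfolding pow_m by (simp add: sum_subtractf)
    also have "(\<Sum>k<m. \<Sum>l<m. (1 / node n k) ^ l *\<^sub>C (W ^^ Suc l) x) =
        (\<Sum>l<m. (\<Sum>k<m. (1 / node n k) ^ l) *\<^sub>C (W ^^ Suc l) x)"
      by (subst sum.swap) (simp add: scaleC_sum_left)
    also have "\<dots> = (\<Sum>l<m. if l = 0 then of_nat m *\<^sub>C W x else 0)"
      using sum0 by (intro sum.cong refl) auto
    also have "\<dots> = of_nat m *\<^sub>C W x" using m by simp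
    finally have sum_eq: "(\<Sum>k<m. res (node n k) x) =
        - (of_nat m *\<^sub>C W x) + (\<Sum>k<m. ?\<rho> ^ m *\<^sub>C res (node n k) ?y)" .
    let ?im = "complex_of_real (1 / real m)"
    have avg_m: "avg n x = ?im *\<^sub>C (\<Sum>k<m. res (node n k) x)" by (simp add: avg_def m_def)
    have "avg n x + W x = ?im *\<^sub>C (\<Sum>k<m. ?\<rho> ^ m *\<^sub>C res (node n k) ?y)"
      unfolding avg_m sum_eq using m by (simp add: scaleC_diff_right scaleC_minus_right scaleC_scaleC)
    then have "norm (avg n x + W x) = (1 / real m) * norm (\<Sum>k<m. ?\<rho> ^ m *\<^sub>C res (node n k) ?y)"
      by (simp add: norm_scaleC norm_divide)
    also have "\<dots> \<le> (1 / real m) * (\<Sum>k<m. (a / 2) ^ m * (2 / a * norm ?y))"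
    proof (intro mult_left_mono sum_norm_le)
      fix k
      show "norm (?\<rho> ^ m *\<^sub>C res (node n k) ?y) \<le> (a / 2) ^ m * (2 / a * norm ?y)"
      proof -
        have "cmod (?\<rho> ^ m) = (a / 2) ^ m" using lower_pos by (simp add: norm_power norm_divide)
        then show ?thesis
          unfolding norm_scaleC using norm_res[OF cmod_node, of n k ?y] lower_pos
          by (intro mult_mono) auto
      qed
    qed simp
    also have "\<dots> = (a / 2) ^ m * (2 / a * norm ?y)" using m by simp
    also have "\<dots> \<le> (a / 2) ^ m * (2 / a * ((1 / a) ^ m * norm x))"
      using norm_inv_power[of m x] lower_pos by (intro mult_left_mono) auto
    also have "\<dots> = ((a / 2) * (1 / a)) ^ m * (2 / a * norm x)" unfolding power_mult_distrib by simp
    also have "(a / 2) * (1 / a) = 1 / 2" using lower_pos by simp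
    also have "(1 / 2) ^ m * (2 / a * norm x) \<le> (1 / 2) ^ n * (2 / a * norm x)"
      using lower_pos less_exp[of n]
      by (intro mult_right_mono power_decreasing) (auto simp: m_def less_imp_le)
    finally show ?thesis .
  qed
  have lim0: "(\<lambda>n. (1 / 2) ^ n * (2 / a * norm x)) \<longlonglongrightarrow> 0"
    by (intro tendsto_mult_left_zero LIMSEQ_power_zero) simp
  have "(\<lambda>n. avg n x + W x) \<longlonglongrightarrow> 0"
    by (rule Lim_null_comparison[OF always_eventually[OF allI[OF step]] lim0])
  then show ?thesis using LIM_zero_iff[of "\<lambda>n. avg n x" "- W x"] by simp
qed

text \<open>The means converge to \<open>1 - P\<close>.\<close>

lemma projection_mem: "op_matrix 0 W \<in> \<A>"
proof -
  obtain C where C: "\<And>n. N (\<lambda>i j. avg_matrix (Suc n) i j - avg_matrix n i j) \<le> C / 2 ^ n"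
    using avg_matrix_step by blast
  then obtain L where L: "L \<in> \<A>" "\<And>i j. (\<lambda>n. avg_matrix n i j) \<longlonglongrightarrow> L i j"
    using complete_geometric[of avg_matrix C, OF avg_matrix_mem C] by blast
  have "L i j = op_matrix 1 (\<lambda>x. - W x) i j" for i j
  proof (rule LIMSEQ_unique[OF L(2)])
    have "(\<lambda>n. cinner (avg n (\<Psi> j)) (\<Psi> i)) \<longlonglongrightarrow> cinner (- W (\<Psi> j)) (\<Psi> i)"
      by (rule bounded_linear.tendsto[OF bounded_linear_cinner_left avg_tendsto])
    then show "(\<lambda>n. avg_matrix n i j) \<longlonglongrightarrow> op_matrix 1 (\<lambda>x. - W x) i j"
      unfolding avg_matrix_eq op_matrix_def by (intro tendsto_add tendsto_const)
  qed
  then have "op_matrix 0 W = (\<lambda>i j. mat_one i j - L i j)"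
    unfolding mat_one_eq_op_matrix by (intro ext) (simp add: op_matrix_def cinner_minus_left)
  then show ?thesis using diff_mem[OF one_mem L(1)] by simp
qed

text \<open>\<open>1 + G - P\<close> acts as \<open>G\<close> on the range of \<open>P\<close> and as the identity on its complement; its inverse
is \<open>1 + D - P\<close>.\<close>

lemma dual_gram_mem: "op_matrix 0 (\<lambda>x. W (W x)) \<in> \<A>"
proof -
  note Wb = bclinear_inv_frame_op
  let ?V = "\<lambda>x. x + (- 1) *\<^sub>C W x" and ?U = "\<lambda>x. W (W x) + (- 1) *\<^sub>C W x"
  have V: "bclinear ?V" and U: "bclinear ?U"
    by (intro bclinear_plus bclinear_ident bclinear_scale bclinear_compose[OF Wb] Wb)+
  have "op_matrix 1 ?V = (\<lambda>i j. (mat_one i j + gram \<Psi> i j) - op_matrix 0 W i j)"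
    unfolding mat_one_eq_op_matrix gram_eq_op_matrix
    by (intro ext) (simp add: op_matrix_def cinner_add_left cinner_minus_left scaleC_minus_one cinner_diff_left)
  then have Vm: "op_matrix 1 ?V \<in> \<A>"
    using diff_mem[OF add_mem[OF one_mem gram_mem] projection_mem] by simp
  have "op_matrix 1 ?U \<in> \<A>"
    by (rule op_matrix_inverse_mem[OF V U Vm])
      (simp_all add: scaleC_minus_one bclinear_add[OF bclinear_frame_op]
        bclinear_minus[OF bclinear_frame_op] bclinear_add[OF Wb] bclinear_minus[OF Wb]
        bclinear_diff[OF bclinear_frame_op] bclinear_diff[OF Wb])
  moreover have "op_matrix 0 (\<lambda>x. W (W x)) = (\<lambda>i j. (op_matrix 1 ?U i j - mat_one i j) + op_matrix 0 W i j)"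
    unfolding mat_one_eq_op_matrix
    by (intro ext) (simp add: op_matrix_def cinner_add_left cinner_minus_left scaleC_minus_one cinner_diff_left)
  ultimately show ?thesis using add_mem[OF diff_mem[OF _ one_mem] projection_mem] by simp
qed

end

section \<open>Co-orbit spaces as spaces of coefficients\<close>

definition cross_gram :: "('i \<Rightarrow> 'a::complex_inner) \<Rightarrow> ('i \<Rightarrow> 'a) \<Rightarrow> 'i matrix" where
  "cross_gram \<Psi> \<Phi> i j = cinner (\<Psi> j) (\<Phi> i)"

definition lim_coeffs :: "('i \<Rightarrow> 'a::complex_inner) \<Rightarrow> (nat \<Rightarrow> 'a) \<Rightarrow> 'i \<Rightarrow> complex" where
  "lim_coeffs \<Phi> f i = lim (\<lambda>n. analysis \<Phi> (f n) i)"

lemma analysis_add': "analysis \<Phi> (f + g) i = analysis \<Phi> f i + analysis \<Phi> g i"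
  by (simp add: analysis_def cinner_add_left)

lemma analysis_diff': "analysis \<Phi> (f - g) i = analysis \<Phi> f i - analysis \<Phi> g i"
  by (simp add: analysis_def cinner_diff_left)

lemma analysis_scaleC': "analysis \<Phi> (c *\<^sub>C f) i = c * analysis \<Phi> f i"
  by (simp add: analysis_def cinner_scaleC_left)

text \<open>Co-orbit spaces are quotients of a set of sequences. This locale isolates what both cases
\<open>p = 1\<close> and \<open>p = \<infinity>\<close> have in common: the equivalence relation is equality of the coefficientwise
limits, so a class is determined by its coefficients, and these are linear.\<close>

locale coefficient_classes =
  fixes S :: "(nat \<Rightarrow> 'a::complex_inner) set" and R and \<Phi> :: "'i \<Rightarrow> 'a"
  assumes convergent_coeffs: "f \<in> S \<Longrightarrow> convergent (\<lambda>n. analysis \<Phi> (f n) i)"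
    and add_closed: "f \<in> S \<Longrightarrow> g \<in> S \<Longrightarrow> (\<lambda>n. f n + g n) \<in> S"
    and scale_closed: "f \<in> S \<Longrightarrow> (\<lambda>n. c *\<^sub>C f n) \<in> S"
    and rel_iff: "(f, g) \<in> R \<longleftrightarrow> f \<in> S \<and> g \<in> S \<and> lim_coeffs \<Phi> f = lim_coeffs \<Phi> g"
begin

abbreviation "coef \<equiv> analysis \<Phi>"
abbreviation "limc \<equiv> lim_coeffs \<Phi>"
abbreviation "ext \<equiv> ext_analysis \<Phi>"

lemma coeffs_LIMSEQ: "f \<in> S \<Longrightarrow> (\<lambda>n. coef (f n) i) \<longlonglongrightarrow> limc f i"
  unfolding lim_coeffs_def using convergent_coeffs convergent_LIMSEQ_iff by blast

lemma lim_coeffs_add: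
  assumes "f \<in> S" and "g \<in> S"
  shows "limc (\<lambda>n. f n + g n) = (\<lambda>i. limc f i + limc g i)"
proof
  fix i
  have "(\<lambda>n. coef (f n + g n) i) \<longlonglongrightarrow> limc f i + limc g i"
    unfolding analysis_add' by (intro tendsto_add coeffs_LIMSEQ assms)
  then show "limc (\<lambda>n. f n + g n) i = limc f i + limc g i"
    unfolding lim_coeffs_def[of \<Phi> "\<lambda>n. f n + g n"] by (rule limI)
qed

lemma lim_coeffs_scale:
  assumes "f \<in> S"
  shows "limc (\<lambda>n. c *\<^sub>C f n) = (\<lambda>i. c * limc f i)"
proof
  fix i
  have "(\<lambda>n. coef (c *\<^sub>C f n) i) \<longlonglongrightarrow> c * limc f i"
    unfolding analysis_scaleC' by (intro tendsto_mult tendsto_const coeffs_LIMSEQ assms)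
  then show "limc (\<lambda>n. c *\<^sub>C f n) i = c * limc f i"
    unfolding lim_coeffs_def[of \<Phi> "\<lambda>n. c *\<^sub>C f n"] by (rule limI)
qed

lemma class_eq: "f \<in> S \<Longrightarrow> R `` {f} = {g \<in> S. limc g = limc f}"
  by (auto simp: rel_iff)

lemma ext_analysis_class:
  assumes "f \<in> S"
  shows "ext (R `` {f}) = limc f"
proof -
  have "f \<in> R `` {f}" using assms by (simp add: rel_iff)
  then have "(SOME g. g \<in> R `` {f}) \<in> R `` {f}" by (rule someI[of "\<lambda>g. g \<in> R `` {f}"])
  then have "limc (SOME g. g \<in> R `` {f}) = limc f"
    unfolding class_eq[OF assms] by blast
  then show ?thesis unfolding ext_analysis_def lim_coeffs_def[symmetric] by (intro ext) simp
qed

lemma class_cases: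
  assumes "X \<in> S // R"
  obtains f where "f \<in> S" and "X = R `` {f}"
  using assms by (rule quotientE)

lemma class_member:
  assumes X: "X \<in> S // R" and f: "f \<in> X"
  shows "f \<in> S" and "ext X = limc f" and "X = R `` {f}"
proof -
  obtain g where g: "g \<in> S" "X = R `` {g}" using X by (rule class_cases)
  show fS: "f \<in> S" using f g class_eq by auto
  have eq: "limc f = limc g" using f g class_eq[OF g(1)] by auto
  then show "X = R `` {f}" using g(2) class_eq[OF g(1)] class_eq[OF fS] by simp
  then show "ext X = limc f" using ext_analysis_class[OF fS] by simp
qed

lemma class_some:
  assumes "X \<in> S // R"
  shows "(SOME f. f \<in> X) \<in> X"
proof -
  obtain f where "f \<in> S" "X = R `` {f}" using assms by (rule class_cases)
  then have "f \<in> X" by (simp add: rel_iff)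
  then show ?thesis by (rule someI[of "\<lambda>f. f \<in> X"])
qed

lemma class_eqI:
  assumes X: "X \<in> S // R" and Y: "Y \<in> S // R" and eq: "ext X = ext Y"
  shows "X = Y"
proof -
  obtain f where f: "f \<in> S" "X = R `` {f}" using X by (rule class_cases)
  obtain g where g: "g \<in> S" "Y = R `` {g}" using Y by (rule class_cases)
  show ?thesis
    using eq unfolding f(2) g(2) ext_analysis_class[OF f(1)] ext_analysis_class[OF g(1)]
    unfolding class_eq[OF f(1)] class_eq[OF g(1)] by simp
qed

text \<open>Sums and multiples of classes are defined as saturations of sets of sequences; such a saturation is a
single class because the coefficients agree.\<close>

lemma class_image:
  assumes Z: "Z \<subseteq> S" "Z \<noteq> {}" and c: "\<And>f. f \<in> Z \<Longrightarrow> limc f = c"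
  shows "R `` Z \<in> S // R" and "ext (R `` Z) = c"
proof -
  obtain f where f: "f \<in> Z" "f \<in> S" using Z by blast
  have "R `` Z = R `` {f}" using Z(1) f c by (auto simp: rel_iff)
  then show "R `` Z \<in> S // R" and "ext (R `` Z) = c"
    using quotientI[OF f(2)] ext_analysis_class[OF f(2)] c[OF f(1)] by auto
qed

lemma class_add:
  assumes X: "X \<in> S // R" and Y: "Y \<in> S // R"
  shows "R `` {(\<lambda>n. f n + g n) | f g. f \<in> X \<and> g \<in> Y} \<in> S // R"
    and "ext (R `` {(\<lambda>n. f n + g n) | f g. f \<in> X \<and> g \<in> Y}) = (\<lambda>i. ext X i + ext Y i)"
proof -
  let ?Z = "{(\<lambda>n. f n + g n) | f g. f \<in> X \<and> g \<in> Y}"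
  note mX = class_member(1,2)[OF X] and mY = class_member(1,2)[OF Y]
  have Z: "?Z \<subseteq> S" using mX(1) mY(1) by (auto intro: add_closed)
  have ne: "?Z \<noteq> {}" using class_some[OF X] class_some[OF Y] by blast
  have c: "limc h = (\<lambda>i. ext X i + ext Y i)" if "h \<in> ?Z" for h
    using that mX mY by (auto simp: lim_coeffs_add)
  show "R `` ?Z \<in> S // R" by (rule class_image(1)[OF Z ne c])
  show "ext (R `` ?Z) = (\<lambda>i. ext X i + ext Y i)" by (rule class_image(2)[OF Z ne c])
qed

lemma class_scale:
  assumes X: "X \<in> S // R"
  shows "R `` {(\<lambda>n. c *\<^sub>C f n) | f. f \<in> X} \<in> S // R"
    and "ext (R `` {(\<lambda>n. c *\<^sub>C f n) | f. f \<in> X}) = (\<lambda>i. c * ext X i)"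
proof -
  let ?Z = "{(\<lambda>n. c *\<^sub>C f n) | f. f \<in> X}"
  note mX = class_member(1,2)[OF X]
  have Z: "?Z \<subseteq> S" using mX(1) by (auto intro: scale_closed)
  have ne: "?Z \<noteq> {}" using class_some[OF X] by blast
  have c: "limc h = (\<lambda>i. c * ext X i)" if "h \<in> ?Z" for h
    using that mX by (auto simp: lim_coeffs_scale)
  show "R `` ?Z \<in> S // R" by (rule class_image(1)[OF Z ne c])
  show "ext (R `` ?Z) = (\<lambda>i. c * ext X i)" by (rule class_image(2)[OF Z ne c])
qed

end

text \<open>Bounded coefficientwise convergence, the convergence that defines the co-orbit space for
\<open>p = \<infinity>\<close>, is preserved by matrices that satisfy Schur's test.\<close>

lemma schur_dominated_convergence:
  assumes A: "schur w B A" and bound: "\<And>n j. cmod (d n j) \<le> M * w j"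
    and lim: "\<And>j. (\<lambda>n. d n j) \<longlonglongrightarrow> e j"
  shows "(\<lambda>n. mat_vec A (d n) i) \<longlonglongrightarrow> mat_vec A e i"
  unfolding mat_vec_def
proof (rule infsum_dominated_convergence[OF summable_on_cmult_left[OF schur_row(1)[OF A], of i M]])
  show "norm (A i j * d n j) \<le> cmod (A i j) * w j * M" for n j
    using mult_left_mono[OF bound[of n j] norm_ge_zero[of "A i j"]] by (simp add: norm_mult mult_ac)
  show "(\<lambda>n. A i j * d n j) \<longlonglongrightarrow> A i j * e j" for j
    by (intro tendsto_intros lim)
qed

text \<open>The properties of a frame and its dual that identify the co-orbit spaces with spaces of coefficients.
The family \<open>\<Phi>\<close> is kept abstract so that the tensor product of two dual frames is covered. The two
reproducing formulas are required only for vectors with weighted bounded coefficients: there Schur's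
test makes the sums absolutely convergent.\<close>

locale coefficient_system =
  fixes \<Psi> \<Phi> :: "'i::countable \<Rightarrow> 'a::complex_inner" and w :: "'i \<Rightarrow> real" and B :: real
  assumes schur_P: "schur w B (cross_gram \<Psi> \<Phi>)"
    and schur_G: "schur w B (gram \<Psi>)"
    and reproduce: "(\<And>j. cmod (analysis \<Phi> f j) \<le> M * w j) \<Longrightarrow>
      mat_vec (cross_gram \<Psi> \<Phi>) (analysis \<Phi> f) = analysis \<Phi> f"
    and reproduce_gram: "(\<And>j. cmod (analysis \<Phi> f j) \<le> M * w j) \<Longrightarrow>
      mat_vec (gram \<Psi>) (analysis \<Phi> f) = analysis \<Psi> f"
begin

abbreviation "coef \<equiv> analysis \<Phi>"
abbreviation "limc \<equiv> lim_coeffs \<Phi>"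
abbreviation "ext \<equiv> ext_analysis \<Phi>"
abbreviation "P \<equiv> cross_gram \<Psi> \<Phi>"
abbreviation "G \<equiv> gram \<Psi>"
abbreviation "v \<equiv> (\<lambda>i. 1 / w i)"
abbreviation "S1 \<equiv> coorbit_seqs 1 \<Psi> \<Phi> w"
abbreviation "R1 \<equiv> coorbit_rel 1 \<Psi> \<Phi> w"
abbreviation "Sinf \<equiv> coorbit_seqs \<infinity> \<Psi> \<Phi> v"
abbreviation "Rinf \<equiv> coorbit_rel \<infinity> \<Psi> \<Phi> v"

lemmas w_pos = schur_weight_pos[OF schur_P]

definition partial_synthesis :: "('i \<Rightarrow> complex) \<Rightarrow> nat \<Rightarrow> 'a" where
  "partial_synthesis c n = (\<Sum>j\<in>{j. to_nat j < n}. c j *\<^sub>C \<Psi> j)"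

lemma analysis_finite_combination:
  assumes "finite F"
  shows "coef (\<Sum>j\<in>F. c j *\<^sub>C \<Psi> j) = mat_vec P (\<lambda>j. if j \<in> F then c j else 0)"
proof
  fix i
  have "((\<lambda>j. P i j * (if j \<in> F then c j else 0)) has_sum (\<Sum>j\<in>F. P i j * c j)) UNIV"
    using assms by (intro has_sum_finite_neutralI[of F]) auto
  then have "mat_vec P (\<lambda>j. if j \<in> F then c j else 0) i = (\<Sum>j\<in>F. P i j * c j)"
    unfolding mat_vec_def by (rule infsumI)
  then show "coef (\<Sum>j\<in>F. c j *\<^sub>C \<Psi> j) i = mat_vec P (\<lambda>j. if j \<in> F then c j else 0) i"
    by (simp add: analysis_def cinner_sum_left cinner_scaleC_left cross_gram_def mult.commute)
qed

text \<open>Finite combinations lie in both coefficient spaces: in \<open>\<ell>\<^sup>1\<^sub>w\<close>, where the sequences for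
\<open>p = 1\<close> live, and in the weighted bounded families, where the reproducing formulas hold.\<close>

lemma finite_combination_coeffs:
  assumes "f \<in> finite_combinations \<Psi>"
  shows "l1_summable w (coef f)" and "\<exists>M. \<forall>j. cmod (coef f j) \<le> M * w j"
proof -
  obtain F c where f: "finite F" "f = (\<Sum>j\<in>F. c j *\<^sub>C \<Psi> j)"
    using assms unfolding finite_combinations_def by blast
  have "finite {j. (if j \<in> F then c j else 0) \<noteq> 0}" by (rule finite_subset[OF _ f(1)]) auto
  then show "l1_summable w (coef f)"
    unfolding f(2) analysis_finite_combination[OF f(1)]
    by (intro schur_l1(1)[OF schur_P] l1_summable_finite_support)
  define M where "M = (\<Sum>j\<in>F. cmod (c j) / w j)"
  have "cmod (if j \<in> F then c j else 0) \<le> M * w j" for j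
  proof (cases "j \<in> F")
    case True
    have "cmod (c j) / w j \<le> M"
      unfolding M_def using f(1) True w_pos by (intro member_le_sum) (auto simp: less_imp_le)
    then show ?thesis using True w_pos[of j] by (simp add: divide_le_eq)
  next
    case False
    have "0 \<le> M" unfolding M_def using w_pos by (intro sum_nonneg) (auto simp: less_imp_le)
    then show ?thesis using False w_pos[of j] by simp
  qed
  from schur_bounded(3)[OF schur_P this]
  show "\<exists>M. \<forall>j. cmod (coef f j) \<le> M * w j"
    unfolding f(2) analysis_finite_combination[OF f(1)] by blast
qed

lemma finite_combination_add_scaleC:
  assumes "f \<in> finite_combinations \<Psi>" and "g \<in> finite_combinations \<Psi>"
  shows "f + k *\<^sub>C g \<in> finite_combinations \<Psi>"
proof -
  obtain F c where f: "finite F" "f = (\<Sum>j\<in>F. c j *\<^sub>C \<Psi> j)"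
    using assms(1) unfolding finite_combinations_def by blast
  obtain F' c' where g: "finite F'" "g = (\<Sum>j\<in>F'. c' j *\<^sub>C \<Psi> j)"
    using assms(2) unfolding finite_combinations_def by blast
  let ?e = "\<lambda>c F j. if j \<in> F then c j else (0::complex)"
  have *: "(\<Sum>j\<in>F. c j *\<^sub>C \<Psi> j) = (\<Sum>j\<in>F''. ?e c F j *\<^sub>C \<Psi> j)" if "finite F''" "F \<subseteq> F''" for F F'' c
  proof -
    have "(\<Sum>j\<in>F. ?e c F j *\<^sub>C \<Psi> j) = (\<Sum>j\<in>F''. ?e c F j *\<^sub>C \<Psi> j)"
      by (rule sum.mono_neutral_left[OF that]) simp
    then show ?thesis by simp
  qed
  have "f + k *\<^sub>C g = (\<Sum>j\<in>F \<union> F'. (?e c F j + k * ?e c' F' j) *\<^sub>C \<Psi> j)"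
    unfolding f(2) g(2) using f(1) g(1) *[of "F \<union> F'" F c] *[of "F \<union> F'" F' c']
    by (simp add: scaleC_add_left sum.distrib scaleC_sum_right scaleC_scaleC)
  then show ?thesis
    unfolding finite_combinations_def using f(1) g(1)
    by (intro CollectI exI[of _ "F \<union> F'"] exI[of _ "\<lambda>j. ?e c F j + k * ?e c' F' j"]) simp
qed

lemma partial_synthesis:
  shows "partial_synthesis c n \<in> finite_combinations \<Psi>"
    and "coef (partial_synthesis c n) = mat_vec P (truncate n c)"
proof -
  show "partial_synthesis c n \<in> finite_combinations \<Psi>"
    unfolding partial_synthesis_def finite_combinations_def using finite_to_nat_less by blast
  show "coef (partial_synthesis c n) = mat_vec P (truncate n c)"
    unfolding partial_synthesis_def analysis_finite_combination[OF finite_to_nat_less]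
    by (simp add: truncate_def[abs_def])
qed

subsection \<open>The case of summable coefficients\<close>

text \<open>Completeness of \<open>\<ell>\<^sup>1\<^sub>w\<close> turns the Cauchy condition into convergence of the coefficients.\<close>

lemma seqs_1_iff:
  "f \<in> S1 \<longleftrightarrow> (\<forall>n. f n \<in> finite_combinations \<Psi>) \<and>
    (\<exists>c. l1_summable w c \<and> l1_conv w (\<lambda>n. coef (f n)) c)"
proof
  assume f: "f \<in> S1"
  then have fin: "\<And>n. f n \<in> finite_combinations \<Psi>"
    and cauchy: "\<And>e. e > 0 \<Longrightarrow> \<exists>M. \<forall>m\<ge>M. \<forall>n\<ge>M. lp_norm 1 w (coef (f m - f n)) < e"
    unfolding coorbit_seqs_def by auto
  have s: "l1_summable w (coef (f n))" for n by (rule finite_combination_coeffs(1)[OF fin])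
  have diff: "coef (f m - f n) = (\<lambda>i. coef (f m) i - coef (f n) i)" for m n
    by (intro ext) (rule analysis_diff')
  have nrm: "lp_norm 1 w (coef (f m - f n)) =
      ennreal (l1_norm w (\<lambda>i. coef (f m) i - coef (f n) i))" for m n
    unfolding diff using lp_norm_1[of w, OF w_pos] l1_diff[of w, OF w_pos s s] by simp
  have "\<exists>c. l1_summable w c \<and> l1_conv w (\<lambda>n. coef (f n)) c"
  proof (rule l1_complete[of w, OF w_pos s])
    fix e :: real assume "e > 0"
    then obtain M where "\<forall>m\<ge>M. \<forall>n\<ge>M. lp_norm 1 w (coef (f m - f n)) < ennreal e"
      using cauchy[of "ennreal e"] by auto
    then show "\<exists>M. \<forall>m\<ge>M. \<forall>n\<ge>M. l1_norm w (\<lambda>i. coef (f m) i - coef (f n) i) < e"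
      unfolding nrm using l1_norm_nonneg[of w, OF w_pos] by (auto simp: ennreal_less_iff)
  qed
  then show "(\<forall>n. f n \<in> finite_combinations \<Psi>) \<and>
    (\<exists>c. l1_summable w c \<and> l1_conv w (\<lambda>n. coef (f n)) c)" using fin by blast
next
  assume asm: "(\<forall>n. f n \<in> finite_combinations \<Psi>) \<and>
    (\<exists>c. l1_summable w c \<and> l1_conv w (\<lambda>n. coef (f n)) c)"
  then obtain c where fin: "\<And>n. f n \<in> finite_combinations \<Psi>" and c: "l1_summable w c"
    and conv: "l1_conv w (\<lambda>n. coef (f n)) c" by blast
  let ?D = "\<lambda>n i. coef (f n) i - c i"
  have D: "l1_summable w (?D n)" for n using conv unfolding l1_conv_def by blast
  have "\<exists>M. \<forall>m\<ge>M. \<forall>n\<ge>M. lp_norm 1 w (coef (f m - f n)) < e" if e: "e > 0" for e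
  proof -
    obtain \<epsilon> where \<epsilon>: "0 < \<epsilon>" "ennreal \<epsilon> \<le> e"
    proof (cases e)
      case (real r)
      then show ?thesis using e that[of r] by auto
    next
      case top
      then show ?thesis using that[of 1] by auto
    qed
    have "(\<lambda>n. l1_norm w (?D n)) \<longlonglongrightarrow> 0" using conv unfolding l1_conv_def by blast
    then have "\<forall>\<^sub>F n in sequentially. l1_norm w (?D n) < \<epsilon> / 2" using \<epsilon>(1) by (intro order_tendstoD(2)) auto
    then obtain M where M: "\<And>n. n \<ge> M \<Longrightarrow> l1_norm w (?D n) < \<epsilon> / 2" by (auto simp: eventually_sequentially)
    have "lp_norm 1 w (coef (f m - f n)) < e" if "m \<ge> M" "n \<ge> M" for m n
    proof -
      have eq: "coef (f m - f n) = (\<lambda>i. ?D m i + (- 1) * ?D n i)"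
        by (intro ext) (simp add: analysis_diff')
      note sc = l1_scale[OF D[of n], of "-1"]
      have "l1_norm w (coef (f m - f n)) \<le> l1_norm w (?D m) + l1_norm w (?D n)"
        unfolding eq using l1_add(2)[of w, OF w_pos D[of m] sc(1)] sc(2) by simp
      then have "l1_norm w (coef (f m - f n)) < \<epsilon>"
        using M[OF that(1)] M[OF that(2)] by linarith
      moreover have "l1_summable w (coef (f m - f n))"
        unfolding eq by (rule l1_add(1)[of w, OF w_pos D[of m] sc(1)])
      ultimately have "lp_norm 1 w (coef (f m - f n)) < ennreal \<epsilon>"
        using lp_norm_1[of w, OF w_pos] l1_norm_nonneg[of w, OF w_pos] by (simp add: ennreal_less_iff)
      then show ?thesis using \<epsilon>(2) by (rule less_le_trans)
    qed
    then show ?thesis by blast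
  qed
  then show "f \<in> S1" unfolding coorbit_seqs_def using fin by simp
qed

lemma seqs_1:
  assumes f: "f \<in> S1"
  shows "l1_summable w (limc f)" and "l1_conv w (\<lambda>n. coef (f n)) (limc f)"
    and "convergent (\<lambda>n. coef (f n) i)" and "mat_vec P (limc f) = limc f"
    and "lim_coeffs \<Psi> f = mat_vec G (limc f)"
proof -
  obtain c where fin: "\<And>n. f n \<in> finite_combinations \<Psi>" and c: "l1_summable w c"
    and conv: "l1_conv w (\<lambda>n. coef (f n)) c" using f unfolding seqs_1_iff by blast
  note coeff = l1_conv_coeff[of w, OF w_pos]
  show "convergent (\<lambda>n. coef (f n) i)" using coeff[OF conv] convergent_def by blast
  have c_eq: "limc f = c" unfolding lim_coeffs_def using coeff[OF conv] limI by blast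
  show "l1_summable w (limc f)" "l1_conv w (\<lambda>n. coef (f n)) (limc f)"
    unfolding c_eq by (fact c, fact conv)
  have P: "mat_vec P (coef (f n)) = coef (f n)"
    and G: "mat_vec G (coef (f n)) = analysis \<Psi> (f n)" for n
    using finite_combination_coeffs(2)[OF fin, of n] reproduce reproduce_gram by blast+
  have "(\<lambda>n. coef (f n) i) \<longlonglongrightarrow> mat_vec P c i" for i
    using coeff[OF l1_conv_mat_vec[OF schur_P conv c]] by (simp add: P)
  then show "mat_vec P (limc f) = limc f"
    unfolding c_eq using coeff[OF conv] LIMSEQ_unique by blast
  have "(\<lambda>n. analysis \<Psi> (f n) i) \<longlonglongrightarrow> mat_vec G c i" for i
    using coeff[OF l1_conv_mat_vec[OF schur_G conv c]] by (simp add: G)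
  then show "lim_coeffs \<Psi> f = mat_vec G (limc f)"
    unfolding c_eq lim_coeffs_def using limI by blast
qed

sublocale one: coefficient_classes "S1" "R1" \<Phi>
proof
  fix f g :: "nat \<Rightarrow> 'a" and i and k :: complex
  show "f \<in> S1 \<Longrightarrow> convergent (\<lambda>n. coef (f n) i)" by (rule seqs_1(3))
  have lin: "(\<lambda>n. f n + k *\<^sub>C g n) \<in> S1"
    if f: "f \<in> S1" and g: "g \<in> S1" for f g k
  proof -
    let ?c = "limc f" and ?d = "limc g"
    let ?L = "\<lambda>n i. coef (f n + k *\<^sub>C g n) i - (?c i + k * ?d i)"
    have eq: "?L n = (\<lambda>i. (coef (f n) i - ?c i) + k * (coef (g n) i - ?d i))" for n
      by (intro ext) (simp add: analysis_add' analysis_scaleC' algebra_simps)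
    have sf: "l1_summable w (\<lambda>i. coef (f n) i - ?c i)" and sg: "l1_summable w (\<lambda>i. coef (g n) i - ?d i)"
      for n using seqs_1(2)[OF f] seqs_1(2)[OF g] unfolding l1_conv_def by auto
    note L = l1_add[of w, OF w_pos sf l1_scale(1)[OF sg, where a = k]]
    have lim: "(\<lambda>n. l1_norm w (\<lambda>i. coef (f n) i - ?c i) + cmod k * l1_norm w (\<lambda>i. coef (g n) i - ?d i)) \<longlonglongrightarrow> 0"
      using seqs_1(2)[OF f] seqs_1(2)[OF g] unfolding l1_conv_def
      by (intro tendsto_add_zero tendsto_mult_right_zero) auto
    have le: "norm (l1_norm w (?L n)) \<le>
        l1_norm w (\<lambda>i. coef (f n) i - ?c i) + cmod k * l1_norm w (\<lambda>i. coef (g n) i - ?d i)" for n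
      using L(2)[of n n] l1_norm_nonneg[of w, OF w_pos] unfolding eq l1_scale(2)[OF sg] by simp
    have "(\<lambda>n. l1_norm w (?L n)) \<longlonglongrightarrow> 0"
      by (rule Lim_null_comparison[OF always_eventually[OF allI[OF le]] lim])
    then have "l1_conv w (\<lambda>n. coef (f n + k *\<^sub>C g n)) (\<lambda>i. ?c i + k * ?d i)"
      unfolding l1_conv_def eq using L(1) by blast
    moreover have "l1_summable w (\<lambda>i. ?c i + k * ?d i)"
      by (intro l1_add(1)[of w, OF w_pos] l1_scale(1) seqs_1(1) f g)
    ultimately show ?thesis
      using f g finite_combination_add_scaleC unfolding seqs_1_iff by blast
  qed
  show "f \<in> S1 \<Longrightarrow> g \<in> S1 \<Longrightarrow> (\<lambda>n. f n + g n) \<in> S1"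
    using lin[of f g 1] by simp
  show "f \<in> S1 \<Longrightarrow> (\<lambda>n. k *\<^sub>C f n) \<in> S1"
    using lin[of f f "k - 1"] by (simp add: scaleC_add_left[of 1 "k - 1", simplified, symmetric])
  show "(f, g) \<in> R1 \<longleftrightarrow> f \<in> S1 \<and> g \<in> S1 \<and>
      limc f = limc g"
  proof (cases "f \<in> S1 \<and> g \<in> S1")
    case False
    then show ?thesis unfolding coorbit_rel_def by auto
  next
    case True
    then have f: "f \<in> S1" and g: "g \<in> S1" by auto
    have "(\<lambda>n. f n + (- 1) *\<^sub>C g n) \<in> S1" by (rule lin[OF f g])
    then have h: "(\<lambda>n. f n - g n) \<in> S1" by (simp add: scaleC_minus_one)
    have lim_h: "limc (\<lambda>n. f n - g n) = (\<lambda>i. limc f i - limc g i)"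
    proof
      fix i
      have "(\<lambda>n. coef (f n - g n) i) \<longlonglongrightarrow> limc f i - limc g i"
        unfolding analysis_diff' by (intro tendsto_diff l1_conv_coeff[of w, OF w_pos] seqs_1(2) f g)
      then show "limc (\<lambda>n. f n - g n) i = limc f i - limc g i"
        unfolding lim_coeffs_def[of \<Phi> "\<lambda>n. f n - g n"] by (rule limI)
    qed
    have s: "l1_summable w (coef (f n - g n))" for n
      using h finite_combination_coeffs(1) unfolding seqs_1_iff by blast
    have "(\<lambda>n. lp_norm 1 w (coef (f n - g n))) \<longlonglongrightarrow> 0 \<longleftrightarrow>
        (\<lambda>n. ennreal (l1_norm w (coef (f n - g n)))) \<longlonglongrightarrow> ennreal 0"
      using lp_norm_1[of w, OF w_pos] s by simp
    also have "\<dots> \<longleftrightarrow> (\<lambda>n. l1_norm w (coef (f n - g n))) \<longlonglongrightarrow> 0"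
      using l1_norm_nonneg[of w, OF w_pos] by (intro tendsto_ennreal_iff) auto
    also have "\<dots> \<longleftrightarrow> l1_conv w (\<lambda>n. coef (f n - g n)) (\<lambda>_. 0)"
      using s by (simp add: l1_conv_def)
    also have "\<dots> \<longleftrightarrow> limc (\<lambda>n. f n - g n) = (\<lambda>_. 0)"
    proof
      assume *: "l1_conv w (\<lambda>n. coef (f n - g n)) (\<lambda>_. 0)"
      show "limc (\<lambda>n. f n - g n) = (\<lambda>_. 0)"
        unfolding lim_coeffs_def using limI[OF l1_conv_coeff[of w, OF w_pos *]] by simp
    next
      assume "limc (\<lambda>n. f n - g n) = (\<lambda>_. 0)"
      then show "l1_conv w (\<lambda>n. coef (f n - g n)) (\<lambda>_. 0)" using seqs_1(2)[OF h] by simp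
    qed
    also have "\<dots> \<longleftrightarrow> limc f = limc g"
      unfolding lim_h fun_eq_iff by simp
    finally show ?thesis using f g unfolding coorbit_rel_def by simp
  qed
qed

lemma coorbit_1_coeffs:
  assumes X: "X \<in> coorbit_wrt 1 \<Psi> \<Phi> w"
  shows "l1_summable w (ext X)" and "mat_vec P (ext X) = ext X"
    and "ext_analysis \<Psi> X = mat_vec G (ext X)"
proof -
  have X': "X \<in> S1 // R1" using X unfolding coorbit_wrt_def .
  let ?f = "SOME f. f \<in> X"
  have f: "?f \<in> S1" and eq: "ext X = limc ?f"
    by (rule one.class_member[OF X' one.class_some[OF X']])+
  show "l1_summable w (ext X)" "mat_vec P (ext X) = ext X"
    unfolding eq by (rule seqs_1[OF f])+
  have "ext_analysis \<Psi> X = lim_coeffs \<Psi> ?f" by (intro ext) (simp add: ext_analysis_def lim_coeffs_def)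
  then show "ext_analysis \<Psi> X = mat_vec G (ext X)" unfolding eq by (simp add: seqs_1(5)[OF f])
qed

text \<open>Every coefficient family in the range of \<open>P\<close> occurs: synthesise the truncations of \<open>c\<close>.\<close>

lemma coorbit_1_exists:
  assumes c: "l1_summable w c"
  shows "\<exists>X\<in>coorbit_wrt 1 \<Psi> \<Phi> w. ext X = mat_vec P c"
proof -
  have conv: "l1_conv w (\<lambda>n. coef (partial_synthesis c n)) (mat_vec P c)"
    unfolding partial_synthesis(2) by (rule l1_conv_mat_vec[OF schur_P l1_conv_truncate[of w, OF w_pos c] c])
  then have f: "partial_synthesis c \<in> S1"
    unfolding seqs_1_iff using partial_synthesis(1) schur_l1(1)[OF schur_P c] by blast
  have "limc (partial_synthesis c) = mat_vec P c"
    unfolding lim_coeffs_def using l1_conv_coeff[of w, OF w_pos conv] limI by blast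
  then show ?thesis
    using one.ext_analysis_class[OF f] quotientI[OF f, of "R1"]
    unfolding coorbit_wrt_def by auto
qed

subsection \<open>The case of bounded coefficients\<close>

lemma seqs_inf_iff:
  "f \<in> Sinf \<longleftrightarrow> (\<forall>i. convergent (\<lambda>n. coef (f n) i)) \<and>
    (\<exists>M\<ge>0. \<forall>n i. cmod (coef (f n) i) \<le> M * w i)"
proof -
  have "(SUP n. lp_norm \<infinity> v (coef (f n))) < \<infinity> \<longleftrightarrow>
      (\<exists>M\<ge>0. \<forall>n i. cmod (coef (f n) i) \<le> M * w i)" (is "?S < \<infinity> \<longleftrightarrow> ?R")
  proof
    assume "?S < \<infinity>"
    then obtain M where M: "?S = ennreal M" "M \<ge> 0"
      unfolding infinity_ennreal_def less_top_ennreal by blast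
    have "lp_norm \<infinity> v (coef (f n)) \<le> ennreal M" for n
      unfolding M(1)[symmetric] by (rule SUP_upper) simp
    then show ?R using lp_norm_inf_le_iff[of w, OF w_pos M(2)] M(2) by blast
  next
    assume ?R
    then obtain M where M: "M \<ge> 0" "\<forall>n i. cmod (coef (f n) i) \<le> M * w i" by blast
    then have "?S \<le> ennreal M" using lp_norm_inf_le_iff[of w, OF w_pos M(1)] by (intro SUP_least) blast
    then show "?S < \<infinity>" by (rule le_less_trans) simp
  qed
  then show ?thesis unfolding coorbit_seqs_def by simp
qed

lemma seqs_inf:
  assumes f: "f \<in> Sinf"
  shows "(\<lambda>n. coef (f n) i) \<longlonglongrightarrow> limc f i"
    and "\<exists>M\<ge>0. \<forall>i. cmod (limc f i) \<le> M * w i"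
    and "mat_vec P (limc f) = limc f"
proof -
  obtain M where M: "M \<ge> 0" "\<And>n i. cmod (coef (f n) i) \<le> M * w i"
    using f unfolding seqs_inf_iff by blast
  show lim: "(\<lambda>n. coef (f n) i) \<longlonglongrightarrow> limc f i" for i
    using f unfolding seqs_inf_iff lim_coeffs_def convergent_LIMSEQ_iff by blast
  have "cmod (limc f i) \<le> M * w i" for i
    by (rule tendsto_upperbound[OF tendsto_norm[OF lim]]) (use M in auto)
  then show "\<exists>M\<ge>0. \<forall>i. cmod (limc f i) \<le> M * w i" using M(1) by blast
  have "mat_vec P (coef (f n)) = coef (f n)" for n using reproduce M(2) by blast
  then have "(\<lambda>n. coef (f n) i) \<longlonglongrightarrow> mat_vec P (limc f) i" for i
    using schur_dominated_convergence[OF schur_P M(2) lim, of i] by simp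
  then show "mat_vec P (limc f) = limc f" using lim LIMSEQ_unique by blast
qed

sublocale inf: coefficient_classes "Sinf" "Rinf" \<Phi>
proof
  fix f g :: "nat \<Rightarrow> 'a" and i and k :: complex
  let ?S = Sinf
  show "f \<in> ?S \<Longrightarrow> convergent (\<lambda>n. coef (f n) i)" unfolding seqs_inf_iff by blast
  show "(\<lambda>n. f n + g n) \<in> ?S" if f: "f \<in> ?S" and g: "g \<in> ?S"
  proof -
    obtain M where M: "M \<ge> 0" "\<And>n i. cmod (coef (f n) i) \<le> M * w i"
      using f unfolding seqs_inf_iff by blast
    obtain L where L: "L \<ge> 0" "\<And>n i. cmod (coef (g n) i) \<le> L * w i"
      using g unfolding seqs_inf_iff by blast
    have "cmod (coef (f n + g n) i) \<le> (M + L) * w i" for n i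
      unfolding analysis_add' using norm_triangle_ineq[of "coef (f n) i" "coef (g n) i"] M(2)[of n i] L(2)[of n i]
      by (simp add: distrib_right)
    moreover have "convergent (\<lambda>n. coef (f n + g n) i)" for i
      unfolding analysis_add' using f g unfolding seqs_inf_iff by (intro convergent_add) auto
    ultimately show ?thesis
      unfolding seqs_inf_iff using M(1) L(1) by (intro conjI allI exI[of _ "M + L"]) auto
  qed
  show "(\<lambda>n. k *\<^sub>C f n) \<in> ?S" if f: "f \<in> ?S"
  proof -
    obtain M where M: "M \<ge> 0" "\<And>n i. cmod (coef (f n) i) \<le> M * w i"
      using f unfolding seqs_inf_iff by blast
    have "cmod (coef (k *\<^sub>C f n) i) \<le> (cmod k * M) * w i" for n i
      unfolding analysis_scaleC' norm_mult using mult_left_mono[OF M(2)[of n i], of "cmod k"] by (simp add: mult.assoc)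
    moreover have "convergent (\<lambda>n. coef (k *\<^sub>C f n) i)" for i
      unfolding analysis_scaleC' using f unfolding seqs_inf_iff by (intro convergent_mult convergent_const) auto
    ultimately show ?thesis
      unfolding seqs_inf_iff using M(1) by (intro conjI allI exI[of _ "cmod k * M"]) auto
  qed
  show "(f, g) \<in> Rinf \<longleftrightarrow> f \<in> ?S \<and> g \<in> ?S \<and> limc f = limc g"
  proof (cases "f \<in> ?S \<and> g \<in> ?S")
    case False
    then show ?thesis unfolding coorbit_rel_def by auto
  next
    case True
    have "(\<lambda>n. coef (f n - g n) i) \<longlonglongrightarrow> limc f i - limc g i" for i
      unfolding analysis_diff' using True by (intro tendsto_diff seqs_inf(1)) auto
    then have "(\<forall>i. (\<lambda>n. coef (f n - g n) i) \<longlonglongrightarrow> 0) \<longleftrightarrow> (\<forall>i. limc f i - limc g i = 0)"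
      using LIMSEQ_unique by metis
    then show ?thesis using True unfolding coorbit_rel_def by (auto simp: fun_eq_iff)
  qed
qed

lemma coorbit_inf_coeffs:
  assumes X: "X \<in> coorbit_wrt \<infinity> \<Psi> \<Phi> v"
  shows "\<exists>M\<ge>0. \<forall>i. cmod (ext X i) \<le> M * w i"
    and "mat_vec P (ext X) = ext X"
proof -
  have X': "X \<in> Sinf // Rinf" using X unfolding coorbit_wrt_def .
  let ?f = "SOME f. f \<in> X"
  have f: "?f \<in> Sinf" and eq: "ext X = limc ?f"
    by (rule inf.class_member[OF X' inf.class_some[OF X']])+
  show "\<exists>M\<ge>0. \<forall>i. cmod (ext X i) \<le> M * w i" "mat_vec P (ext X) = ext X"
    unfolding eq by (rule seqs_inf[OF f])+
qed

text \<open>In general, truncations of a bounded family do not converge in norm, but they converge boundedly and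
coefficientwise, and so do their images under \<open>P\<close>.\<close>

lemma coorbit_inf_exists:
  assumes d: "\<And>i. cmod (d i) \<le> M * w i"
  shows "\<exists>X\<in>coorbit_wrt \<infinity> \<Psi> \<Phi> v. ext X = mat_vec P d"
proof -
  have t: "cmod (truncate n d i) \<le> M * w i" for n i
    using order_trans[OF cmod_truncate_le d] .
  have lim: "(\<lambda>n. coef (partial_synthesis d n) i) \<longlonglongrightarrow> mat_vec P d i" for i
    unfolding partial_synthesis(2) by (rule schur_dominated_convergence[OF schur_P t truncate_tendsto])
  have M: "0 \<le> M" for i :: 'i
    using order_trans[OF norm_ge_zero d[of i]] w_pos[of i] by (simp add: zero_le_mult_iff less_le_not_le)
  have "cmod (coef (partial_synthesis d n) i) \<le> (B * M) * w i" for n i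
    unfolding partial_synthesis(2) using schur_bounded(3)[OF schur_P t] by simp
  then have f: "partial_synthesis d \<in> Sinf"
    unfolding seqs_inf_iff using lim M schur_const_nonneg[OF schur_P]
    by (intro conjI allI exI[of _ "B * M"]) (auto simp: convergent_def)
  have "limc (partial_synthesis d) = mat_vec P d"
    unfolding lim_coeffs_def using lim limI by blast
  then show ?thesis
    using inf.ext_analysis_class[OF f] quotientI[OF f, of "Rinf"]
    unfolding coorbit_wrt_def by auto
qed

end

section \<open>Localised frames give coefficient systems\<close>

text \<open>The matrix identities that hold when \<open>\<Phi>\<close> is the canonical dual; the Gram matrix of the dual is the
pseudo-inverse of \<open>gram \<Psi>\<close> and the cross Gram matrix is the projection onto the common range.\<close>

locale dual_system = coefficient_system \<Psi> "dual_frame \<Psi>" w B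
  for \<Psi> :: "'i::countable \<Rightarrow> 'a::complex_inner" and w B +
  assumes schur_D: "schur w B (gram (dual_frame \<Psi>))"
    and P_P: "mat_mult (cross_gram \<Psi> (dual_frame \<Psi>)) (cross_gram \<Psi> (dual_frame \<Psi>)) = cross_gram \<Psi> (dual_frame \<Psi>)"
    and D_G: "mat_mult (gram (dual_frame \<Psi>)) (gram \<Psi>) = cross_gram \<Psi> (dual_frame \<Psi>)"
    and G_D: "mat_mult (gram \<Psi>) (gram (dual_frame \<Psi>)) = cross_gram \<Psi> (dual_frame \<Psi>)"
    and P_D: "mat_mult (cross_gram \<Psi> (dual_frame \<Psi>)) (gram (dual_frame \<Psi>)) = gram (dual_frame \<Psi>)"
    and D_P: "mat_mult (gram (dual_frame \<Psi>)) (cross_gram \<Psi> (dual_frame \<Psi>)) = gram (dual_frame \<Psi>)"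
    and reconstruction: "\<And>x. ((\<lambda>i. cinner x (\<Psi> i) *\<^sub>C dual_frame \<Psi> i) has_sum x) UNIV"

lemma gram_hermitian: "gram \<Psi> j i = cnj (gram \<Psi> i j)"
  unfolding gram_def by (rule cinner_commute)

lemma localised_frame_dual_system:
  fixes \<Psi> :: "'i::countable \<Rightarrow> 'a::complex_hilbert"
  assumes A: "spectral_matrix_algebra \<A> N" and loc: "localised_frame \<A> \<Psi>" and w: "admissible_weight \<A> w"
  shows "\<exists>B. dual_system \<Psi> w B"
proof -
  obtain a b where ab: "a > 0" "b > 0" and fr: "\<And>f. (\<lambda>i. (cmod (cinner f (\<Psi> i)))\<^sup>2) summable_on UNIV \<and>
      a * (norm f)\<^sup>2 \<le> (\<Sum>\<^sub>\<infinity>i. (cmod (cinner f (\<Psi> i)))\<^sup>2) \<and>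
      (\<Sum>\<^sub>\<infinity>i. (cmod (cinner f (\<Psi> i)))\<^sup>2) \<le> b * (norm f)\<^sup>2"
    using loc unfolding localised_frame_def is_frame_def by blast
  have "hilbert_frame \<Psi> a b"
    by unfold_locales (use ab fr in \<open>auto simp: l2_summable_def analysis_def\<close>)
  then have loc_frame: "localised_hilbert_frame \<Psi> a b \<A> N"
    using A loc unfolding localised_hilbert_frame_def localised_hilbert_frame_axioms_def localised_frame_def by blast
  interpret localised_hilbert_frame \<Psi> a b \<A> N by (rule loc_frame)
  note Wb = bclinear_inv_frame_op
  have WWb: "bclinear (\<lambda>x. W (W x))" by (rule bclinear_compose[OF Wb Wb])
  let ?P = "cross_gram \<Psi> (dual_frame \<Psi>)" and ?D = "gram (dual_frame \<Psi>)"
  have P: "?P = op_matrix 0 W"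
    by (intro ext) (simp add: cross_gram_def op_matrix_def dual_frame_eq cinner_inv_frame_op)
  have D: "?D = op_matrix 0 (\<lambda>x. W (W x))"
    by (intro ext) (simp add: gram_def op_matrix_def dual_frame_eq cinner_inv_frame_op)
  have P_herm: "?P j i = cnj (?P i j)" for i j
    unfolding cross_gram_def dual_frame_eq
    by (metis cinner_commute cinner_inv_frame_op)
  have P_mem: "?P \<in> \<A>" and D_mem: "?D \<in> \<A>"
    unfolding P D by (rule projection_mem, rule dual_gram_mem)
  obtain B1 where B1: "schur w B1 (?P)"
    using admissible_imp_schur[OF w P_mem P_herm] by blast
  obtain B2 where B2: "schur w B2 (gram \<Psi>)"
    using admissible_imp_schur[OF w gram_mem gram_hermitian] by blast
  obtain B3 where B3: "schur w B3 (?D)"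
    using admissible_imp_schur[OF w D_mem gram_hermitian] by blast
  define B where "B = max B1 (max B2 B3)"
  have repr: "((\<lambda>j. cinner (\<Psi> j) x * cinner f (dual_frame \<Psi> j)) has_sum cinner f x) UNIV" for f x
  proof -
    have "((\<lambda>j. cinner f (cinner x (\<Psi> j) *\<^sub>C dual_frame \<Psi> j)) has_sum cinner f x) UNIV"
      by (rule has_sum_bounded_linear[OF bounded_linear_cinner_right reconstruction_dual])
    moreover have "cinner f (cinner x (\<Psi> j) *\<^sub>C dual_frame \<Psi> j) = cinner (\<Psi> j) x * cinner f (dual_frame \<Psi> j)" for j
      unfolding cinner_scaleC_right by (metis cinner_commute)
    ultimately show ?thesis by simp
  qed
  have "dual_system \<Psi> w B"
  proof unfold_locales
    show "schur w B (?P)" "schur w B (gram \<Psi>)"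
      "schur w B (?D)"
      using schur_mono[OF B1] schur_mono[OF B2] schur_mono[OF B3]
      by (auto simp: B_def)
    show "mat_vec (?P) (analysis (dual_frame \<Psi>) f) = analysis (dual_frame \<Psi>) f" for f
      by (intro ext) (use infsumI[OF repr] in \<open>simp add: mat_vec_def cross_gram_def analysis_def\<close>)
    show "mat_vec (gram \<Psi>) (analysis (dual_frame \<Psi>) f) = analysis \<Psi> f" for f
      by (intro ext) (use infsumI[OF repr] in \<open>simp add: mat_vec_def gram_def analysis_def\<close>)
    show "mat_mult (?P) (?P) = ?P"
      unfolding P mat_mult_op_matrix[OF Wb Wb] by simp
    show "mat_mult (?D) (gram \<Psi>) = ?P"
      unfolding P D gram_eq_op_matrix mat_mult_op_matrix[OF WWb bclinear_ident] by simp
    show "mat_mult (gram \<Psi>) (?D) = ?P"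
      unfolding P D gram_eq_op_matrix mat_mult_op_matrix[OF bclinear_ident WWb] by simp
    show "mat_mult (?P) (?D) = ?D"
      unfolding P D mat_mult_op_matrix[OF Wb WWb] by simp
    show "mat_mult (?D) (?P) = ?D"
      unfolding P D mat_mult_op_matrix[OF WWb Wb] by simp
    show "((\<lambda>i. cinner x (\<Psi> i) *\<^sub>C dual_frame \<Psi> i) has_sum x) UNIV" for x
      by (rule reconstruction_dual)
  qed
  then show ?thesis by blast
qed

section \<open>Tensor products\<close>

lemma rank_one_add_left: "rank_one (f + f') g = rank_one f g + rank_one f' g"
  by transfer (simp add: cinner_add_right scaleC_add_left)

lemma rank_one_add_right: "rank_one f (g + g') = rank_one f g + rank_one f g'"
  by transfer (simp add: scaleC_add_right)

lemma rank_one_scaleC_left: "rank_one (c *\<^sub>C f) g = cnj c *\<^sub>C rank_one f g"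
  by transfer (simp add: cinner_scaleC_right scaleC_scaleC)

lemma rank_one_scaleC_right: "rank_one f (c *\<^sub>C g) = c *\<^sub>C rank_one f g"
  by transfer (simp add: scaleC_scaleC mult.commute)

lemma tensor_scaleC_left: "(c *\<^sub>C f) \<otimes>\<^sub>H g = cnj c *\<^sub>C (f \<otimes>\<^sub>H g)"
  by (simp add: tensor_def rank_one_scaleC_left to_completion_scaleC)

lemma tensor_scaleC_right: "f \<otimes>\<^sub>H (c *\<^sub>C g) = c *\<^sub>C (f \<otimes>\<^sub>H g)"
  by (simp add: tensor_def rank_one_scaleC_right to_completion_scaleC)

lemma norm_tensor: "norm (f \<otimes>\<^sub>H g) = norm f * norm g"
proof -
  have "complex_of_real ((norm (f \<otimes>\<^sub>H g))\<^sup>2) = cnj (cinner f f) * cinner g g"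
    using cinner_tensor[of f g f g] cinner_norm[of "f \<otimes>\<^sub>H g"] by simp
  also have "\<dots> = complex_of_real ((norm f * norm g)\<^sup>2)"
    by (simp add: cinner_norm power_mult_distrib)
  finally have "(norm (f \<otimes>\<^sub>H g))\<^sup>2 = (norm f * norm g)\<^sup>2" using of_real_eq_iff by blast
  then show ?thesis by (simp add: power2_eq_iff_nonneg)
qed

lemma bounded_bilinear_tensor: "bounded_bilinear (\<lambda>f g. f \<otimes>\<^sub>H g)"
proof
  show "(f + f') \<otimes>\<^sub>H g = f \<otimes>\<^sub>H g + f' \<otimes>\<^sub>H g" for f f' :: 'a and g :: 'b
    by (simp add: tensor_def rank_one_add_left to_completion_add)
  show "f \<otimes>\<^sub>H (g + g') = f \<otimes>\<^sub>H g + f \<otimes>\<^sub>H g'" for f :: 'a and g g' :: 'b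
    by (simp add: tensor_def rank_one_add_right to_completion_add)
  show "(r *\<^sub>R f) \<otimes>\<^sub>H g = r *\<^sub>R (f \<otimes>\<^sub>H g)" for r and f :: 'a and g :: 'b
    by (simp add: scaleR_scaleC tensor_scaleC_left)
  show "f \<otimes>\<^sub>H (r *\<^sub>R g) = r *\<^sub>R (f \<otimes>\<^sub>H g)" for r and f :: 'a and g :: 'b
    by (simp add: scaleR_scaleC tensor_scaleC_right)
  show "\<exists>K. \<forall>f g. norm ((f :: 'a) \<otimes>\<^sub>H (g :: 'b)) \<le> norm f * norm g * K"
    by (intro exI[of _ 1]) (simp add: norm_tensor)
qed

text \<open>The first factor is conjugated because \<open>f \<otimes> g\<close> is antilinear in \<open>f\<close>.\<close>

definition tensor_matrix :: "'i matrix \<Rightarrow> 'j matrix \<Rightarrow> ('i \<times> 'j) matrix" where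
  "tensor_matrix A A' = (\<lambda>(i, j) (i', j'). cnj (A i i') * A' j j')"

definition tensor_coeffs :: "('i \<Rightarrow> complex) \<Rightarrow> ('j \<Rightarrow> complex) \<Rightarrow> 'i \<times> 'j \<Rightarrow> complex" where
  "tensor_coeffs c d = (\<lambda>(i, j). cnj (c i) * d j)"

lemma cross_gram_tensor:
  "cross_gram (tensor_family \<Psi> \<Psi>') (tensor_family \<Phi> \<Phi>') = tensor_matrix (cross_gram \<Psi> \<Phi>) (cross_gram \<Psi>' \<Phi>')"
  by (intro ext) (auto simp: cross_gram_def tensor_family_def tensor_matrix_def cinner_tensor)

lemma gram_tensor: "gram (tensor_family \<Psi> \<Psi>') = tensor_matrix (gram \<Psi>) (gram \<Psi>')"
  by (intro ext) (auto simp: gram_def tensor_family_def tensor_matrix_def cinner_tensor)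

text \<open>Absolutely convergent series multiply; this gives the row sums and the images of simple tensors for
\<open>tensor_matrix\<close>.\<close>

lemma infsum_product:
  fixes f :: "'x \<Rightarrow> 'c::{banach, real_normed_field}" and g :: "'y \<Rightarrow> 'c"
  assumes f: "(\<lambda>x. norm (f x)) summable_on UNIV" and g: "(\<lambda>y. norm (g y)) summable_on UNIV"
  shows "(\<lambda>(x, y). norm (f x * g y)) summable_on UNIV"
    and "(\<Sum>\<^sub>\<infinity>(x, y). f x * g y) = (\<Sum>\<^sub>\<infinity>x. f x) * (\<Sum>\<^sub>\<infinity>y. g y)"
proof -
  have inner: "(\<lambda>y. norm (f x * g y)) summable_on UNIV" for x
    unfolding norm_mult by (rule summable_on_cmult_right[OF g])
  have outer: "(\<lambda>x. norm (f x) * (\<Sum>\<^sub>\<infinity>y. norm (g y))) summable_on UNIV"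
    by (rule summable_on_cmult_left[OF f])
  have le: "(\<Sum>\<^sub>\<infinity>y. norm (f x * g y)) \<le> norm (f x) * (\<Sum>\<^sub>\<infinity>y. norm (g y))" for x
    by (simp add: norm_mult infsum_cmult_right')
  show s: "(\<lambda>(x, y). norm (f x * g y)) summable_on UNIV"
    by (rule dominated_Fubini(5)[OF inner outer le])
  have s': "(\<lambda>(x, y). f x * g y) summable_on UNIV \<times> UNIV"
    by (rule abs_summable_summable) (use s in \<open>simp add: case_prod_unfold\<close>)
  show "(\<Sum>\<^sub>\<infinity>(x, y). f x * g y) = (\<Sum>\<^sub>\<infinity>x. f x) * (\<Sum>\<^sub>\<infinity>y. g y)"
    using infsum_Sigma'_banach[OF s'] by (simp add: infsum_cmult_right' infsum_cmult_left')
qed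

lemma schur_tensor:
  fixes A :: "'i matrix" and A' :: "'j matrix"
  assumes A: "schur w B A" and A': "schur w' B' A'"
  shows "schur (tensor_weight w w') (B * B') (tensor_matrix A A')"
  unfolding schur_def
proof (intro conjI allI)
  note w = schur_weight_pos[OF A] and w' = schur_weight_pos[OF A']
  fix p q :: "'i \<times> 'j"
  obtain i j where p: "p = (i, j)" by (cases p)
  show "0 < tensor_weight w w' p" using w w' by (simp add: p tensor_weight_def)
  show "tensor_matrix A A' q p = cnj (tensor_matrix A A' p q)"
    using schur_cnj[OF A, of "fst q" i] schur_cnj[OF A', of "snd q" j]
    by (simp add: p tensor_matrix_def case_prod_unfold)
  let ?f = "\<lambda>i'. cmod (A i i') * w i'" and ?g = "\<lambda>j'. cmod (A' j j') * w' j'"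
  have f: "(\<lambda>i'. norm (?f i')) summable_on UNIV" and g: "(\<lambda>j'. norm (?g j')) summable_on UNIV"
    using schur_row(1)[OF A, of i] schur_row(1)[OF A', of j] w w' by (simp_all add: abs_mult less_imp_le)
  have eq: "(\<lambda>q. cmod (tensor_matrix A A' p q) * tensor_weight w w' q) = (\<lambda>(i', j'). ?f i' * ?g j')"
    by (auto simp: p tensor_matrix_def tensor_weight_def norm_mult mult_ac)
  have "0 \<le> ?f i' * ?g j'" for i' j' using w[of i'] w'[of j'] by simp
  then have eq': "(\<lambda>(i', j'). norm (?f i' * ?g j')) = (\<lambda>(i', j'). ?f i' * ?g j')" by auto
  show "(\<lambda>q. cmod (tensor_matrix A A' p q) * tensor_weight w w' q) summable_on UNIV"
    unfolding eq using infsum_product(1)[OF f g] unfolding eq' .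
  have "(\<Sum>\<^sub>\<infinity>i'. ?f i') * (\<Sum>\<^sub>\<infinity>j'. ?g j') \<le> (B * w i) * (B' * w' j)"
    using schur_row(2)[OF A] schur_row(2)[OF A'] schur_const_nonneg[OF A] w[of i] w'
    by (intro mult_mono infsum_nonneg) (auto simp: less_imp_le)
  then show "(\<Sum>\<^sub>\<infinity>q. cmod (tensor_matrix A A' p q) * tensor_weight w w' q) \<le> B * B' * tensor_weight w w' p"
    unfolding eq infsum_product(2)[OF f g] by (simp add: p tensor_weight_def mult_ac)
qed

lemma l1_summable_tensor:
  assumes w: "\<And>i. 0 < w i" and w': "\<And>j. 0 < w' j" and c: "l1_summable w c" and d: "l1_summable w' d"
  shows "l1_summable (tensor_weight w w') (tensor_coeffs c d)"
proof -
  have f: "(\<lambda>i. norm (cmod (c i) * w i)) summable_on UNIV" and g: "(\<lambda>j. norm (cmod (d j) * w' j)) summable_on UNIV"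
    using c d w w' by (simp_all add: l1_summable_def abs_mult less_imp_le)
  have "(\<lambda>(i, j). norm (cmod (c i) * w i * (cmod (d j) * w' j))) =
      (\<lambda>p. cmod (tensor_coeffs c d p) * tensor_weight w w' p)"
    using w w' by (auto simp: tensor_coeffs_def tensor_weight_def norm_mult abs_mult less_imp_le mult_ac)
  then show ?thesis using infsum_product(1)[OF f g] by (simp add: l1_summable_def)
qed

lemma mat_vec_tensor:
  fixes A :: "'i matrix" and A' :: "'j matrix"
  assumes A: "schur w B A" and A': "schur w' B' A'"
    and c: "l1_summable w c" and d: "l1_summable w' d"
  shows "mat_vec (tensor_matrix A A') (tensor_coeffs c d) = tensor_coeffs (mat_vec A c) (mat_vec A' d)"
proof
  fix p :: "'i \<times> 'j"
  obtain i j where p: "p = (i, j)" by (cases p)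
  have f: "(\<lambda>i'. norm (cnj (A i i' * c i'))) summable_on UNIV"
    using schur_l1_norms(1)[OF A c, of i] by (simp add: norm_mult)
  note g = schur_l1_norms(1)[OF A' d, of j]
  have "(\<Sum>\<^sub>\<infinity>q. tensor_matrix A A' p q * tensor_coeffs c d q) =
      (\<Sum>\<^sub>\<infinity>(i', j'). cnj (A i i' * c i') * (A' j j' * d j'))"
    by (rule infsum_cong) (auto simp: p tensor_matrix_def tensor_coeffs_def)
  also have "\<dots> = cnj (mat_vec A c i) * mat_vec A' d j"
    unfolding infsum_product(2)[OF f g] by (simp only: infsum_cnj mat_vec_def)
  finally show "mat_vec (tensor_matrix A A') (tensor_coeffs c d) p = tensor_coeffs (mat_vec A c) (mat_vec A' d) p"
    by (simp add: mat_vec_def[of "tensor_matrix A A'"] p tensor_coeffs_def)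
qed

lemma filterlim_rectangles:
  "filterlim (\<lambda>n. {i::'i::countable. to_nat i < n} \<times> {j::'j::countable. to_nat j < n})
    (finite_subsets_at_top UNIV) sequentially"
proof (rule filterlim_finite_subsets_at_top[THEN iffD2], intro allI impI)
  fix X :: "('i \<times> 'j) set" assume X: "finite X \<and> X \<subseteq> UNIV"
  then obtain N where "\<And>p. p \<in> X \<Longrightarrow> to_nat (fst p) < N"
    using finite_nat_set_iff_bounded[of "(\<lambda>p. to_nat (fst p)) ` X"] by auto
  moreover obtain N' where "\<And>p. p \<in> X \<Longrightarrow> to_nat (snd p) < N'"
    using X finite_nat_set_iff_bounded[of "(\<lambda>p. to_nat (snd p)) ` X"] by auto
  ultimately have "X \<subseteq> {i. to_nat i < n} \<times> {j. to_nat j < n}" if "n \<ge> max N N'" for n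
    using that by (auto dest!: bspec subsetD) (fastforce dest: less_le_trans)+
  then show "\<forall>\<^sub>F n in sequentially. finite ({i::'i. to_nat i < n} \<times> {j::'j. to_nat j < n}) \<and>
      X \<subseteq> {i. to_nat i < n} \<times> {j. to_nat j < n} \<and> {i::'i. to_nat i < n} \<times> {j::'j. to_nat j < n} \<subseteq> UNIV"
    by (intro eventually_sequentiallyI[of "max N N'"]) (auto intro!: finite_cartesian_product finite_to_nat_less)
qed

text \<open>The partial sums over rectangles are inner products of \<open>F\<close> with simple tensors of partial sums for
\<open>x\<close> and \<open>y\<close>, so they converge to \<open>\<langle>F, x \<otimes> y\<rangle>\<close> by continuity of the tensor product. When the
double series converges unconditionally, this determines its sum.\<close>

lemma tensor_reproduce:
  fixes \<Psi> \<Phi> :: "'i::countable \<Rightarrow> 'a::complex_inner" and \<Psi>' \<Phi>' :: "'j::countable \<Rightarrow> 'b::complex_inner"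
  assumes x: "((\<lambda>i. cinner x (\<Psi> i) *\<^sub>C \<Phi> i) has_sum x) UNIV"
    and y: "((\<lambda>j. cinner y (\<Psi>' j) *\<^sub>C \<Phi>' j) has_sum y) UNIV"
    and s: "((\<lambda>p. cinner (tensor_family \<Psi> \<Psi>' p) (x \<otimes>\<^sub>H y) * cinner F (tensor_family \<Phi> \<Phi>' p)) has_sum s) UNIV"
  shows "s = cinner F (x \<otimes>\<^sub>H y)"
proof (rule LIMSEQ_unique)
  let ?I = "\<lambda>n. {i::'i. to_nat i < n}" and ?J = "\<lambda>n. {j::'j. to_nat j < n}"
  let ?t = "\<lambda>p. cinner (tensor_family \<Psi> \<Psi>' p) (x \<otimes>\<^sub>H y) * cinner F (tensor_family \<Phi> \<Phi>' p)"
  show "(\<lambda>n. \<Sum>p\<in>?I n \<times> ?J n. ?t p) \<longlonglongrightarrow> s"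
    using filterlim_compose[OF s[unfolded has_sum_def] filterlim_rectangles] .
  have eq: "(\<Sum>p\<in>?I n \<times> ?J n. ?t p) =
      cinner F ((\<Sum>i\<in>?I n. cinner x (\<Psi> i) *\<^sub>C \<Phi> i) \<otimes>\<^sub>H (\<Sum>j\<in>?J n. cinner y (\<Psi>' j) *\<^sub>C \<Phi>' j))" for n
  proof -
    have "cinner F ((cinner x (\<Psi> i) *\<^sub>C \<Phi> i) \<otimes>\<^sub>H (cinner y (\<Psi>' j) *\<^sub>C \<Phi>' j)) = ?t (i, j)" for i j
      unfolding tensor_scaleC_left tensor_scaleC_right cinner_scaleC_right tensor_family_def
      by (simp add: cinner_tensor) (metis cinner_commute mult.assoc mult.commute)
    then show ?thesis
      unfolding bounded_bilinear.sum_left[OF bounded_bilinear_tensor]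
      unfolding bounded_bilinear.sum_right[OF bounded_bilinear_tensor] cinner_sum_right
      by (simp add: sum.cartesian_product case_prod_unfold)
  qed
  show "(\<lambda>n. \<Sum>p\<in>?I n \<times> ?J n. ?t p) \<longlonglongrightarrow> cinner F (x \<otimes>\<^sub>H y)"
    unfolding eq
    by (intro bounded_linear.tendsto[OF bounded_linear_cinner_right]
        bounded_bilinear.tendsto[OF bounded_bilinear_tensor] has_sum_imp_LIMSEQ x y)
qed

lemma tensor_coefficient_system:
  fixes \<Psi> :: "'i::countable \<Rightarrow> 'a::complex_inner" and \<Psi>' :: "'j::countable \<Rightarrow> 'b::complex_inner"
  assumes "dual_system \<Psi> w B" and "dual_system \<Psi>' w' B'"
  shows "coefficient_system (tensor_family \<Psi> \<Psi>') (tensor_family (dual_frame \<Psi>) (dual_frame \<Psi>'))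
    (tensor_weight w w') (B * B')"
proof -
  interpret s1: dual_system \<Psi> w B by fact
  interpret s2: dual_system \<Psi>' w' B' by fact
  let ?\<Psi> = "tensor_family \<Psi> \<Psi>'" and ?\<Phi> = "tensor_family (dual_frame \<Psi>) (dual_frame \<Psi>')"
  have P: "schur (tensor_weight w w') (B * B') (cross_gram ?\<Psi> ?\<Phi>)"
    unfolding cross_gram_tensor by (rule schur_tensor[OF s1.schur_P s2.schur_P])
  have G: "schur (tensor_weight w w') (B * B') (gram ?\<Psi>)"
    unfolding gram_tensor by (rule schur_tensor[OF s1.schur_G s2.schur_G])
  show ?thesis
  proof unfold_locales
    fix F M assume b: "\<And>p. cmod (analysis ?\<Phi> F p) \<le> M * tensor_weight w w' p"
    show "mat_vec (cross_gram ?\<Psi> ?\<Phi>) (analysis ?\<Phi> F) = analysis ?\<Phi> F"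
    proof
      fix p :: "'i \<times> 'j"
      obtain i j where p: "p = (i, j)" by (cases p)
      have "((\<lambda>q. cross_gram ?\<Psi> ?\<Phi> p q * analysis ?\<Phi> F q) has_sum
          mat_vec (cross_gram ?\<Psi> ?\<Phi>) (analysis ?\<Phi> F) p) UNIV"
        unfolding mat_vec_def by (rule has_sum_infsum[OF abs_summable_summable[OF schur_bounded(1)[OF P b]]])
      then have "((\<lambda>q. cinner (?\<Psi> q) (dual_frame \<Psi> i \<otimes>\<^sub>H dual_frame \<Psi>' j) * cinner F (?\<Phi> q)) has_sum
          mat_vec (cross_gram ?\<Psi> ?\<Phi>) (analysis ?\<Phi> F) p) UNIV"
        by (simp add: p cross_gram_def analysis_def tensor_family_def)
      from tensor_reproduce[OF s1.reconstruction s2.reconstruction this]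
      show "mat_vec (cross_gram ?\<Psi> ?\<Phi>) (analysis ?\<Phi> F) p = analysis ?\<Phi> F p"
        by (simp add: p analysis_def tensor_family_def)
    qed
    show "mat_vec (gram ?\<Psi>) (analysis ?\<Phi> F) = analysis ?\<Psi> F"
    proof
      fix p :: "'i \<times> 'j"
      obtain i j where p: "p = (i, j)" by (cases p)
      have "((\<lambda>q. gram ?\<Psi> p q * analysis ?\<Phi> F q) has_sum mat_vec (gram ?\<Psi>) (analysis ?\<Phi> F) p) UNIV"
        unfolding mat_vec_def by (rule has_sum_infsum[OF abs_summable_summable[OF schur_bounded(1)[OF G b]]])
      then have "((\<lambda>q. cinner (?\<Psi> q) (\<Psi> i \<otimes>\<^sub>H \<Psi>' j) * cinner F (?\<Phi> q)) has_sum
          mat_vec (gram ?\<Psi>) (analysis ?\<Phi> F) p) UNIV"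
        by (simp add: p gram_def analysis_def tensor_family_def)
      from tensor_reproduce[OF s1.reconstruction s2.reconstruction this]
      show "mat_vec (gram ?\<Psi>) (analysis ?\<Phi> F) p = analysis ?\<Psi> F p"
        by (simp add: p analysis_def tensor_family_def)
    qed
  qed (fact P, fact G)
qed

section \<open>Kernel theorem\<close>

context dual_system
begin

text \<open>The co-orbit space for \<open>p = 1\<close> is parametrised by \<open>\<ell>\<^sup>1\<^sub>w\<close> through the series
\<open>\<Sum>\<^sub>i g\<^sub>i \<phi>\<^sub>i\<close> in the dual frame, which is called \<open>elem g\<close>.\<close>

abbreviation "D \<equiv> gram (dual_frame \<Psi>)"

lemma coorbit_one: "coorbit 1 \<Psi> w = coorbit_seqs 1 \<Psi> (dual_frame \<Psi>) w // coorbit_rel 1 \<Psi> (dual_frame \<Psi>) w"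
  by (simp add: coorbit_def coorbit_wrt_def)

lemma coorbit_inf: "coorbit \<infinity> \<Psi> v = coorbit_seqs \<infinity> \<Psi> (dual_frame \<Psi>) v // coorbit_rel \<infinity> \<Psi> (dual_frame \<Psi>) v"
  by (simp add: coorbit_def coorbit_wrt_def)

text \<open>The coefficients of \<open>\<Sum>\<^sub>j g\<^sub>j \<phi>\<^sub>j\<close> are \<open>\<Sum>\<^sub>j g\<^sub>j \<langle>\<phi>\<^sub>j, \<phi>\<^sub>i\<rangle> = (D g)\<^sub>i\<close>. In particular
\<open>elem (mat_one i)\<close> represents the dual frame vector \<open>\<phi>\<^sub>i\<close>.\<close>

definition elem :: "('i \<Rightarrow> complex) \<Rightarrow> (nat \<Rightarrow> 'a) set" where
  "elem g = (SOME X. X \<in> coorbit 1 \<Psi> w \<and> ext X = mat_vec D g)"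

lemma elem:
  assumes g: "l1_summable w g"
  shows "elem g \<in> coorbit 1 \<Psi> w" and "ext (elem g) = mat_vec D g"
    and "ext_analysis \<Psi> (elem g) = mat_vec P g"
proof -
  obtain X where X: "X \<in> coorbit 1 \<Psi> w" "ext X = mat_vec P (mat_vec D g)"
    using coorbit_1_exists[OF schur_l1(1)[OF schur_D g]] unfolding coorbit_def by blast
  have "mat_vec P (mat_vec D g) = mat_vec D g"
    by (simp add: mat_vec_assoc_l1[OF schur_P schur_D g] P_D)
  with X have "\<exists>X. X \<in> coorbit 1 \<Psi> w \<and> ext X = mat_vec D g" by auto
  from someI_ex[OF this] show 1: "elem g \<in> coorbit 1 \<Psi> w"
    and 2: "ext (elem g) = mat_vec D g" unfolding elem_def by blast+
  show "ext_analysis \<Psi> (elem g) = mat_vec P g"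
    using coorbit_1_coeffs(3)[of "elem g"] 1 2
    by (simp add: coorbit_def mat_vec_assoc_l1[OF schur_G schur_D g] G_D)
qed

lemma elem_eqI:
  assumes X: "X \<in> coorbit 1 \<Psi> w" and "l1_summable w g" and "ext X = mat_vec D g"
  shows "X = elem g"
  using one.class_eqI[OF X[unfolded coorbit_one] elem(1)[OF assms(2), unfolded coorbit_one]] elem(2)[OF assms(2)] assms(3)
  by simp

text \<open>The expansion \<open>f = \<Sum>\<^sub>i \<langle>f, \<psi>\<^sub>i\<rangle> \<phi>\<^sub>i\<close> in the co-orbit space: in coefficients it reads
\<open>D (G c) = P c = c\<close>.\<close>

lemma coorbit_1_analysis:
  assumes X: "X \<in> coorbit 1 \<Psi> w"
  shows "l1_summable w (ext_analysis \<Psi> X)" and "X = elem (ext_analysis \<Psi> X)"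
    and "ennreal (l1_norm w (ext_analysis \<Psi> X)) \<le> ennreal B * coorbit_norm 1 \<Psi> w X"
proof -
  note c = coorbit_1_coeffs[OF X[unfolded coorbit_def]]
  show s: "l1_summable w (ext_analysis \<Psi> X)" unfolding c(3) by (rule schur_l1(1)[OF schur_G c(1)])
  have "mat_vec D (ext_analysis \<Psi> X) = ext X"
    unfolding c(3) mat_vec_assoc_l1[OF schur_D schur_G c(1)] D_G by (rule c(2))
  then show "X = elem (ext_analysis \<Psi> X)" using elem_eqI[OF X s] by simp
  have "l1_norm w (ext_analysis \<Psi> X) \<le> B * l1_norm w (ext X)"
    unfolding c(3) by (rule schur_l1(2)[OF schur_G c(1)])
  then show "ennreal (l1_norm w (ext_analysis \<Psi> X)) \<le> ennreal B * coorbit_norm 1 \<Psi> w X"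
    unfolding coorbit_norm_def coorbit_norm_wrt_def using c(1) lp_norm_1[of w, OF w_pos]
      schur_const_nonneg[OF schur_G] l1_norm_nonneg[of w, OF w_pos]
    by (simp add: ennreal_mult[symmetric] ennreal_le_iff)
qed

lemma coorbit_norm_elem:
  assumes g: "l1_summable w g"
  shows "coorbit_norm 1 \<Psi> w (elem g) \<le> ennreal (B * l1_norm w g)"
  unfolding coorbit_norm_def coorbit_norm_wrt_def elem(2)[OF g]
  using lp_norm_1[of w, OF w_pos] schur_l1[OF schur_D g] by (simp add: ennreal_leI)

lemma coorbit_add_1:
  assumes "X \<in> coorbit 1 \<Psi> w" and "Y \<in> coorbit 1 \<Psi> w"
  shows "coorbit_add 1 \<Psi> w X Y \<in> coorbit 1 \<Psi> w"
    and "ext (coorbit_add 1 \<Psi> w X Y) =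
      (\<lambda>i. ext X i + ext Y i)"
  using one.class_add[OF assms[unfolded coorbit_one]] by (simp_all add: coorbit_one coorbit_add_def)

lemma coorbit_scale_1:
  assumes "X \<in> coorbit 1 \<Psi> w"
  shows "coorbit_scale 1 \<Psi> w k X \<in> coorbit 1 \<Psi> w"
    and "ext (coorbit_scale 1 \<Psi> w k X) = (\<lambda>i. k * ext X i)"
  using one.class_scale[OF assms[unfolded coorbit_one]] by (simp_all add: coorbit_one coorbit_scale_def)

lemma coorbit_add_inf:
  assumes "X \<in> coorbit \<infinity> \<Psi> v" and "Y \<in> coorbit \<infinity> \<Psi> v"
  shows "coorbit_add \<infinity> \<Psi> v X Y \<in> coorbit \<infinity> \<Psi> v"
    and "ext (coorbit_add \<infinity> \<Psi> v X Y) =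
      (\<lambda>i. ext X i + ext Y i)"
  unfolding coorbit_inf coorbit_add_def using inf.class_add[OF assms[unfolded coorbit_inf]] by simp_all

lemma coorbit_scale_inf:
  assumes "X \<in> coorbit \<infinity> \<Psi> v"
  shows "coorbit_scale \<infinity> \<Psi> v k X \<in> coorbit \<infinity> \<Psi> v"
    and "ext (coorbit_scale \<infinity> \<Psi> v k X) = (\<lambda>i. k * ext X i)"
  unfolding coorbit_inf coorbit_scale_def using inf.class_scale[OF assms[unfolded coorbit_inf]] by simp_all

lemma ext_analysis_add_1:
  assumes "X \<in> coorbit 1 \<Psi> w" and "Y \<in> coorbit 1 \<Psi> w"
  shows "ext_analysis \<Psi> (coorbit_add 1 \<Psi> w X Y) = (\<lambda>i. ext_analysis \<Psi> X i + ext_analysis \<Psi> Y i)"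
  using coorbit_1_coeffs[OF assms(1)[unfolded coorbit_def]] coorbit_1_coeffs[OF assms(2)[unfolded coorbit_def]]
    coorbit_1_coeffs(3)[OF coorbit_add_1(1)[OF assms, unfolded coorbit_def]] coorbit_add_1(2)[OF assms]
  by (simp add: mat_vec_add_l1[OF schur_G])

lemma ext_analysis_scale_1:
  assumes "X \<in> coorbit 1 \<Psi> w"
  shows "ext_analysis \<Psi> (coorbit_scale 1 \<Psi> w k X) = (\<lambda>i. k * ext_analysis \<Psi> X i)"
  using coorbit_1_coeffs(3)[OF assms(1)[unfolded coorbit_def]]
    coorbit_1_coeffs(3)[OF coorbit_scale_1(1)[OF assms, unfolded coorbit_def]] coorbit_scale_1(2)[OF assms]
  by (simp add: mat_vec_scale[OF schur_G])

lemma elem_add: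
  assumes g: "l1_summable w g" and h: "l1_summable w h"
  shows "elem (\<lambda>i. g i + h i) = coorbit_add 1 \<Psi> w (elem g) (elem h)"
  by (rule elem_eqI[symmetric])
    (simp_all add: coorbit_add_1 elem g h l1_add(1)[of w, OF w_pos] mat_vec_add_l1[OF schur_D])

lemma elem_scale:
  assumes g: "l1_summable w g"
  shows "elem (\<lambda>i. k * g i) = coorbit_scale 1 \<Psi> w k (elem g)"
  by (rule elem_eqI[symmetric]) (simp_all add: coorbit_scale_1 elem g l1_scale(1) mat_vec_scale[OF schur_D])

text \<open>The parametrisation is redundant: \<open>g\<close> and \<open>P g\<close> give the same element, as \<open>D P = D\<close>.\<close>

lemma elem_projection: "elem (mat_vec P (mat_one i)) = elem (mat_one i)"
proof (rule elem_eqI[symmetric])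
  show "elem (mat_one i) \<in> coorbit 1 \<Psi> w" by (rule elem(1)[OF l1_summable_mat_one])
  show "l1_summable w (mat_vec P (mat_one i))" by (rule schur_l1(1)[OF schur_P l1_summable_mat_one])
  show "ext (elem (mat_one i)) = mat_vec D (mat_vec P (mat_one i))"
    by (simp add: mat_vec_assoc_l1[OF schur_D schur_P l1_summable_mat_one] D_P elem(2)[OF l1_summable_mat_one])
qed

lemma coorbit_inf_norm:
  "0 \<le> M \<Longrightarrow> coorbit_norm \<infinity> \<Psi> v X \<le> ennreal M \<longleftrightarrow> (\<forall>i. cmod (ext X i) \<le> M * w i)"
  unfolding coorbit_norm_def coorbit_norm_wrt_def by (rule lp_norm_inf_le_iff[of w, OF w_pos])

lemma P_cnj: "cnj (P i j) = P j i"
  by (rule schur_cnj[OF schur_P, symmetric])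

text \<open>The pairing with \<open>\<phi>\<^sub>i\<close> recovers the \<open>i\<close>-th coefficient, since \<open>\<langle>\<phi>\<^sub>i, \<psi>\<^sub>j\<rangle>\<close> is an entry
of \<open>P\<close>. This is why the kernel identity determines both the operator and the kernel.\<close>

lemma pairing_elem_mat_one:
  assumes "mat_vec P d = d"
  shows "(\<Sum>\<^sub>\<infinity>j. d j * cnj (ext_analysis \<Psi> (elem (mat_one i)) j)) = d i"
proof -
  have "(\<Sum>\<^sub>\<infinity>j. d j * cnj (ext_analysis \<Psi> (elem (mat_one i)) j)) = mat_vec P d i"
    unfolding elem(3)[OF l1_summable_mat_one] mat_vec_mat_one mat_vec_def[of P d] P_cnj
    by (simp only: mult.commute)
  then show ?thesis using assms by simp
qed

end

text \<open>The discrete integral operator with kernel \<open>k\<close>; it acts on the frame coefficients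
\<open>\<langle>f, \<psi>\<^sub>i\<rangle>\<close> and produces coefficients with respect to the dual frame.\<close>

definition kernel_action :: "('i \<times> 'j \<Rightarrow> complex) \<Rightarrow> ('i \<Rightarrow> complex) \<Rightarrow> 'j \<Rightarrow> complex" where
  "kernel_action k g j = (\<Sum>\<^sub>\<infinity>i. k (i, j) * g i)"

locale kernel_setting = s1: dual_system \<Psi> w B + s2: dual_system \<Psi>' w' B'
  for \<Psi> :: "'i::countable \<Rightarrow> 'a::complex_inner" and w B
    and \<Psi>' :: "'j::countable \<Rightarrow> 'b::complex_inner" and w' B'
begin

sublocale t: coefficient_system "tensor_family \<Psi> \<Psi>'" "tensor_family (dual_frame \<Psi>) (dual_frame \<Psi>')"
  "tensor_weight w w'" "B * B'"
  by (rule tensor_coefficient_system) unfold_locales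

abbreviation "H1 \<equiv> coorbit 1 \<Psi> w"
abbreviation "H2 \<equiv> coorbit 1 \<Psi>' w'"
abbreviation "Hinf \<equiv> coorbit \<infinity> \<Psi>' (\<lambda>j. 1 / w' j)"
abbreviation "Kinf \<equiv> tensor_coorbit \<infinity> \<Psi> \<Psi>' (\<lambda>k. 1 / tensor_weight w w' k)"
abbreviation "ops \<equiv> bounded_coorbit_ops 1 \<Psi> w \<infinity> \<Psi>' (\<lambda>j. 1 / w' j)"
abbreviation "op_norm \<equiv> coorbit_op_norm 1 \<Psi> w \<infinity> \<Psi>' (\<lambda>j. 1 / w' j)"
abbreviation "K_norm \<equiv> tensor_coorbit_norm \<infinity> \<Psi> \<Psi>' (\<lambda>k. 1 / tensor_weight w w' k)"
abbreviation "ext2 \<equiv> ext_analysis (dual_frame \<Psi>')"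
abbreviation "extT \<equiv> ext_analysis (tensor_family (dual_frame \<Psi>) (dual_frame \<Psi>'))"
abbreviation "norm1 \<equiv> coorbit_norm 1 \<Psi> w"
abbreviation "norm_inf \<equiv> coorbit_norm \<infinity> \<Psi>' (\<lambda>j. 1 / w' j)"
abbreviation "is_kernel \<equiv> kernel_of \<Psi> \<Psi>' w w'"

text \<open>The element \<open>f\<^sub>1 \<otimes> f\<^sub>2\<close> exists because its prescribed coefficients are summable and fixed by the
projection; its frame coefficients factor since the Gram matrix is a tensor product.\<close>

lemma coorbit_tensor:
  assumes f1: "f\<^sub>1 \<in> H1" and f2: "f\<^sub>2 \<in> H2"
  shows "ext_analysis (tensor_family \<Psi> \<Psi>') (coorbit_tensor \<Psi> \<Psi>' w w' f\<^sub>1 f\<^sub>2) =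
    tensor_coeffs (ext_analysis \<Psi> f\<^sub>1) (ext_analysis \<Psi>' f\<^sub>2)"
proof -
  note c1 = s1.coorbit_1_coeffs[OF f1[unfolded coorbit_def]] and c2 = s2.coorbit_1_coeffs[OF f2[unfolded coorbit_def]]
  let ?c = "tensor_coeffs (ext_analysis (dual_frame \<Psi>) f\<^sub>1) (ext2 f\<^sub>2)"
  have s: "l1_summable (tensor_weight w w') ?c"
    by (rule l1_summable_tensor[OF s1.w_pos s2.w_pos c1(1) c2(1)])
  have Pc: "mat_vec (cross_gram (tensor_family \<Psi> \<Psi>') (tensor_family (dual_frame \<Psi>) (dual_frame \<Psi>'))) ?c = ?c"
    unfolding cross_gram_tensor mat_vec_tensor[OF s1.schur_P s2.schur_P c1(1) c2(1)] c1(2) c2(2) ..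
  obtain F where F: "F \<in> tensor_coorbit 1 \<Psi> \<Psi>' (tensor_weight w w')" "extT F = ?c"
    using t.coorbit_1_exists[OF s] unfolding Pc tensor_coorbit_def by blast
  have "coorbit_tensor \<Psi> \<Psi>' w w' f\<^sub>1 f\<^sub>2 = F"
    unfolding coorbit_tensor_def
  proof (rule the_equality)
    show "F \<in> tensor_coorbit 1 \<Psi> \<Psi>' (tensor_weight w w') \<and> (\<forall>i j. extT F (i, j) =
        cnj (ext_analysis (dual_frame \<Psi>) f\<^sub>1 i) * ext2 f\<^sub>2 j)"
      using F by (simp add: tensor_coeffs_def)
  next
    fix F' assume F': "F' \<in> tensor_coorbit 1 \<Psi> \<Psi>' (tensor_weight w w') \<and> (\<forall>i j. extT F' (i, j) =
        cnj (ext_analysis (dual_frame \<Psi>) f\<^sub>1 i) * ext2 f\<^sub>2 j)"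
    then have "extT F' = extT F" unfolding F(2) by (auto simp: tensor_coeffs_def)
    then show "F' = F"
      using F' F(1) t.one.class_eqI unfolding tensor_coorbit_def coorbit_wrt_def by blast
  qed
  then show ?thesis
    using t.coorbit_1_coeffs(3)[OF F(1)[unfolded tensor_coorbit_def]]
    by (simp add: F(2) gram_tensor mat_vec_tensor[OF s1.schur_G s2.schur_G c1(1) c2(1)] c1(3) c2(3))
qed

lemma bounded_kernel_Fubini:
  assumes k: "\<And>i j. cmod (k (i, j)) \<le> M * (w i * w' j)" and g: "l1_summable w g" and h: "l1_summable w' h"
  shows "(\<Sum>\<^sub>\<infinity>(i, j). k (i, j) * (g i * h j)) = (\<Sum>\<^sub>\<infinity>j. kernel_action k g j * h j)"
proof -
  have le: "norm (k (i, j) * (g i * h j)) \<le> (M * (cmod (g i) * w i)) * (cmod (h j) * w' j)" for i j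
    using mult_right_mono[OF k[of i j], of "cmod (g i) * cmod (h j)"] by (simp add: norm_mult mult_ac)
  have hs: "(\<lambda>j. (M * (cmod (g i) * w i)) * (cmod (h j) * w' j)) summable_on UNIV" for i
    using h unfolding l1_summable_def by (rule summable_on_cmult_right)
  have row: "(\<lambda>j. norm (k (i, j) * (g i * h j))) summable_on UNIV" for i
    by (rule Infinite_Sum.abs_summable_on_comparison_test'[OF hs le])
  have row_le: "(\<Sum>\<^sub>\<infinity>j. norm (k (i, j) * (g i * h j))) \<le> (cmod (g i) * w i) * (M * l1_norm w' h)" for i
  proof -
    have "(\<Sum>\<^sub>\<infinity>j. norm (k (i, j) * (g i * h j))) \<le> (M * (cmod (g i) * w i)) * l1_norm w' h"
      using infsum_mono[OF row hs le, of i] by (simp only: infsum_cmult_right' l1_norm_def)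
    then show ?thesis by (simp add: mult_ac)
  qed
  have gs: "(\<lambda>i. (cmod (g i) * w i) * (M * l1_norm w' h)) summable_on UNIV"
    using g unfolding l1_summable_def by (rule summable_on_cmult_left)
  note F = dominated_Fubini[OF row gs row_le]
  have s: "(\<lambda>(i, j). k (i, j) * (g i * h j)) summable_on UNIV \<times> UNIV"
    by (rule abs_summable_summable) (use F(5) in \<open>simp add: case_prod_unfold\<close>)
  have "(\<Sum>\<^sub>\<infinity>(i, j). k (i, j) * (g i * h j)) = (\<Sum>\<^sub>\<infinity>i. \<Sum>\<^sub>\<infinity>j. k (i, j) * (g i * h j))"
    using infsum_Sigma'_banach[OF s] by simp
  also have "\<dots> = (\<Sum>\<^sub>\<infinity>j. \<Sum>\<^sub>\<infinity>i. k (i, j) * (g i * h j))" by (rule F(4)[symmetric])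
  also have "\<dots> = (\<Sum>\<^sub>\<infinity>j. kernel_action k g j * h j)"
    unfolding kernel_action_def mult.assoc[symmetric] by (simp add: infsum_cmult_left')
  finally show ?thesis .
qed

lemma kernel_action_bound:
  assumes k: "\<And>i j. cmod (k (i, j)) \<le> M * (w i * w' j)" and g: "l1_summable w g"
  shows "(\<lambda>i. norm (k (i, j) * g i)) summable_on UNIV"
    and "cmod (kernel_action k g j) \<le> (M * l1_norm w g) * w' j"
proof -
  have le: "norm (k (i, j) * g i) \<le> (cmod (g i) * w i) * (M * w' j)" for i
    using mult_right_mono[OF k[of i j], of "cmod (g i)"] by (simp add: norm_mult mult_ac)
  have gs: "(\<lambda>i. (cmod (g i) * w i) * (M * w' j)) summable_on UNIV"
    using g unfolding l1_summable_def by (rule summable_on_cmult_left)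
  show s: "(\<lambda>i. norm (k (i, j) * g i)) summable_on UNIV"
    by (rule Infinite_Sum.abs_summable_on_comparison_test'[OF gs le])
  show "cmod (kernel_action k g j) \<le> (M * l1_norm w g) * w' j"
  proof -
    have "(\<Sum>\<^sub>\<infinity>i. norm (k (i, j) * g i)) \<le> l1_norm w g * (M * w' j)"
      using infsum_mono[OF s gs le] by (simp only: infsum_cmult_left' l1_norm_def)
    then show ?thesis
      using norm_infsum_bound[OF s] unfolding kernel_action_def by (simp add: mult_ac)
  qed
qed

text \<open>This makes \<open>kernel_action k g\<close> the coefficient family of an element of the co-orbit space of the
second frame.\<close>

lemma projection_kernel_action:
  assumes k: "\<And>i j. cmod (k (i, j)) \<le> M * (w i * w' j)" and g: "l1_summable w g"
    and P2: "\<And>i. mat_vec s2.P (\<lambda>j. k (i, j)) = (\<lambda>j. k (i, j))"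
  shows "mat_vec s2.P (kernel_action k g) = kernel_action k g"
proof
  fix j
  let ?f = "\<lambda>i j'. s2.P j j' * k (i, j') * g i"
  have k': "cmod (k (i, j')) \<le> (M * w i) * w' j'" for i j' using k[of i j'] by (simp add: mult.assoc)
  have row: "(\<lambda>j'. norm (?f i j')) summable_on UNIV" for i
    unfolding norm_mult[of _ "g i"] by (rule summable_on_cmult_left[OF schur_bounded(1)[OF s2.schur_P k']])
  have le: "(\<Sum>\<^sub>\<infinity>j'. norm (?f i j')) \<le> (cmod (g i) * w i) * (B' * M * w' j)" for i
    unfolding norm_mult[of _ "g i"] infsum_cmult_left'
    using mult_right_mono[OF schur_bounded(2)[OF s2.schur_P k', of j i], of "cmod (g i)"] by (simp add: mult_ac)
  have gs: "(\<lambda>i. (cmod (g i) * w i) * (B' * M * w' j)) summable_on UNIV"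
    using g unfolding l1_summable_def by (rule summable_on_cmult_left)
  have "mat_vec s2.P (kernel_action k g) j = (\<Sum>\<^sub>\<infinity>j'. \<Sum>\<^sub>\<infinity>i. ?f i j')"
    unfolding mat_vec_def kernel_action_def mult.assoc by (simp add: infsum_cmult_right')
  also have "\<dots> = (\<Sum>\<^sub>\<infinity>i. \<Sum>\<^sub>\<infinity>j'. ?f i j')" by (rule dominated_Fubini(4)[OF row gs le])
  also have "\<dots> = (\<Sum>\<^sub>\<infinity>i. mat_vec s2.P (\<lambda>j. k (i, j)) j * g i)"
    by (simp add: mat_vec_def infsum_cmult_left')
  finally show "mat_vec s2.P (kernel_action k g) j = kernel_action k g j"
    by (simp add: P2 kernel_action_def)
qed

text \<open>The projection of the tensor product may be applied in one variable after the other, in either order.\<close>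

lemma tensor_projection_iterated:
  assumes k: "\<And>i j. cmod (k (i, j)) \<le> M * (w i * w' j)"
  shows "mat_vec t.P k (i, j) = mat_vec s2.P (\<lambda>j'. \<Sum>\<^sub>\<infinity>i'. cnj (s1.P i i') * k (i', j')) j"
    and "mat_vec t.P k (i, j) = (\<Sum>\<^sub>\<infinity>i'. cnj (s1.P i i') * mat_vec s2.P (\<lambda>j'. k (i', j')) j)"
proof -
  have k': "cmod (k p) \<le> M * tensor_weight w w' p" for p
    using k by (cases p) (simp add: tensor_weight_def)
  let ?f = "\<lambda>i' j'. cnj (s1.P i i') * s2.P j j' * k (i', j')"
  have eq: "(\<lambda>q. t.P (i, j) q * k q) = (\<lambda>(i', j'). ?f i' j')"
    unfolding cross_gram_tensor by (auto simp: tensor_matrix_def)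
  have s: "(\<lambda>(i', j'). ?f i' j') summable_on UNIV \<times> UNIV"
    using abs_summable_summable[OF schur_bounded(1)[OF t.schur_P k', of "(i, j)"]] unfolding eq by simp
  have P: "mat_vec t.P k (i, j) = (\<Sum>\<^sub>\<infinity>(i', j'). ?f i' j')" unfolding mat_vec_def eq ..
  also have "\<dots> = (\<Sum>\<^sub>\<infinity>i'. \<Sum>\<^sub>\<infinity>j'. ?f i' j')" using infsum_Sigma'_banach[OF s] by simp
  finally have it: "mat_vec t.P k (i, j) = (\<Sum>\<^sub>\<infinity>i'. \<Sum>\<^sub>\<infinity>j'. ?f i' j')" .
  then show "mat_vec t.P k (i, j) = (\<Sum>\<^sub>\<infinity>i'. cnj (s1.P i i') * mat_vec s2.P (\<lambda>j'. k (i', j')) j)"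
    by (simp add: mat_vec_def mult.assoc infsum_cmult_right')
  have "mat_vec t.P k (i, j) = (\<Sum>\<^sub>\<infinity>j'. \<Sum>\<^sub>\<infinity>i'. s2.P j j' * (cnj (s1.P i i') * k (i', j')))"
    unfolding it infsum_swap_banach[OF s] by (simp add: mult_ac)
  then show "mat_vec t.P k (i, j) = mat_vec s2.P (\<lambda>j'. \<Sum>\<^sub>\<infinity>i'. cnj (s1.P i i') * k (i', j')) j"
    by (simp add: mat_vec_def infsum_cmult_right')
qed

text \<open>A family fixed by the projection of the tensor product is fixed by the projections in each variable,
because these are idempotent. The second claim is this property for the first variable, read as the
value of the kernel on the dual frame vector \<open>\<phi>\<^sub>i\<close>.\<close>

lemma kernel_slices:
  assumes k: "\<And>i j. cmod (k (i, j)) \<le> M * (w i * w' j)" and Pk: "mat_vec t.P k = k"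
  shows "mat_vec s2.P (\<lambda>j. k (i, j)) = (\<lambda>j. k (i, j))"
    and "kernel_action k (mat_vec s1.P (mat_one i)) j = k (i, j)"
proof -
  let ?h = "\<lambda>i j'. \<Sum>\<^sub>\<infinity>i'. cnj (s1.P i i') * k (i', j')"
  have h: "cmod (?h i j') \<le> (B * M * w i) * w' j'" for i j'
  proof -
    have "cmod (cnj (k (i', j'))) \<le> (M * w' j') * w i'" for i' using k[of i' j'] by (simp add: mult_ac)
    from schur_bounded(3)[OF s1.schur_P this, of i]
    have "cmod (\<Sum>\<^sub>\<infinity>i'. s1.P i i' * cnj (k (i', j'))) \<le> B * (M * w' j') * w i" by (simp add: mat_vec_def)
    moreover have "?h i j' = cnj (\<Sum>\<^sub>\<infinity>i'. s1.P i i' * cnj (k (i', j')))"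
      by (simp flip: infsum_cnj)
    ultimately show ?thesis by (simp add: mult_ac)
  qed
  have kh: "(\<lambda>j. k (i, j)) = mat_vec s2.P (?h i)" for i
    by (rule ext) (simp only: tensor_projection_iterated(1)[OF k, symmetric] Pk)
  show sl: "mat_vec s2.P (\<lambda>j. k (i, j)) = (\<lambda>j. k (i, j))" for i
    unfolding kh[of i] mat_vec_assoc_bounded[OF s2.schur_P s2.schur_P h] s2.P_P ..
  have "k (i, j) = (\<Sum>\<^sub>\<infinity>i'. cnj (s1.P i i') * k (i', j))"
    using Pk tensor_projection_iterated(2)[OF k, of i j] by (simp add: sl)
  also have "\<dots> = kernel_action k (mat_vec s1.P (mat_one i)) j"
    unfolding kernel_action_def mat_vec_mat_one
    by (intro infsum_cong) (simp add: s1.P_cnj mult.commute)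
  finally show "kernel_action k (mat_vec s1.P (mat_one i)) j = k (i, j)" by simp
qed

lemma kernel_coeffs:
  assumes K: "K \<in> Kinf"
  shows "\<exists>M\<ge>0. \<forall>i j. cmod (extT K (i, j)) \<le> M * (w i * w' j)" and "mat_vec t.P (extT K) = extT K"
  using t.coorbit_inf_coeffs[OF K[unfolded tensor_coorbit_def]] by (auto simp: tensor_weight_def)

lemma K_norm_le_iff:
  assumes "0 \<le> M"
  shows "K_norm K \<le> ennreal M \<longleftrightarrow> (\<forall>i j. cmod (extT K (i, j)) \<le> M * (w i * w' j))"
  unfolding tensor_coorbit_norm_def coorbit_norm_wrt_def
  using lp_norm_inf_le_iff[of "tensor_weight w w'", OF t.w_pos assms] by (simp add: tensor_weight_def)

lemma kernel_eqI: "K \<in> Kinf \<Longrightarrow> K' \<in> Kinf \<Longrightarrow> extT K = extT K' \<Longrightarrow> K = K'"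
  using t.inf.class_eqI unfolding tensor_coorbit_def coorbit_wrt_def by blast

text \<open>The kernel identity in coordinates. Test elements \<open>\<phi>\<^sub>j\<close> of the second space suffice to deduce the
equality of coefficients, because both sides are fixed by the projection.\<close>

lemma kernel_of_iff:
  assumes K: "K \<in> Kinf" and T: "\<And>f. f \<in> H1 \<Longrightarrow> T f \<in> Hinf"
  shows "is_kernel K T \<longleftrightarrow>
    (\<forall>f\<in>H1. ext2 (T f) = kernel_action (extT K) (ext_analysis \<Psi> f))"
proof -
  let ?k = "extT K"
  obtain M where k: "\<And>i j. cmod (?k (i, j)) \<le> M * (w i * w' j)" using kernel_coeffs(1)[OF K] by blast
  note Pk = kernel_coeffs(2)[OF K]
  have tp: "tensor_coorbit_pairing \<Psi> \<Psi>' K (coorbit_tensor \<Psi> \<Psi>' w w' f\<^sub>1 f\<^sub>2) =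
      (\<Sum>\<^sub>\<infinity>j. kernel_action ?k (ext_analysis \<Psi> f\<^sub>1) j * cnj (ext_analysis \<Psi>' f\<^sub>2 j))"
    if f1: "f\<^sub>1 \<in> H1" and f2: "f\<^sub>2 \<in> H2" for f\<^sub>1 f\<^sub>2
  proof -
    have h: "l1_summable w' (\<lambda>j. cnj (ext_analysis \<Psi>' f\<^sub>2 j))"
      using s2.coorbit_1_analysis(1)[OF f2] by (simp add: l1_summable_def)
    show ?thesis
      unfolding tensor_coorbit_pairing_def coorbit_pairing_wrt_def coorbit_tensor[OF f1 f2]
        bounded_kernel_Fubini[OF k s1.coorbit_1_analysis(1)[OF f1] h, symmetric]
      by (intro infsum_cong) (auto simp: tensor_coeffs_def)
  qed
  show ?thesis
  proof
    assume L: "\<forall>f\<in>H1. ext2 (T f) = kernel_action ?k (ext_analysis \<Psi> f)"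
    then show "is_kernel K T"
      unfolding kernel_of_def by (simp add: tp coorbit_pairing_def coorbit_pairing_wrt_def)
  next
    assume ker: "is_kernel K T"
    show "\<forall>f\<in>H1. ext2 (T f) = kernel_action ?k (ext_analysis \<Psi> f)"
    proof (intro ballI ext)
      fix f j assume f: "f \<in> H1"
      let ?e = "s2.elem (mat_one j)" and ?d = "kernel_action ?k (ext_analysis \<Psi> f)"
      have e: "?e \<in> H2" by (rule s2.elem(1)[OF l1_summable_mat_one])
      have "(\<Sum>\<^sub>\<infinity>j'. ext2 (T f) j' * cnj (ext_analysis \<Psi>' ?e j')) =
          (\<Sum>\<^sub>\<infinity>j'. ?d j' * cnj (ext_analysis \<Psi>' ?e j'))"
        using ker f e tp[OF f e] unfolding kernel_of_def by (simp add: coorbit_pairing_def coorbit_pairing_wrt_def)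
      moreover have "mat_vec s2.P (ext2 (T f)) = ext2 (T f)"
        using s2.coorbit_inf_coeffs(2) T[OF f] unfolding coorbit_def by blast
      moreover have "mat_vec s2.P ?d = ?d"
        by (rule projection_kernel_action[OF k s1.coorbit_1_analysis(1)[OF f] kernel_slices(1)[OF k Pk]])
      ultimately show "ext2 (T f) j = ?d j" by (simp only: s2.pairing_elem_mat_one)
    qed
  qed
qed

lemma opsD:
  assumes "T \<in> ops"
  shows "f \<in> H1 \<Longrightarrow> T f \<in> Hinf"
    and "f \<in> H1 \<Longrightarrow> g \<in> H1 \<Longrightarrow> ext2 (T (coorbit_add 1 \<Psi> w f g)) = (\<lambda>j. ext2 (T f) j + ext2 (T g) j)"
    and "f \<in> H1 \<Longrightarrow> ext2 (T (coorbit_scale 1 \<Psi> w c f)) = (\<lambda>j. c * ext2 (T f) j)"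
    and "\<exists>C\<ge>0. \<forall>f\<in>H1. norm_inf (T f) \<le> ennreal C * norm1 f"
proof -
  show T: "f \<in> H1 \<Longrightarrow> T f \<in> Hinf" for f using assms unfolding bounded_coorbit_ops_def by blast
  show "f \<in> H1 \<Longrightarrow> g \<in> H1 \<Longrightarrow> ext2 (T (coorbit_add 1 \<Psi> w f g)) = (\<lambda>j. ext2 (T f) j + ext2 (T g) j)"
    using assms s2.coorbit_add_inf(2)[OF T T] unfolding bounded_coorbit_ops_def by simp
  show "f \<in> H1 \<Longrightarrow> ext2 (T (coorbit_scale 1 \<Psi> w c f)) = (\<lambda>j. c * ext2 (T f) j)"
    using assms s2.coorbit_scale_inf(2)[OF T] unfolding bounded_coorbit_ops_def by simp
  obtain C where C: "\<forall>f\<in>H1. norm_inf (T f) \<le> ennreal C * norm1 f"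
    using assms unfolding bounded_coorbit_ops_def by blast
  have "ennreal C * x \<le> ennreal (max C 0) * x" for x by (intro mult_right_mono ennreal_leI) auto
  then show "\<exists>C\<ge>0. \<forall>f\<in>H1. norm_inf (T f) \<le> ennreal C * norm1 f"
    using C by (intro exI[of _ "max C 0"]) (meson max.cobounded2 order_trans)
qed

text \<open>The factor \<open>B\<close> bounds the norm of the Gram matrix, which takes the coefficients of \<open>f\<close> that define its
norm to the frame coefficients on which the kernel acts.\<close>

lemma kernel_action_norm:
  assumes k: "\<And>i j. cmod (k (i, j)) \<le> M * (w i * w' j)" and M: "0 \<le> M" and f: "f \<in> H1"
    and Y: "ext2 Y = kernel_action k (ext_analysis \<Psi> f)"
  shows "norm_inf Y \<le> ennreal (M * B) * norm1 f"
proof -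
  let ?n = "l1_norm w (ext_analysis \<Psi> f)"
  note a = s1.coorbit_1_analysis[OF f]
  have n: "0 \<le> ?n" by (rule l1_norm_nonneg[of w, OF s1.w_pos])
  have "norm_inf Y \<le> ennreal (M * ?n)"
    using s2.coorbit_inf_norm[of "M * ?n"] kernel_action_bound(2)[OF k a(1)] M n by (simp add: Y)
  also have "\<dots> = ennreal M * ennreal ?n" using M n by (simp add: ennreal_mult)
  also have "\<dots> \<le> ennreal M * (ennreal B * norm1 f)" by (rule mult_left_mono[OF a(3)]) simp
  also have "\<dots> = ennreal (M * B) * norm1 f"
    using M schur_const_nonneg[OF s1.schur_P] by (simp add: ennreal_mult mult.assoc)
  finally show ?thesis .
qed

lemma operator_from_kernel:
  assumes K: "K \<in> Kinf"
  shows "\<exists>!T. T \<in> ops \<and> is_kernel K T"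
proof -
  let ?k = "extT K" and ?g = "ext_analysis \<Psi>"
  obtain M where M: "0 \<le> M" and k: "\<And>i j. cmod (?k (i, j)) \<le> M * (w i * w' j)"
    using kernel_coeffs(1)[OF K] by blast
  note Pk = kernel_coeffs(2)[OF K]
  have ex: "\<exists>Y. Y \<in> Hinf \<and> ext2 Y = kernel_action ?k (?g f)" if f: "f \<in> H1" for f
  proof -
    note g = s1.coorbit_1_analysis(1)[OF f]
    have "mat_vec s2.P (kernel_action ?k (?g f)) = kernel_action ?k (?g f)"
      by (rule projection_kernel_action[OF k g kernel_slices(1)[OF k Pk]])
    then show ?thesis
      using s2.coorbit_inf_exists[OF kernel_action_bound(2)[OF k g]] unfolding coorbit_def by auto
  qed
  define T where "T = (\<lambda>f\<in>H1. SOME Y. Y \<in> Hinf \<and> ext2 Y = kernel_action ?k (?g f))"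
  have T: "T f \<in> Hinf" "ext2 (T f) = kernel_action ?k (?g f)" if "f \<in> H1" for f
    using someI_ex[OF ex[OF that]] that unfolding T_def by simp_all
  have eqI: "Y = Z" if "Y \<in> Hinf" "Z \<in> Hinf" "ext2 Y = ext2 Z" for Y Z
    using s2.inf.class_eqI[of Y Z] that unfolding s2.coorbit_inf by blast
  have "T \<in> ops"
    unfolding bounded_coorbit_ops_def
  proof (intro CollectI conjI ballI allI exI[of _ "M * B"])
    show "T \<in> H1 \<rightarrow>\<^sub>E Hinf" using T(1) unfolding T_def by auto
    show "T (coorbit_add 1 \<Psi> w X Y) = coorbit_add \<infinity> \<Psi>' (\<lambda>j. 1 / w' j) (T X) (T Y)"
      if X: "X \<in> H1" and Y: "Y \<in> H1" for X Y
    proof (rule eqI)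
      show "T (coorbit_add 1 \<Psi> w X Y) \<in> Hinf" by (rule T(1)[OF s1.coorbit_add_1(1)[OF X Y]])
      show "coorbit_add \<infinity> \<Psi>' (\<lambda>j. 1 / w' j) (T X) (T Y) \<in> Hinf" by (rule s2.coorbit_add_inf(1)[OF T(1)[OF X] T(1)[OF Y]])
      have "kernel_action ?k (\<lambda>i. ?g X i + ?g Y i) = (\<lambda>j. kernel_action ?k (?g X) j + kernel_action ?k (?g Y) j)"
        unfolding kernel_action_def distrib_left
        by (intro ext infsum_add abs_summable_summable[OF kernel_action_bound(1)[OF k s1.coorbit_1_analysis(1)]] X Y)
      then show "ext2 (T (coorbit_add 1 \<Psi> w X Y)) = ext2 (coorbit_add \<infinity> \<Psi>' (\<lambda>j. 1 / w' j) (T X) (T Y))"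
        unfolding T(2)[OF s1.coorbit_add_1(1)[OF X Y]] s2.coorbit_add_inf(2)[OF T(1)[OF X] T(1)[OF Y]]
          T(2)[OF X] T(2)[OF Y] s1.ext_analysis_add_1[OF X Y] .
    qed
    show "T (coorbit_scale 1 \<Psi> w c X) = coorbit_scale \<infinity> \<Psi>' (\<lambda>j. 1 / w' j) c (T X)"
      if X: "X \<in> H1" for c X
    proof (rule eqI)
      show "T (coorbit_scale 1 \<Psi> w c X) \<in> Hinf" by (rule T(1)[OF s1.coorbit_scale_1(1)[OF X]])
      show "coorbit_scale \<infinity> \<Psi>' (\<lambda>j. 1 / w' j) c (T X) \<in> Hinf" by (rule s2.coorbit_scale_inf(1)[OF T(1)[OF X]])
      have "kernel_action ?k (\<lambda>i. c * ?g X i) = (\<lambda>j. c * kernel_action ?k (?g X) j)"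
        unfolding kernel_action_def mult.left_commute[of _ c] by (simp add: infsum_cmult_right')
      then show "ext2 (T (coorbit_scale 1 \<Psi> w c X)) = ext2 (coorbit_scale \<infinity> \<Psi>' (\<lambda>j. 1 / w' j) c (T X))"
        unfolding T(2)[OF s1.coorbit_scale_1(1)[OF X]] s2.coorbit_scale_inf(2)[OF T(1)[OF X]]
          T(2)[OF X] s1.ext_analysis_scale_1[OF X] .
    qed
    show "norm_inf (T X) \<le> ennreal (M * B) * norm1 X"
      if X: "X \<in> H1" for X by (rule kernel_action_norm[OF k M X T(2)[OF X]])
  qed
  moreover have "is_kernel K T" using T by (subst kernel_of_iff[OF K]) auto
  moreover have "T' = T" if T': "T' \<in> ops" and ker: "is_kernel K T'" for T'
  proof (rule extensionalityI[of _ H1])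
    show "T' \<in> extensional H1" using T' unfolding bounded_coorbit_ops_def by (auto simp: PiE_def)
    show "T \<in> extensional H1" unfolding T_def by simp
    show "T' f = T f" if f: "f \<in> H1" for f
      by (rule eqI) (use opsD(1)[OF T'] T f ker kernel_of_iff[OF K opsD(1)[OF T']] in auto)
  qed
  ultimately show ?thesis by blast
qed

text \<open>\<open>k\<^sub>i\<^sub>j = (O \<phi>\<^sub>i)\<^sub>j\<close>: a kernel is determined by its operator.\<close>

lemma kernel_coeffs_from_operator:
  assumes K: "K \<in> Kinf" and T: "T \<in> ops" and ker: "is_kernel K T"
  shows "extT K (i, j) = ext2 (T (s1.elem (mat_one i))) j"
proof -
  obtain M where k: "\<And>i j. cmod (extT K (i, j)) \<le> M * (w i * w' j)" using kernel_coeffs(1)[OF K] by blast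
  have "ext2 (T (s1.elem (mat_one i))) = kernel_action (extT K) (mat_vec s1.P (mat_one i))"
    using bspec[OF iffD1[OF kernel_of_iff[OF K opsD(1)[OF T]] ker] s1.elem(1)[OF l1_summable_mat_one[of w i]]]
    unfolding s1.elem(3)[OF l1_summable_mat_one] .
  then show ?thesis using kernel_slices(2)[OF k kernel_coeffs(2)[OF K]] by simp
qed

text \<open>One estimate bounds \<open>O f\<close> by the kernel; the other one evaluates \<open>O\<close> on the dual frame vectors, whose
norms are at most \<open>B w\<^sub>i\<close>.\<close>

lemma norm_equivalence:
  assumes K: "K \<in> Kinf" and T: "T \<in> ops" and ker: "is_kernel K T"
  defines "C \<equiv> max 1 B"
  shows "ennreal (1 / C) * op_norm T \<le> K_norm K" and "K_norm K \<le> ennreal C * op_norm T"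
proof -
  have C: "1 \<le> C" "B \<le> C" by (auto simp: C_def)
  obtain M0 where "0 \<le> M0" "\<And>i j. cmod (extT K (i, j)) \<le> M0 * (w i * w' j)"
    using kernel_coeffs(1)[OF K] by blast
  then have "K_norm K \<le> ennreal M0" using K_norm_le_iff by blast
  then have "K_norm K < top" by (rule le_less_trans) simp
  then obtain M where M: "0 \<le> M" "K_norm K = ennreal M" unfolding less_top_ennreal by blast
  then have k: "\<And>i j. cmod (extT K (i, j)) \<le> M * (w i * w' j)" using K_norm_le_iff[of M K] by simp
  have "op_norm T \<le> ennreal (M * B)"
    unfolding coorbit_op_norm_def
  proof (rule SUP_least)
    fix f assume "f \<in> {f \<in> H1. norm1 f \<le> 1}"
    then have f: "f \<in> H1" "norm1 f \<le> 1" by auto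
    have "ext2 (T f) = kernel_action (extT K) (ext_analysis \<Psi> f)"
      by (rule bspec[OF iffD1[OF kernel_of_iff[OF K opsD(1)[OF T]] ker] f(1)])
    from kernel_action_norm[OF k M(1) f(1) this]
    have "norm_inf (T f) \<le> ennreal (M * B) * norm1 f" .
    also have "\<dots> \<le> ennreal (M * B) * 1" by (rule mult_left_mono[OF f(2)]) simp
    finally show "norm_inf (T f) \<le> ennreal (M * B)" by simp
  qed
  also have "ennreal (M * B) \<le> ennreal (M * C)" using M(1) C by (intro ennreal_leI mult_left_mono)
  finally have op: "op_norm T \<le> ennreal (M * C)" .
  then have "ennreal (1 / C) * op_norm T \<le> ennreal (1 / C) * ennreal (M * C)" by (rule mult_left_mono) simp
  also have "\<dots> = ennreal M" using C M(1) by (simp add: ennreal_mult[symmetric])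
  finally show "ennreal (1 / C) * op_norm T \<le> K_norm K" using M(2) by simp
  have "op_norm T < top" using op by (rule le_less_trans) simp
  then obtain m where m: "0 \<le> m" "op_norm T = ennreal m" unfolding less_top_ennreal by blast
  have "cmod (extT K (i, j)) \<le> (C * m) * (w i * w' j)" for i j
  proof -
    \<comment> \<open>\<open>\<phi>\<^sub>i / (C w\<^sub>i)\<close> lies in the unit ball over which the operator norm is the supremum;
      \<open>C \<ge> 1\<close> keeps the divisor positive even if \<open>B = 0\<close>.\<close>
    let ?r = "C * w i"
    have r: "0 < ?r" using C s1.w_pos[of i] by simp
    let ?e = "s1.elem (\<lambda>i'. complex_of_real (1 / ?r) * mat_one i i')"
    have l1: "l1_summable w (\<lambda>i'. complex_of_real (1 / ?r) * mat_one i i')"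
      by (rule l1_scale(1)[OF l1_summable_mat_one])
    have "l1_norm w (\<lambda>i'. complex_of_real (1 / ?r) * mat_one i i') = 1 / ?r * w i"
      using s1.w_pos[of i] C by (subst l1_scale(2)[OF l1_summable_mat_one]) (simp add: l1_norm_mat_one norm_divide norm_mult)
    then have "B * l1_norm w (\<lambda>i'. complex_of_real (1 / ?r) * mat_one i i') = B / C"
      using s1.w_pos[of i] C by simp
    also have "\<dots> \<le> 1" using C by simp
    finally have e1: "norm1 ?e \<le> 1"
      using s1.coorbit_norm_elem[OF l1] by (metis ennreal_1 ennreal_leI order_trans)
    have "norm_inf (T ?e) \<le> ennreal m"
      unfolding m(2)[symmetric] coorbit_op_norm_def
      by (rule SUP_upper) (use e1 s1.elem(1)[OF l1] in simp)
    then have "cmod (ext2 (T ?e) j) \<le> m * w' j" using s2.coorbit_inf_norm[OF m(1)] by blast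
    moreover have "ext2 (T ?e) j = complex_of_real (1 / ?r) * extT K (i, j)"
      unfolding s1.elem_scale[OF l1_summable_mat_one] kernel_coeffs_from_operator[OF K T ker]
        opsD(3)[OF T s1.elem(1)[OF l1_summable_mat_one]] ..
    ultimately have "cmod (extT K (i, j)) / ?r \<le> m * w' j"
      using C s1.w_pos[of i] by (simp add: norm_mult norm_divide)
    then show ?thesis using r by (simp add: divide_le_eq mult_ac)
  qed
  then have "K_norm K \<le> ennreal (C * m)" using K_norm_le_iff[of "C * m" K] C m(1) by simp
  then show "K_norm K \<le> ennreal C * op_norm T" using C m by (simp add: ennreal_mult)
qed

text \<open>The candidate \<open>k\<^sub>i\<^sub>j = (O \<phi>\<^sub>i)\<^sub>j\<close> represents \<open>O\<close> since the expansion of \<open>f\<close> in the dual frame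
converges in norm. It is fixed by the projection of the tensor product: in the second variable because
\<open>O \<phi>\<^sub>i\<close> is an element of the co-orbit space, in the first one because \<open>elem\<close> does not distinguish
the unit vector from its projection.\<close>

lemma kernel_from_operator:
  assumes T: "T \<in> ops"
  shows "\<exists>!K. K \<in> Kinf \<and> is_kernel K T"
proof -
  define k where "k = (\<lambda>(i, j). ext2 (T (s1.elem (mat_one i))) j)"
  obtain C where C: "0 \<le> C" "\<And>f. f \<in> H1 \<Longrightarrow>
      norm_inf (T f) \<le> ennreal C * norm1 f"
    using opsD(4)[OF T] by blast
  have B: "0 \<le> B" by (rule schur_const_nonneg[OF s1.schur_P])
  have bound: "cmod (ext2 (T (s1.elem g)) j) \<le> (C * B * w' j) * l1_norm w g" if g: "l1_summable w g" for g j
  proof -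
    have n: "0 \<le> l1_norm w g" by (rule l1_norm_nonneg[of w, OF s1.w_pos])
    have "norm_inf (T (s1.elem g)) \<le> ennreal C * norm1 (s1.elem g)"
      by (rule C(2)[OF s1.elem(1)[OF g]])
    also have "\<dots> \<le> ennreal C * ennreal (B * l1_norm w g)"
      by (rule mult_left_mono[OF s1.coorbit_norm_elem[OF g]]) simp
    also have "\<dots> = ennreal (C * (B * l1_norm w g))" using C(1) B n by (simp add: ennreal_mult)
    finally have "cmod (ext2 (T (s1.elem g)) j) \<le> (C * (B * l1_norm w g)) * w' j"
      using s2.coorbit_inf_norm[of "C * (B * l1_norm w g)"] C(1) B n by simp
    then show ?thesis by (simp add: mult_ac)
  qed
  have k: "cmod (k (i, j)) \<le> (C * B) * (w i * w' j)" for i j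
    using bound[OF l1_summable_mat_one, of i j] by (simp add: k_def l1_norm_mat_one mult_ac)
  have action: "ext2 (T (s1.elem g)) = kernel_action k g" if g: "l1_summable w g" for g
  proof
    fix j
    have "((\<lambda>i. g i * ext2 (T (s1.elem (mat_one i))) j) has_sum ext2 (T (s1.elem g)) j) UNIV"
      by (rule l1_functional_has_sum[of w "\<lambda>g. ext2 (T (s1.elem g)) j", OF s1.w_pos _ _ bound g])
        (simp_all add: s1.elem_add s1.elem_scale opsD(2,3)[OF T] s1.elem(1))
    then show "ext2 (T (s1.elem g)) j = kernel_action k g j"
      unfolding kernel_action_def k_def by (simp add: infsumI mult.commute)
  qed
  have P2: "mat_vec s2.P (\<lambda>j. k (i, j)) = (\<lambda>j. k (i, j))" for i
    using s2.coorbit_inf_coeffs(2)[of "T (s1.elem (mat_one i))"] opsD(1)[OF T s1.elem(1)[OF l1_summable_mat_one]]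
    unfolding coorbit_def k_def by simp
  have Pk: "mat_vec t.P k = k"
  proof
    fix p :: "'i \<times> 'j"
    obtain i j where p: "p = (i, j)" by (cases p)
    have "mat_vec t.P k (i, j) = (\<Sum>\<^sub>\<infinity>i'. cnj (s1.P i i') * k (i', j))"
      unfolding tensor_projection_iterated(2)[OF k] P2 ..
    also have "\<dots> = kernel_action k (mat_vec s1.P (mat_one i)) j"
      unfolding kernel_action_def mat_vec_mat_one
      by (intro infsum_cong) (simp add: s1.P_cnj mult.commute)
    also have "\<dots> = ext2 (T (s1.elem (mat_one i))) j"
      using action[OF schur_l1(1)[OF s1.schur_P l1_summable_mat_one], of i] by (simp add: s1.elem_projection)
    finally show "mat_vec t.P k p = k p" by (simp add: p k_def)
  qed
  have "cmod (k p) \<le> (C * B) * tensor_weight w w' p" for p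
    using k by (cases p) (simp add: tensor_weight_def)
  from t.coorbit_inf_exists[OF this]
  obtain K where K: "K \<in> Kinf" "extT K = k" unfolding Pk tensor_coorbit_def by blast
  have act: "ext2 (T f) = kernel_action (extT K) (ext_analysis \<Psi> f)" if f: "f \<in> H1" for f
    unfolding K(2) using action[OF s1.coorbit_1_analysis(1)[OF f]] s1.coorbit_1_analysis(2)[OF f] by simp
  have ker: "is_kernel K T"
    by (rule iffD2[OF kernel_of_iff[OF K(1) opsD(1)[OF T]]]) (auto intro: act)
  show ?thesis
  proof (rule ex1I[of _ K])
    show "K \<in> Kinf \<and> is_kernel K T" using K(1) ker by blast
    fix K' assume K': "K' \<in> Kinf \<and> is_kernel K' T"
    have "extT K' (i, j) = extT K (i, j)" for i j
      using kernel_coeffs_from_operator[OF _ T, of K' i j] kernel_coeffs_from_operator[OF K(1) T ker, of i j] K'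
      by simp
    then have "extT K' = extT K" by auto
    then show "K' = K" using kernel_eqI K' K(1) by blast
  qed
qed

end

theorem theorem4p1:
  fixes \<Psi>\<^sub>1 :: "'i::countable \<Rightarrow> 'a::{complex_hilbert, second_countable_topology}"
    and \<Psi>\<^sub>2 :: "'j::countable \<Rightarrow> 'b::{complex_hilbert, second_countable_topology}"
    and \<A>\<^sub>1 :: "'i matrix set" and N\<^sub>1 :: "'i matrix \<Rightarrow> real"
    and \<A>\<^sub>2 :: "'j matrix set" and N\<^sub>2 :: "'j matrix \<Rightarrow> real"
    and w\<^sub>1 :: "'i \<Rightarrow> real" and w\<^sub>2 :: "'j \<Rightarrow> real"
  assumes "spectral_matrix_algebra \<A>\<^sub>1 N\<^sub>1" and "spectral_matrix_algebra \<A>\<^sub>2 N\<^sub>2"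
    and "localised_frame \<A>\<^sub>1 \<Psi>\<^sub>1" and "localised_frame \<A>\<^sub>2 \<Psi>\<^sub>2"
    and "admissible_weight \<A>\<^sub>1 w\<^sub>1" and "admissible_weight \<A>\<^sub>2 w\<^sub>2"
  shows "(\<forall>K\<in>tensor_coorbit \<infinity> \<Psi>\<^sub>1 \<Psi>\<^sub>2 (\<lambda>k. 1 / tensor_weight w\<^sub>1 w\<^sub>2 k).
      \<exists>!T. T \<in> bounded_coorbit_ops 1 \<Psi>\<^sub>1 w\<^sub>1 \<infinity> \<Psi>\<^sub>2 (\<lambda>j. 1 / w\<^sub>2 j) \<and> kernel_of \<Psi>\<^sub>1 \<Psi>\<^sub>2 w\<^sub>1 w\<^sub>2 K T) \<and>
    (\<exists>C::real. C \<ge> 1 \<and>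
      (\<forall>K\<in>tensor_coorbit \<infinity> \<Psi>\<^sub>1 \<Psi>\<^sub>2 (\<lambda>k. 1 / tensor_weight w\<^sub>1 w\<^sub>2 k).
       \<forall>T\<in>bounded_coorbit_ops 1 \<Psi>\<^sub>1 w\<^sub>1 \<infinity> \<Psi>\<^sub>2 (\<lambda>j. 1 / w\<^sub>2 j).
         kernel_of \<Psi>\<^sub>1 \<Psi>\<^sub>2 w\<^sub>1 w\<^sub>2 K T \<longrightarrow>
         ennreal (1 / C) * coorbit_op_norm 1 \<Psi>\<^sub>1 w\<^sub>1 \<infinity> \<Psi>\<^sub>2 (\<lambda>j. 1 / w\<^sub>2 j) T
           \<le> tensor_coorbit_norm \<infinity> \<Psi>\<^sub>1 \<Psi>\<^sub>2 (\<lambda>k. 1 / tensor_weight w\<^sub>1 w\<^sub>2 k) K \<and>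
         tensor_coorbit_norm \<infinity> \<Psi>\<^sub>1 \<Psi>\<^sub>2 (\<lambda>k. 1 / tensor_weight w\<^sub>1 w\<^sub>2 k) K
           \<le> ennreal C * coorbit_op_norm 1 \<Psi>\<^sub>1 w\<^sub>1 \<infinity> \<Psi>\<^sub>2 (\<lambda>j. 1 / w\<^sub>2 j) T)) \<and>
    (\<forall>T\<in>bounded_coorbit_ops 1 \<Psi>\<^sub>1 w\<^sub>1 \<infinity> \<Psi>\<^sub>2 (\<lambda>j. 1 / w\<^sub>2 j).
      \<exists>!K. K \<in> tensor_coorbit \<infinity> \<Psi>\<^sub>1 \<Psi>\<^sub>2 (\<lambda>k. 1 / tensor_weight w\<^sub>1 w\<^sub>2 k) \<and>
        kernel_of \<Psi>\<^sub>1 \<Psi>\<^sub>2 w\<^sub>1 w\<^sub>2 K T)"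
proof -
  obtain B\<^sub>1 where "dual_system \<Psi>\<^sub>1 w\<^sub>1 B\<^sub>1" using localised_frame_dual_system assms(1,3,5) by blast
  moreover obtain B\<^sub>2 where "dual_system \<Psi>\<^sub>2 w\<^sub>2 B\<^sub>2" using localised_frame_dual_system assms(2,4,6) by blast
  ultimately interpret kernel_setting \<Psi>\<^sub>1 w\<^sub>1 B\<^sub>1 \<Psi>\<^sub>2 w\<^sub>2 B\<^sub>2 by (intro kernel_setting.intro)
  show ?thesis
    using operator_from_kernel norm_equivalence kernel_from_operator
    by (intro conjI ballI exI[of _ "max 1 B\<^sub>1"] impI) auto
qed

end
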